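(* Let $\lambda>0$, $G_0\in L^2(-1,1)$ and $\wp\in\mathbb{R}$. There exists at most one function $G\in C\big((0,\infty);L^2(-1,1)\big)\cap L^2_{\rm loc}\big((0,\infty);H^1_\rho(-1,1)\big)$ with $G(1,\cdot),G(-1,\cdot)\in L^2_{\rm loc}(0,\infty)$ which (weakly) solves $$\begin{cases}\dfrac{\partial G}{\partial t} = \dfrac{\lambda}{2}(1-x^2)\dfrac{\partial^2G}{\partial x^2}, & t>0,\ x\in(-1,1),\\ G(x,0)=G_0(x), & x\in(-1,1),\\ G(1,t)=1,\quad G(-1,t)=\wp, & t>0.\end{cases}$$
   Context: The weighted Sobolev space is $H^1_\rho(-1,1) := \{v\in L^2(-1,1): \sqrt{1-x^2}\,\partial_x v\in L^2(-1,1)\}$. The boundary values $G(\pm1,t)$ are understood as traces. *)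

theory Defs
  imports "HOL-Analysis.Analysis"
begin

definition I :: "real set" where "I = {-1<..<1}"

definition L2 :: "(real \<Rightarrow> real) \<Rightarrow> bool" where
  "L2 f \<longleftrightarrow> f \<in> borel_measurable (lebesgue_on I)
      \<and> integrable (lebesgue_on I) (\<lambda>x. (f x)^2)"

definition L2_norm :: "(real \<Rightarrow> real) \<Rightarrow> real" where
  "L2_norm f = sqrt (\<integral>x. (f x)^2 \<partial>lebesgue_on I)"

definition smooth1 :: "(real \<Rightarrow> real) \<Rightarrow> bool" where
  "smooth1 \<phi> \<longleftrightarrow> (\<forall>k x. ((deriv ^^ k) \<phi>) differentiable (at x))"

definition test1 :: "(real \<Rightarrow> real) \<Rightarrow> bool" where
  "test1 \<phi> \<longleftrightarrow> smooth1 \<phi> \<and>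
     (\<exists>a b. -1 < a \<and> b < 1 \<and> (\<forall>x. \<phi> x \<noteq> 0 \<longrightarrow> x \<in> {a..b}))"

definition weak_deriv :: "(real \<Rightarrow> real) \<Rightarrow> (real \<Rightarrow> real) \<Rightarrow> bool" where
  "weak_deriv v w \<longleftrightarrow>
     (\<forall>a b. -1 < a \<longrightarrow> b < 1 \<longrightarrow> integrable (lebesgue_on {a..b}) w) \<and>
     (\<forall>\<phi>. test1 \<phi> \<longrightarrow>
        (\<integral>x. v x * deriv \<phi> x \<partial>lebesgue_on I) = - (\<integral>x. w x * \<phi> x \<partial>lebesgue_on I))"

definition H1rho_with :: "(real \<Rightarrow> real) \<Rightarrow> (real \<Rightarrow> real) \<Rightarrow> bool" where
  "H1rho_with v w \<longleftrightarrow> L2 v \<and> weak_deriv v w \<and> L2 (\<lambda>x. sqrt (1 - x^2) * w x)"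

definition px :: "(real \<Rightarrow> real \<Rightarrow> real) \<Rightarrow> real \<Rightarrow> real \<Rightarrow> real" where
  "px f = (\<lambda>x t. deriv (\<lambda>y. f y t) x)"

definition pt :: "(real \<Rightarrow> real \<Rightarrow> real) \<Rightarrow> real \<Rightarrow> real \<Rightarrow> real" where
  "pt f = (\<lambda>x t. deriv (\<lambda>s. f x s) t)"

inductive_set partials :: "(real \<Rightarrow> real \<Rightarrow> real) \<Rightarrow> (real \<Rightarrow> real \<Rightarrow> real) set"
  for f where
  self: "f \<in> partials f"
| dx: "g \<in> partials f \<Longrightarrow> px g \<in> partials f"
| dt: "g \<in> partials f \<Longrightarrow> pt g \<in> partials f"

definition smooth2 :: "(real \<Rightarrow> real \<Rightarrow> real) \<Rightarrow> bool" where
  "smooth2 f \<longleftrightarrow> (\<forall>g\<in>partials f.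
      continuous_on UNIV (\<lambda>(x, t). g x t) \<and>
      (\<forall>x t. (\<lambda>y. g y t) differentiable (at x) \<and> (\<lambda>s. g x s) differentiable (at t)))"

definition test2 :: "(real \<Rightarrow> real \<Rightarrow> real) \<Rightarrow> bool" where
  "test2 \<phi> \<longleftrightarrow> smooth2 \<phi> \<and>
     (\<exists>a b c d. -1 < a \<and> b < 1 \<and> 0 < c \<and>
        (\<forall>x t. \<phi> x t \<noteq> 0 \<longrightarrow> x \<in> {a..b} \<and> t \<in> {c..d}))"

text \<open>G_t = (lam/2)(1-x^2) G_xx in the sense of distributions on (-1,1) x (0,infinity).\<close>
definition weak_eq :: "real \<Rightarrow> (real \<Rightarrow> real \<Rightarrow> real) \<Rightarrow> bool" where
  "weak_eq lam G \<longleftrightarrow> (\<forall>\<phi>. test2 \<phi> \<longrightarrow>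
     (\<integral>t. (\<integral>x. G x t * (pt \<phi> x t + lam / 2 * px (px (\<lambda>y s. (1 - y^2) * \<phi> y s)) x t)
              \<partial>lebesgue_on I) \<partial>lebesgue_on {0<..}) = 0)"

text \<open>Trace of G(.,t) at x = 1 is a and at x = -1 is b: the continuous representative of
  G(.,t) (which exists since G(.,t) has an L^1_loc weak derivative) has these one-sided limits.\<close>
definition has_traces :: "(real \<Rightarrow> real) \<Rightarrow> real \<Rightarrow> real \<Rightarrow> bool" where
  "has_traces v a b \<longleftrightarrow> (\<exists>u. continuous_on I u \<and> (AE x in lebesgue_on I. u x = v x) \<and>
       (u \<longlongrightarrow> a) (at_left 1) \<and> (u \<longlongrightarrow> b) (at_right (-1)))"

definition is_weak_solution ::
  "real \<Rightarrow> (real \<Rightarrow> real) \<Rightarrow> real \<Rightarrow> (real \<Rightarrow> real \<Rightarrow> real) \<Rightarrow> bool" where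
  "is_weak_solution lam G0 p G \<longleftrightarrow>
     \<comment> \<open>G in C((0,infinity); L^2(-1,1))\<close>
     (\<forall>t>0. L2 (\<lambda>x. G x t)) \<and>
     (\<forall>t>0. ((\<lambda>s. L2_norm (\<lambda>x. G x s - G x t)) \<longlongrightarrow> 0) (at t)) \<and>
     \<comment> \<open>G in L^2_loc((0,infinity); H^1_rho(-1,1))\<close>
     (\<exists>Gx. (AE t in lborel. t > 0 \<longrightarrow> H1rho_with (\<lambda>x. G x t) (\<lambda>x. Gx x t)) \<and>
           (\<forall>a b. 0 < a \<longrightarrow> set_integrable lborel {a..b}
               (\<lambda>t. \<integral>x. (1 - x^2) * (Gx x t)^2 \<partial>lebesgue_on I))) \<and>
     \<comment> \<open>boundary conditions G(1,t) = 1, G(-1,t) = p (as traces, for a.e. t > 0)\<close>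
     (AE t in lborel. t > 0 \<longrightarrow> has_traces (\<lambda>x. G x t) 1 p) \<and>
     \<comment> \<open>the PDE in the weak sense\<close>
     weak_eq lam G \<and>
     \<comment> \<open>initial condition G(.,0) = G0 in L^2\<close>
     ((\<lambda>t. L2_norm (\<lambda>x. G x t - G0 x)) \<longlongrightarrow> 0) (at_right 0)"

end

theory Submission
  imports Defs
begin

text \<open>
  The difference \<open>W\<close> of two solutions has zero initial and boundary values. Testing its equation with
  \<open>x\<^sup>n\<close> gives, with \<open>m\<^sub>n(t) = \<integral> W x\<^sup>n dx\<close>,
  \<open>m\<^sub>n' = \<lambda>/2 (n (n - 1) m\<^sub>n\<^sub>-\<^sub>2 - (n + 2) (n + 1) m\<^sub>n)\<close>, so all moments vanish and \<open>W = 0\<close>.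

  Since \<open>x\<^sup>n\<close> has no compact support, cut-offs at distance \<open>1/k\<close> from the endpoints are needed, and they
  produce averages \<open>w\<^sub>k(t)\<close> of \<open>W\<close> over boundary strips. The traces give \<open>w\<^sub>k(t) \<rightarrow> 0\<close> only for almost
  every \<open>t\<close>, and the weighted Sobolev norm does not control \<open>W\<close> uniformly up to the boundary.
  Integrability in time comes from the equation: with \<open>w\<^sub>j\<close> the average at distance \<open>2\<^sup>-\<^sup>j\<close> and \<open>Q\<^sub>j\<close> a
  similar average with another weight, \<open>2\<^sup>-\<^sup>j Q\<^sub>j'\<close> is proportional to \<open>2 w\<^sub>j\<^sub>+\<^sub>1 - 3 w\<^sub>j + w\<^sub>j\<^sub>-\<^sub>1\<close>, while
  \<open>w\<^sub>j\<^sub>+\<^sub>1 - w\<^sub>j\<close> and \<open>Q\<^sub>j - w\<^sub>j\<close> are bounded by the energy of \<open>W\<close> in the \<open>j\<close>-th dyadic strip. Multiplying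
  by \<open>Q\<^sub>j\<close> and summing over \<open>j\<close> telescopes and bounds \<open>\<integral> w\<^sub>J\<^sup>2 dt\<close> uniformly in \<open>J\<close>. Together with
  the almost everywhere convergence this yields \<open>\<integral> \<bar>w\<^sub>J\<bar> dt \<rightarrow> 0\<close>.
\<close>

subsection \<open>Smooth functions and cut-offs\<close>

text \<open>The operator is symmetric for the weight 1 / (1 - x^2), but the energy method in that
  weight is out of reach: for W in the given class neither the integral of W^2 / (1 - x^2) nor that
  of (W_x)^2 need be finite. Moments avoid both, because f -> ((1 - x^2) f)'' maps polynomials to
  polynomials without raising the degree. The function (1 - x^2) x^n vanishes at -1 and 1 while its
  slope there does not, so integration by parts leaves exactly a multiple of the boundary value of
  W.

  Dyadic scales are forced by uniformity: at distance 2^-j from the endpoint both the length of a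
  strip and the weight 1 - x^2 are of order 2^-j, so the increment bounds carry constants
  independent of j, and summing them costs a fixed multiple of one total energy.

  The sign in the telescoped identity is favourable: its time integral is a nonnegative quantity at
  time b minus one at time a, and the former is at most a multiple of the squared L^2 norm of W at
  time b. The uniform bound therefore uses no boundary data; the traces only identify the limit as
  0.\<close>

fun Cn :: "nat \<Rightarrow> (real \<Rightarrow> real) \<Rightarrow> bool" where
  "Cn 0 f \<longleftrightarrow> True"
| "Cn (Suc n) f \<longleftrightarrow> (\<exists>f'. (\<forall>x. (f has_real_derivative f' x) (at x)) \<and> Cn n f')"

lemma Cn_Suc_deriv: "Cn (Suc n) f \<longleftrightarrow> (\<forall>x. f differentiable (at x)) \<and> Cn n (deriv f)"
proof
  assume "Cn (Suc n) f"
  then obtain f' where f': "\<And>x. (f has_real_derivative f' x) (at x)" "Cn n f'" by auto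
  then have "deriv f = f'" by (auto intro: DERIV_imp_deriv)
  with f' show "(\<forall>x. f differentiable (at x)) \<and> Cn n (deriv f)"
    using real_differentiable_def by blast
next
  assume "(\<forall>x. f differentiable (at x)) \<and> Cn n (deriv f)"
  then show "Cn (Suc n) f"
    by (auto simp: real_differentiable_def intro!: exI[of _ "deriv f"] dest: DERIV_imp_deriv)
qed

text \<open>Each level of \<open>Cn\<close> supplies a derivative as a witness, so closure under
  products and affine substitution follows by induction on the order with the function generalised.
  Iterated \<open>deriv\<close> would call for explicit higher product and chain rules.\<close>

lemma smooth1_iff_Cn: "smooth1 f \<longleftrightarrow> (\<forall>n. Cn n f)"
proof -
  have *: "Cn n f \<longleftrightarrow> (\<forall>k<n. \<forall>x. (deriv ^^ k) f differentiable (at x))" for n f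
  proof (induction n arbitrary: f)
    case (Suc n)
    show ?case
      unfolding Cn_Suc_deriv Suc.IH
      by (auto simp: less_Suc_eq_0_disj simp del: funpow.simps simp: funpow_0 funpow_Suc_right)
  qed simp
  show ?thesis unfolding smooth1_def * by blast
qed

lemma smooth1_DERIV: "smooth1 f \<Longrightarrow> (f has_real_derivative deriv f x) (at x)"
  unfolding smooth1_iff_Cn using Cn_Suc_deriv[of 0 f]
  by (metis DERIV_imp_deriv real_differentiable_def)

lemma smooth1_deriv: "smooth1 f \<Longrightarrow> smooth1 (deriv f)"
  unfolding smooth1_iff_Cn using Cn_Suc_deriv by blast

lemma smooth1_of_DERIV:
  assumes "\<And>x. (f has_real_derivative f' x) (at x)" "smooth1 f'" shows "smooth1 f"
  unfolding smooth1_iff_Cn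
proof
  fix n show "Cn n f" using assms by (cases n) (auto simp: smooth1_iff_Cn)
qed

lemma smooth1_continuous_on: "smooth1 f \<Longrightarrow> continuous_on S f"
  by (meson DERIV_isCont continuous_at_imp_continuous_on smooth1_DERIV)

lemma Cn_mono: "Cn (Suc n) f \<Longrightarrow> Cn n f"
  by (induction n arbitrary: f) auto

lemma Cn_const: "Cn n (\<lambda>x. c)"
  by (induction n arbitrary: c) (auto intro!: exI[of _ "\<lambda>x. 0"])

lemma Cn_ident: "Cn n (\<lambda>x. x)"
  by (cases n) (auto intro!: exI[of _ "\<lambda>x. 1"] Cn_const)

lemma Cn_add: "Cn n f \<Longrightarrow> Cn n g \<Longrightarrow> Cn n (\<lambda>x. f x + g x)"
proof (induction n arbitrary: f g)
  case (Suc n)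
  then obtain f' g' where "\<And>x. (f has_real_derivative f' x) (at x)" "Cn n f'"
    "\<And>x. (g has_real_derivative g' x) (at x)" "Cn n g'" by auto
  with Suc.IH show ?case
    by (auto intro!: exI[of _ "\<lambda>x. f' x + g' x"] derivative_intros)
qed simp

lemma Cn_mult: "Cn n f \<Longrightarrow> Cn n g \<Longrightarrow> Cn n (\<lambda>x. f x * g x)"
proof (induction n arbitrary: f g)
  case (Suc n)
  then obtain f' g' where *: "\<And>x. (f has_real_derivative f' x) (at x)" "Cn n f'"
    "\<And>x. (g has_real_derivative g' x) (at x)" "Cn n g'" by auto
  have "Cn n f" "Cn n g" using Suc.prems Cn_mono by auto
  with * Suc.IH have "Cn n (\<lambda>x. f' x * g x + g' x * f x)" by (intro Cn_add) auto
  with * show ?case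
    by (auto intro!: exI[of _ "\<lambda>x. f' x * g x + g' x * f x"] DERIV_mult)
qed simp

lemma Cn_affine: "Cn n f \<Longrightarrow> Cn n (\<lambda>x. f (c * x + d))"
proof (induction n arbitrary: f)
  case (Suc n)
  then obtain f' where *: "\<And>x. (f has_real_derivative f' x) (at x)" "Cn n f'" by auto
  then have "Cn n (\<lambda>x. f' (c * x + d) * c)" using Suc.IH by (intro Cn_mult Cn_const) auto
  moreover have "((\<lambda>x. f (c * x + d)) has_real_derivative f' (c * x + d) * c) (at x)" for x
    by (rule DERIV_chain2[OF *(1)]) (auto intro!: derivative_eq_intros)
  ultimately show ?case by (auto intro!: exI[of _ "\<lambda>x. f' (c * x + d) * c"])
qed simp

lemma smooth1_const [simp, intro]: "smooth1 (\<lambda>x. c)"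
  and smooth1_ident [simp, intro]: "smooth1 (\<lambda>x. x)"
  and smooth1_add [intro]: "smooth1 f \<Longrightarrow> smooth1 g \<Longrightarrow> smooth1 (\<lambda>x. f x + g x)"
  and smooth1_mult [intro]: "smooth1 f \<Longrightarrow> smooth1 g \<Longrightarrow> smooth1 (\<lambda>x. f x * g x)"
  and smooth1_affine: "smooth1 f \<Longrightarrow> smooth1 (\<lambda>x. f (c * x + d))"
  by (auto simp: smooth1_iff_Cn Cn_const Cn_ident Cn_add Cn_mult Cn_affine)

lemma smooth1_minus [intro]: "smooth1 f \<Longrightarrow> smooth1 (\<lambda>x. - f x)"
  using smooth1_mult[of "\<lambda>x. -1" f] by simp

lemma smooth1_diff [intro]: "smooth1 f \<Longrightarrow> smooth1 g \<Longrightarrow> smooth1 (\<lambda>x. f x - g x)"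
  using smooth1_add[of f "\<lambda>x. - g x"] by auto

lemma smooth1_power [intro]: "smooth1 f \<Longrightarrow> smooth1 (\<lambda>x. f x ^ n)"
  by (induction n) auto

lemma smooth1_divide_const [intro]: "smooth1 f \<Longrightarrow> smooth1 (\<lambda>x. f x / c)"
  using smooth1_mult[of f "\<lambda>x. inverse c"] by (simp add: divide_inverse)

lemma test1I:
  assumes "smooth1 f" "-1 < a" "b < 1" "\<And>x. x \<notin> {a..b} \<Longrightarrow> f x = 0"
  shows "test1 f"
  using assms unfolding test1_def by blast

lemma test1_smooth: "test1 f \<Longrightarrow> smooth1 f"
  by (simp add: test1_def)

lemma has_derivative_zero_outside:
  fixes f :: "real \<Rightarrow> real"
  assumes "\<And>y. y \<notin> {a..b} \<Longrightarrow> f y = 0" "x \<notin> {a..b}"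
  shows "(f has_real_derivative 0) (at x)"
proof -
  have "((\<lambda>x. 0::real) has_real_derivative 0) (at x)" by simp
  then show ?thesis
    by (rule has_field_derivative_transform_within_open[where S = "- {a..b}"])
       (use assms in auto)
qed

lemma deriv_zero_outside:
  fixes f :: "real \<Rightarrow> real"
  assumes "\<And>y. y \<notin> {a..b} \<Longrightarrow> f y = 0" "x \<notin> {a..b}"
  shows "deriv f x = 0"
  by (rule DERIV_imp_deriv) (rule has_derivative_zero_outside[OF assms])

text \<open>With u = f / (1 - x^2) one has u' = (f' + 2 x u) / (1 - x^2). The numerator again
  vanishes outside \<open>{a..b}\<close> and has one order of differentiability less, so the
  induction closes. The zeros of the weight lie off \<open>{a..b}\<close>, where the quotient is 0
  whatever the denominator.\<close>

lemma Cn_divide_weight: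
  assumes "-1 < a" "b < 1"
  shows "Cn n f \<Longrightarrow> (\<And>x. x \<notin> {a..b} \<Longrightarrow> f x = 0) \<Longrightarrow> Cn n (\<lambda>x. f x / (1 - x^2))"
proof (induction n arbitrary: f)
  case (Suc n)
  then obtain f' where f': "\<And>x. (f has_real_derivative f' x) (at x)" "Cn n f'" by auto
  have f'0: "f' x = 0" if "x \<notin> {a..b}" for x
    by (rule DERIV_unique[OF f'(1) has_derivative_zero_outside[OF Suc.prems(2) that]])
  have "Cn n f" using Suc.prems(1) Cn_mono by blast
  have "Cn n (\<lambda>x. f x / (1 - x^2))" using Suc.IH \<open>Cn n f\<close> Suc.prems(2) by blast
  then have "Cn n (\<lambda>x. 2 * x * (f x / (1 - x^2)))" by (intro Cn_mult Cn_const Cn_ident)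
  then have "Cn n (\<lambda>x. f' x + 2 * x * (f x / (1 - x^2)))" using f' by (intro Cn_add)
  then have c: "Cn n (\<lambda>x. (f' x + 2 * x * (f x / (1 - x^2))) / (1 - x^2))"
    using f'0 Suc.prems(2) by (intro Suc.IH) auto
  have "((\<lambda>x. f x / (1 - x^2)) has_real_derivative
          (f' x + 2 * x * (f x / (1 - x^2))) / (1 - x^2)) (at x)" for x
  proof (cases "x \<in> {a..b}")
    case True
    then have "1 - x^2 \<noteq> 0" using assms by (auto simp: power2_eq_1_iff)
    then show ?thesis
      by (auto intro!: derivative_eq_intros f'(1) simp: field_simps power2_eq_square)
  next
    case False
    then show ?thesis
      using has_derivative_zero_outside[of a b "\<lambda>x. f x / (1 - x^2)" x] Suc.prems(2) f'0 by auto
  qed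
  with c show ?case
    by (auto intro!: exI[of _ "\<lambda>x. (f' x + 2 * x * (f x / (1 - x^2))) / (1 - x^2)"])
qed simp

lemma smooth1_divide_weight:
  assumes "smooth1 f" "-1 < a" "b < 1" "\<And>x. x \<notin> {a..b} \<Longrightarrow> f x = 0"
  shows "smooth1 (\<lambda>x. f x / (1 - x^2))"
  using assms Cn_divide_weight unfolding smooth1_iff_Cn by blast

text \<open>The powers of 1 / x make the family closed under differentiation up to linear
  combinations; \<open>flat_exp 0\<close> is the classical flat function exp (-1/x).\<close>

definition flat_exp :: "nat \<Rightarrow> real \<Rightarrow> real" where
  "flat_exp k x = (if x > 0 then (1 / x) ^ k * exp (- (1 / x)) else 0)"

lemma flat_exp_tendsto_0: "(flat_exp k \<longlongrightarrow> 0) (at 0)"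
proof -
  have "((\<lambda>u::real. u ^ k / exp u) \<longlongrightarrow> 0) at_top" by (rule tendsto_power_div_exp_0)
  then have "((\<lambda>x::real. inverse x ^ k / exp (inverse x)) \<longlongrightarrow> 0) (at_right 0)"
    by (rule filterlim_compose[OF _ filterlim_inverse_at_top_right])
  then have "(flat_exp k \<longlongrightarrow> 0) (at_right 0)"
    by (rule Lim_transform_eventually)
       (auto simp: eventually_at_right_field flat_exp_def exp_minus field_simps intro!: exI[of _ 1])
  moreover have "(flat_exp k \<longlongrightarrow> 0) (at_left 0)"
    by (rule Lim_transform_eventually[OF tendsto_const])
       (auto simp: eventually_at_left_field flat_exp_def intro!: exI[of _ "-1"])
  ultimately show ?thesis by (simp add: filterlim_split_at_real)
qed

lemma flat_exp_DERIV:
  "(flat_exp k has_real_derivative (flat_exp (k + 2) x - k * flat_exp (k + 1) x)) (at x)"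
proof -
  consider "x > 0" | "x < 0" | "x = 0" by linarith
  then show ?thesis
  proof cases
    case 1
    have "((\<lambda>x. (1 / x) ^ k * exp (- (1 / x))) has_real_derivative
       (flat_exp (k + 2) x - k * flat_exp (k + 1) x)) (at x)"
    proof -
      have i: "((\<lambda>x. 1 / x) has_real_derivative - ((1 / x)^2)) (at x)"
        using 1 by (auto intro!: derivative_eq_intros simp: power2_eq_square)
      have p: "((\<lambda>x. (1 / x) ^ k) has_real_derivative - (real k * (1 / x) ^ (k + 1))) (at x)"
        by (rule DERIV_cong[OF DERIV_power[OF i]]) (cases k, simp_all add: power2_eq_square)
      have e: "((\<lambda>x. exp (- (1 / x))) has_real_derivative exp (- (1 / x)) * (1 / x)^2) (at x)"
        by (rule DERIV_cong[OF DERIV_fun_exp[OF DERIV_minus[OF i]]]) simp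
      show ?thesis
        by (rule DERIV_cong[OF DERIV_mult[OF p e]])
           (use 1 in \<open>simp add: flat_exp_def power2_eq_square algebra_simps\<close>)
    qed
    then show ?thesis
      by (rule has_field_derivative_transform_within_open[where S = "{0<..}"])
         (use 1 in \<open>auto simp: flat_exp_def\<close>)
  next
    case 2
    have "((\<lambda>x. 0) has_real_derivative (flat_exp (k + 2) x - k * flat_exp (k + 1) x)) (at x)"
      using 2 by (simp add: flat_exp_def)
    then show ?thesis
      by (rule has_field_derivative_transform_within_open[where S = "{..<0}"])
         (use 2 in \<open>auto simp: flat_exp_def\<close>)
  next
    case 3
    \<comment> \<open>At the origin the difference quotient is itself a member of the family: it
      equals \<open>flat_exp (k + 1) h\<close> on both sides.\<close>
    have "((\<lambda>h. (flat_exp k (0 + h) - flat_exp k 0) / h) \<longlongrightarrow> 0) (at 0)"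
      by (rule Lim_transform_eventually[OF flat_exp_tendsto_0[of "k + 1"]])
         (auto simp: flat_exp_def eventually_at intro!: exI[of _ 1])
    then show ?thesis using 3 by (simp add: DERIV_def flat_exp_def)
  qed
qed

lemma smooth1_flat_exp: "smooth1 (flat_exp k)"
proof -
  have "Cn n (flat_exp k)" for n
  proof (induction n arbitrary: k)
    case (Suc n)
    have "Cn n (\<lambda>x. flat_exp (k + 2) x + (- real k) * flat_exp (k + 1) x)"
      by (intro Cn_add Cn_mult Cn_const Suc)
    then show ?case using flat_exp_DERIV[of k] by (auto intro!: exI)
  qed simp
  then show ?thesis by (simp add: smooth1_iff_Cn)
qed

definition bump :: "real \<Rightarrow> real" where
  "bump z = flat_exp 0 (z - 1) * flat_exp 0 (2 - z)"

lemma smooth1_bump: "smooth1 bump"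
proof -
  have "smooth1 (\<lambda>z. flat_exp 0 (1 * z + -1) * flat_exp 0 ((-1) * z + 2))"
    by (intro smooth1_mult smooth1_affine smooth1_flat_exp)
  then show ?thesis by (simp add: bump_def[abs_def])
qed

lemma bump_nonneg: "bump z \<ge> 0" and bump_pos: "1 < z \<Longrightarrow> z < 2 \<Longrightarrow> bump z > 0"
  and bump_zero: "z \<notin> {1<..<2} \<Longrightarrow> bump z = 0"
  by (auto simp: bump_def flat_exp_def)

lemma ex_antiderivative:
  fixes f :: "real \<Rightarrow> real"
  assumes "continuous_on UNIV f"
  shows "\<exists>F. (\<forall>x. (F has_real_derivative f x) (at x)) \<and> F 0 = 0"
proof -
  have "\<exists>F. \<forall>x. (F has_real_derivative f x) (at x)"
    using einterval_antiderivative[of "-\<infinity>" \<infinity> f] assms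
    by (auto simp: continuous_on_eq_continuous_at has_real_derivative_iff_has_vector_derivative)
  then obtain F where "\<And>x. (F has_real_derivative f x) (at x)" by blast
  then show ?thesis by (intro exI[of _ "\<lambda>x. F x - F 0"]) (auto intro!: derivative_eq_intros)
qed

text \<open>With the transition inside [1, 2], \<open>step (k * (1 - x))\<close> for k > 0 is 0
  within distance 1 / k of the right endpoint and 1 from distance 2 / k on. Only the four properties
  in the description are used later.\<close>

definition step :: "real \<Rightarrow> real" where
  "step = (SOME s. smooth1 s \<and> mono s \<and> (\<forall>z\<le>1. s z = 0) \<and> (\<forall>z\<ge>2. s z = 1))"

lemma step_exists: "\<exists>s. smooth1 s \<and> mono s \<and> (\<forall>z\<le>1. s z = 0) \<and> (\<forall>z\<ge>2. s z = 1)"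
proof -
  obtain F where F: "\<And>x. (F has_real_derivative bump x) (at x)"
    using ex_antiderivative smooth1_continuous_on[OF smooth1_bump] by blast
  have Fm: "F x \<le> F y" if "x \<le> y" for x y
    by (rule DERIV_nonneg_imp_nondecreasing[OF that]) (use F bump_nonneg in blast)
  have Fconst: "F x = F y" if "x \<le> y" "\<And>z. x < z \<Longrightarrow> z < y \<Longrightarrow> bump z = 0" for x y
  proof (cases "x = y")
    case False
    then have "x < y" using that by simp
    then obtain z where "x < z" "z < y" "F y - F x = (y - x) * bump z"
      using MVT2[of x y F bump] F by blast
    then show ?thesis using that(2) by simp
  qed simp
  obtain z where "1 < z" "z < 2" "F 2 - F 1 = (2 - 1) * bump z"
    using MVT2[of 1 2 F bump] F by auto
  then have pos: "F 1 < F 2" using bump_pos[of z] by simp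
  have "smooth1 (\<lambda>x. (F x - F 1) / (F 2 - F 1))"
    by (intro smooth1_divide_const smooth1_diff smooth1_const smooth1_of_DERIV[OF F smooth1_bump])
  moreover have "mono (\<lambda>x. (F x - F 1) / (F 2 - F 1))"
    using Fm pos by (auto intro!: monoI divide_right_mono)
  moreover have "(F z - F 1) / (F 2 - F 1) = 0" if "z \<le> 1" for z
    using Fconst[of z 1] that by (simp add: bump_zero)
  moreover have "(F z - F 1) / (F 2 - F 1) = 1" if "z \<ge> 2" for z
    using Fconst[of 2 z] that pos by (simp add: bump_zero)
  ultimately show ?thesis
    by (intro exI[of _ "\<lambda>x. (F x - F 1) / (F 2 - F 1)"]) blast
qed

lemma smooth1_step: "smooth1 step" and mono_step: "mono step"
  and step_eq_0: "z \<le> 1 \<Longrightarrow> step z = 0" and step_eq_1: "z \<ge> 2 \<Longrightarrow> step z = 1"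
  using someI_ex[OF step_exists, folded step_def] by auto

lemma step_DERIV: "(step has_real_derivative deriv step z) (at z)"
  by (rule smooth1_DERIV[OF smooth1_step])

lemma step_nonneg: "step z \<ge> 0" and step_le_1: "step z \<le> 1"
  using monoD[OF mono_step, of 1 z] monoD[OF mono_step, of z 1] step_eq_0[of 1] step_eq_0[of z]
    monoD[OF mono_step, of z 2] monoD[OF mono_step, of 2 z] step_eq_1[of 2] step_eq_1[of z]
  by (cases "z \<le> 1"; cases "z \<le> 2"; simp)+

lemma deriv_step_nonneg: "deriv step z \<ge> 0"
  by (rule mono_on_imp_deriv_nonneg[of UNIV step]) (use mono_step step_DERIV in auto)

lemma deriv_step_eq_0: "z \<notin> {1..2} \<Longrightarrow> deriv step z = 0"
proof -
  assume "z \<notin> {1..2}"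
  then consider "z < 1" | "z > 2" by fastforce
  then show ?thesis
  proof cases
    case 1
    have "(step has_real_derivative 0) (at z)"
      by (rule has_field_derivative_transform_within_open[where f = "\<lambda>z. 0" and S = "{..<1}"])
         (use 1 in \<open>auto simp: step_eq_0\<close>)
    then show ?thesis by (rule DERIV_imp_deriv)
  next
    case 2
    have "(step has_real_derivative 0) (at z)"
      by (rule has_field_derivative_transform_within_open[where f = "\<lambda>z. 1" and S = "{2<..}"])
         (use 2 in \<open>auto simp: step_eq_1\<close>)
    then show ?thesis by (rule DERIV_imp_deriv)
  qed
qed

text \<open>Products of a function of x and a function of t are stable under both partial
  derivatives, so rule induction over \<open>partials\<close> reduces joint smoothness to one
  variable. These products are the only space-time test functions needed.\<close>

lemma partials_tensor:
  assumes "g \<in> partials (\<lambda>x t. f0 x * g0 t)" "smooth1 f0" "smooth1 g0"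
  shows "\<exists>f h. smooth1 f \<and> smooth1 h \<and> g = (\<lambda>x t. f x * h t)"
  using assms
proof induction
  case (dx g)
  then obtain f h where fh: "smooth1 f" "smooth1 h" "g = (\<lambda>x t. f x * h t)" by blast
  have "px g = (\<lambda>x t. deriv f x * h t)"
    unfolding px_def fh
    by (intro ext DERIV_imp_deriv) (auto intro!: derivative_eq_intros smooth1_DERIV fh)
  then show ?case using fh smooth1_deriv by blast
next
  case (dt g)
  then obtain f h where fh: "smooth1 f" "smooth1 h" "g = (\<lambda>x t. f x * h t)" by blast
  have "pt g = (\<lambda>x t. f x * deriv h t)"
    unfolding pt_def fh
    by (intro ext DERIV_imp_deriv) (auto intro!: derivative_eq_intros smooth1_DERIV fh)
  then show ?case using fh smooth1_deriv by blast
qed blast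

lemma smooth2_tensor:
  assumes "smooth1 f" "smooth1 g" shows "smooth2 (\<lambda>x t. f x * g t)"
  unfolding smooth2_def
proof
  fix k assume "k \<in> partials (\<lambda>x t. f x * g t)"
  then obtain u v where uv: "smooth1 u" "smooth1 v" "k = (\<lambda>x t. u x * v t)"
    using partials_tensor[OF _ assms] by blast
  have d: "f differentiable (at x)" if "smooth1 f" for f :: "real \<Rightarrow> real" and x
    using smooth1_DERIV[OF that] unfolding real_differentiable_def by blast
  have "continuous_on UNIV (\<lambda>p. u (fst p) * v (snd p))"
    by (intro continuous_intros continuous_on_compose2[OF smooth1_continuous_on[OF uv(1)]]
        continuous_on_compose2[OF smooth1_continuous_on[OF uv(2)]]) auto
  then show "continuous_on UNIV (\<lambda>(x, t). k x t) \<and>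
      (\<forall>x t. (\<lambda>y. k y t) differentiable (at x) \<and> (\<lambda>s. k x s) differentiable (at t))"
    by (simp add: uv case_prod_beta' d differentiable_mult)
qed

subsection \<open>Square integrable functions and the evolution of test pairings\<close>

lemma Cauchy_Schwarz_integral:
  fixes f g :: "'a \<Rightarrow> real"
  assumes [measurable]: "f \<in> borel_measurable M" "g \<in> borel_measurable M"
    and f: "integrable M (\<lambda>x. (f x)^2)" and g: "integrable M (\<lambda>x. (g x)^2)"
  shows "integrable M (\<lambda>x. f x * g x)"
    and "(\<integral>x. f x * g x \<partial>M)^2 \<le> (\<integral>x. (f x)^2 \<partial>M) * (\<integral>x. (g x)^2 \<partial>M)"
proof -
  show fg: "integrable M (\<lambda>x. f x * g x)"
  proof (rule Bochner_Integration.integrable_bound[OF Bochner_Integration.integrable_add[OF f g]])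
    show "AE x in M. norm (f x * g x) \<le> norm ((f x)^2 + (g x)^2)"
    proof (rule AE_I2)
      fix x
      have "0 \<le> (\<bar>f x\<bar> - \<bar>g x\<bar>)^2" "0 \<le> \<bar>f x\<bar> * \<bar>g x\<bar>" by auto
      then show "norm (f x * g x) \<le> norm ((f x)^2 + (g x)^2)"
        by (simp only: power2_diff abs_mult real_norm_def power2_abs)
    qed
  qed simp
  define A B C where "A = (\<integral>x. (f x)^2 \<partial>M)" and "B = (\<integral>x. (g x)^2 \<partial>M)"
    and "C = (\<integral>x. f x * g x \<partial>M)"
  have B0: "B \<ge> 0" unfolding B_def by simp
  have q: "0 \<le> s^2 * A - 2 * s * r * C + r^2 * B" for s r
  proof -
    have "0 \<le> (\<integral>x. (s * f x - r * g x)^2 \<partial>M)" by simp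
    also have "(\<lambda>x. (s * f x - r * g x)^2) = (\<lambda>x. s^2 * (f x)^2 - 2 * s * r * (f x * g x) + r^2 * (g x)^2)"
      by (auto simp: power2_eq_square algebra_simps)
    also have "(\<integral>x. \<dots> x \<partial>M) = s^2 * A - 2 * s * r * C + r^2 * B"
      using f g fg by (simp add: A_def B_def C_def)
    finally show ?thesis .
  qed
  have "C^2 \<le> A * B"
  proof (cases "B = 0")
    case True
    have "C = 0"
    proof (rule ccontr)
      assume "C \<noteq> 0"
      \<comment> \<open>For s = 1 and r = (A + 1) / (2 C) the quadratic form, with B = 0, takes the
        value A - (A + 1) = -1.\<close>
      then show False using q[of 1 "(A + 1) / (2 * C)"] True by (simp add: field_simps)
    qed
    then show ?thesis using True by simp
  next
    case False
    have "B * C^2 \<le> B * (A * B)"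
      using q[of B C] by (simp add: power2_eq_square algebra_simps)
    then show ?thesis using False B0 by simp
  qed
  then show "(\<integral>x. f x * g x \<partial>M)^2 \<le> (\<integral>x. (f x)^2 \<partial>M) * (\<integral>x. (g x)^2 \<partial>M)"
    by (simp add: A_def B_def C_def)
qed

section \<open>The inner product and norm of L^2(-1,1)\<close>

definition ip :: "(real \<Rightarrow> real) \<Rightarrow> (real \<Rightarrow> real) \<Rightarrow> real" where
  "ip f g = (\<integral>x. f x * g x \<partial>lebesgue_on I)"

lemma I_lmeasurable [simp]: "I \<in> lmeasurable" and I_sets [simp]: "I \<in> sets lebesgue"
  by (auto simp: I_def)

lemma finite_measure_I: "finite_measure (lebesgue_on I)"
  by (rule finite_measure_lebesgue_on) simp

lemma measure_I: "measure (lebesgue_on I) I = 2"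
  by (simp add: measure_restrict_space I_def)

lemma L2_measurable [measurable_dest]: "L2 f \<Longrightarrow> f \<in> borel_measurable (lebesgue_on I)"
  and L2_square_integrable: "L2 f \<Longrightarrow> integrable (lebesgue_on I) (\<lambda>x. (f x)^2)"
  by (simp_all add: L2_def)

lemma L2_mult_integrable: "L2 f \<Longrightarrow> L2 g \<Longrightarrow> integrable (lebesgue_on I) (\<lambda>x. f x * g x)"
  unfolding L2_def by (rule Cauchy_Schwarz_integral(1)) auto

lemma ip_Cauchy_Schwarz: "L2 f \<Longrightarrow> L2 g \<Longrightarrow> (ip f g)^2 \<le> ip f f * ip g g"
  unfolding L2_def ip_def
  using Cauchy_Schwarz_integral(2)[of f "lebesgue_on I" g] by (simp add: power2_eq_square)

lemma ip_self_nonneg: "ip f f \<ge> 0"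
  by (simp add: ip_def)

lemma L2_norm_eq: "L2_norm f = sqrt (ip f f)"
  by (simp add: L2_norm_def ip_def power2_eq_square)

lemma abs_ip_le: "L2 f \<Longrightarrow> L2 g \<Longrightarrow> \<bar>ip f g\<bar> \<le> L2_norm f * L2_norm g"
  using real_sqrt_le_mono[OF ip_Cauchy_Schwarz[of f g]]
  by (simp add: L2_norm_eq real_sqrt_mult)

lemma L2_cmult: "L2 f \<Longrightarrow> L2 (\<lambda>x. c * f x)"
  unfolding L2_def by (auto simp: power_mult_distrib)

lemma L2_add: assumes "L2 f" "L2 g" shows "L2 (\<lambda>x. f x + g x)"
proof -
  have "(\<lambda>x. (f x + g x)^2) = (\<lambda>x. (f x)^2 + 2 * (f x * g x) + (g x)^2)"
    by (auto simp: power2_sum)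
  then show ?thesis
    using assms L2_mult_integrable[OF assms] unfolding L2_def by auto
qed

lemma L2_diff: "L2 f \<Longrightarrow> L2 g \<Longrightarrow> L2 (\<lambda>x. f x - g x)"
  using L2_add[of f "\<lambda>x. (-1) * g x"] L2_cmult[of g "-1"] by simp

lemma L2_bounded:
  assumes [measurable]: "f \<in> borel_measurable (lebesgue_on I)" and B: "\<And>x. x \<in> I \<Longrightarrow> \<bar>f x\<bar> \<le> B"
  shows "L2 f"
  unfolding L2_def
proof
  show "integrable (lebesgue_on I) (\<lambda>x. (f x)^2)"
  proof (rule finite_measure.integrable_const_bound[OF finite_measure_I, where B = "B^2"])
    show "AE x in lebesgue_on I. norm ((f x)^2) \<le> B^2"
    proof (rule AE_I2)
      fix x assume "x \<in> space (lebesgue_on I)"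
      then show "norm ((f x)^2) \<le> B^2"
        using B[of x] by (simp add: abs_le_square_iff[symmetric])
    qed
  qed simp
qed fact

lemma continuous_measurable_I: "continuous_on I f \<Longrightarrow> f \<in> borel_measurable (lebesgue_on I)" for f :: "real \<Rightarrow> real"
  by (rule continuous_imp_measurable_on_sets_lebesgue) auto

lemma L2_continuous: assumes "continuous_on {-1..1} f" shows "L2 f"
proof -
  obtain B where "\<forall>y\<in>f ` {-1..1}. norm y \<le> B"
    using compact_imp_bounded[OF compact_continuous_image[OF assms compact_Icc]]
    unfolding bounded_iff by blast
  then have "\<bar>f x\<bar> \<le> B" if "x \<in> {-1..1}" for x using that by auto
  then show ?thesis
    by (intro L2_bounded[of _ B] continuous_measurable_I continuous_on_subset[OF assms]) (auto simp: I_def)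
qed

lemma L2_smooth1: "smooth1 f \<Longrightarrow> L2 f"
  by (intro L2_continuous smooth1_continuous_on)

lemma ip_add_right: "L2 f \<Longrightarrow> L2 g \<Longrightarrow> L2 h \<Longrightarrow> ip f (\<lambda>x. g x + h x) = ip f g + ip f h"
  and ip_diff_right: "L2 f \<Longrightarrow> L2 g \<Longrightarrow> L2 h \<Longrightarrow> ip f (\<lambda>x. g x - h x) = ip f g - ip f h"
  and ip_diff_left: "L2 g \<Longrightarrow> L2 h \<Longrightarrow> L2 f \<Longrightarrow> ip (\<lambda>x. g x - h x) f = ip g f - ip h f"
  by (simp_all add: ip_def algebra_simps L2_mult_integrable)

lemma ip_commute: "ip f g = ip g f"
  by (simp add: ip_def mult.commute)

lemma ip_cmult_right: "ip f (\<lambda>x. c * g x) = c * ip f g"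
  by (simp add: ip_def mult.left_commute)

lemma ip_minus_right: "ip f (\<lambda>x. - g x) = - ip f g"
  using ip_cmult_right[of f "-1" g] by simp

lemma L2_norm_triangle:
  assumes "L2 f" "L2 g" shows "L2_norm (\<lambda>x. f x + g x) \<le> L2_norm f + L2_norm g"
proof -
  have "ip (\<lambda>x. f x + g x) (\<lambda>x. f x + g x) = ip f f + 2 * ip f g + ip g g"
    using ip_add_right[OF L2_add[OF assms] assms] ip_add_right[OF assms(1) assms]
      ip_add_right[OF assms(2) assms] ip_commute[of "\<lambda>x. f x + g x" f]
      ip_commute[of "\<lambda>x. f x + g x" g] ip_commute[of g f] by linarith
  also have "\<dots> \<le> (L2_norm f)^2 + 2 * (L2_norm f * L2_norm g) + (L2_norm g)^2"
    using abs_ip_le[OF assms] by (simp add: L2_norm_eq ip_self_nonneg)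
  also have "\<dots> = (L2_norm f + L2_norm g)^2" by (simp add: power2_sum)
  finally show ?thesis
    unfolding L2_norm_eq[of "\<lambda>x. f x + g x"]
    by (intro real_le_lsqrt) (auto simp: L2_norm_eq ip_self_nonneg)
qed

lemma L2_norm_nonneg: "L2_norm f \<ge> 0"
  by (simp add: L2_norm_def)

lemma L2_norm_diff_le:
  assumes "L2 f" "L2 g" shows "L2_norm (\<lambda>x. f x - g x) \<le> L2_norm f + L2_norm g"
  using L2_norm_triangle[OF assms(1) L2_cmult[OF assms(2), of "-1"]] by (simp add: L2_norm_def)

section \<open>Continuous paths in L^2(-1,1)\<close>

definition L2_path :: "(real \<Rightarrow> real \<Rightarrow> real) \<Rightarrow> bool" where
  "L2_path G \<longleftrightarrow> (\<forall>t>0. L2 (\<lambda>x. G x t)) \<and>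
     (\<forall>t>0. ((\<lambda>s. L2_norm (\<lambda>x. G x s - G x t)) \<longlongrightarrow> 0) (at t))"

lemma L2_pathD: "L2_path G \<Longrightarrow> t > 0 \<Longrightarrow> L2 (\<lambda>x. G x t)"
  by (simp add: L2_path_def)

lemma L2_path_ip_isCont:
  assumes G: "L2_path G" and g: "L2 g" and t: "t > 0"
  shows "isCont (\<lambda>s. ip (\<lambda>x. G x s) g) t"
  unfolding isCont_def
proof (rule Lim_null_comparison[THEN LIM_zero_cancel])
  show "((\<lambda>s. L2_norm (\<lambda>x. G x s - G x t) * L2_norm g) \<longlongrightarrow> 0) (at t)"
    using G t unfolding L2_path_def by (intro tendsto_mult_left_zero) auto
  have "\<forall>\<^sub>F s in at t. s \<in> {0<..}" using t by (intro eventually_at_in_open') auto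
  then show "\<forall>\<^sub>F s in at t. norm (ip (\<lambda>x. G x s) g - ip (\<lambda>x. G x t) g) \<le> L2_norm (\<lambda>x. G x s - G x t) * L2_norm g"
  proof eventually_elim
    case (elim s)
    then have "L2 (\<lambda>x. G x s)" "L2 (\<lambda>x. G x t)" using G t L2_pathD by auto
    then show ?case using abs_ip_le[OF L2_diff g] g by (simp add: ip_diff_left)
  qed
qed

lemma L2_path_ip_continuous_on:
  assumes "L2_path G" "L2 g" "S \<subseteq> {0<..}" shows "continuous_on S (\<lambda>s. ip (\<lambda>x. G x s) g)"
  using L2_path_ip_isCont[OF assms(1,2)] assms(3) by (auto intro!: continuous_at_imp_continuous_on)

lemma L2_path_norm_isCont:
  assumes G: "L2_path G" and t: "t > 0"
  shows "isCont (\<lambda>s. L2_norm (\<lambda>x. G x s)) t"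
  unfolding isCont_def
proof (rule Lim_null_comparison[THEN LIM_zero_cancel])
  show "((\<lambda>s. L2_norm (\<lambda>x. G x s - G x t)) \<longlongrightarrow> 0) (at t)"
    using G t unfolding L2_path_def by auto
  have "\<forall>\<^sub>F s in at t. s \<in> {0<..}" using t by (intro eventually_at_in_open') auto
  then show "\<forall>\<^sub>F s in at t. norm (L2_norm (\<lambda>x. G x s) - L2_norm (\<lambda>x. G x t)) \<le> L2_norm (\<lambda>x. G x s - G x t)"
  proof eventually_elim
    case (elim s)
    then have L: "L2 (\<lambda>x. G x s)" "L2 (\<lambda>x. G x t)" using G t L2_pathD by auto
    have "L2_norm (\<lambda>x. G x t - G x s) = L2_norm (\<lambda>x. G x s - G x t)"
      by (simp add: L2_norm_def power2_commute)
    then show ?case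
      using L2_norm_triangle[OF L2_diff[OF L] L(2)] L2_norm_triangle[OF L2_diff[OF L(2,1)] L(1)]
      by simp
  qed
qed

lemma L2_path_bounded:
  assumes "L2_path G" "0 < a"
  obtains K where "\<And>t. t \<in> {a..b} \<Longrightarrow> L2_norm (\<lambda>x. G x t) \<le> K" "K \<ge> 0"
proof -
  have "continuous_on {a..b} (\<lambda>s. L2_norm (\<lambda>x. G x s))"
    using L2_path_norm_isCont[OF assms(1)] assms(2) by (auto intro!: continuous_at_imp_continuous_on)
  from compact_imp_bounded[OF compact_continuous_image[OF this compact_Icc]]
  obtain K where "\<forall>y\<in>(\<lambda>s. L2_norm (\<lambda>x. G x s)) ` {a..b}. norm y \<le> K"
    unfolding bounded_iff by blast
  then have K: "L2_norm (\<lambda>x. G x t) \<le> K" if "t \<in> {a..b}" for t using that by force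
  show ?thesis by (rule that[of "max K 0"]) (use K in force)+
qed

section \<open>Approximate identities in time and continuous distributional derivatives\<close>

lemma step_kernel_DERIV:
  "((\<lambda>t. step (n * (t - a))) has_real_derivative n * deriv step (n * (t - a))) (at t)"
  by (rule DERIV_cong[OF DERIV_chain2[OF step_DERIV]]) (auto intro!: derivative_eq_intros)

lemma step_kernel_smooth: "smooth1 (\<lambda>t. step (n * (t - a)))"
  using smooth1_affine[OF smooth1_step, of n "- (n * a)"] by (simp add: algebra_simps)

lemma continuous_on_deriv_step [continuous_intros]:
  "continuous_on S f \<Longrightarrow> continuous_on S (\<lambda>x. deriv step (f x))" for f :: "'a::topological_space \<Rightarrow> real"
  by (rule continuous_on_compose2[OF smooth1_continuous_on[OF smooth1_deriv[OF smooth1_step], of UNIV]]) auto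

text \<open>The kernel is nonnegative and lives on [a + 1/n, a + 2/n]. It is one-sided, so its mass
  inside \<open>{c..d}\<close> is exactly 1 as soon as n (d - a) > 2.\<close>

lemma step_kernel_tendsto:
  fixes h :: "real \<Rightarrow> real"
  assumes h: "continuous_on {c..d} h" and "c < a" "a < d"
  shows "(\<lambda>n. integral {c..d} (\<lambda>t. h t * (real n * deriv step (n * (t - a))))) \<longlonglongrightarrow> h a"
proof (rule LIMSEQ_I)
  fix e :: real assume "e > 0"
  have "isCont h a" using h assms by (simp add: continuous_on_interior)
  then obtain r where r: "r > 0" "\<And>t. \<bar>t - a\<bar> < r \<Longrightarrow> \<bar>h t - h a\<bar> < e / 2"
    using \<open>e > 0\<close> unfolding continuous_at_eps_delta dist_real_def by (meson half_gt_zero)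
  obtain m :: nat where m: "real m > 2 / min r (d - a)" using reals_Archimedean2 by blast
  have m0: "real m > 0" using m r assms by (smt (verit) divide_pos_pos)
  have "norm (integral {c..d} (\<lambda>t. h t * (real n * deriv step (n * (t - a)))) - h a) < e" if "n \<ge> m" for n
  proof -
    have n0: "real n > 0" using m0 that by linarith
    have "2 / min r (d - a) < real n" using m that by linarith
    then have "2 < real n * min r (d - a)" using r assms by (simp add: field_simps)
    then have n: "2 < real n * r" "2 < real n * (d - a)"
      using mult_left_mono[of "min r (d - a)" r "real n"] mult_left_mono[of "min r (d - a)" "d - a" "real n"] n0
      by linarith+
    define k where "k t = real n * deriv step (n * (t - a))" for t
    have k0: "k t \<ge> 0" for t using deriv_step_nonneg n0 by (simp add: k_def)
    have kc: "continuous_on {c..d} k" unfolding k_def by (intro continuous_intros)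
    have "(k has_integral (step (n * (d - a)) - step (n * (c - a)))) {c..d}"
      unfolding k_def using assms
      by (intro fundamental_theorem_of_calculus)
         (auto simp: has_real_derivative_iff_has_vector_derivative[symmetric]
            intro!: has_field_derivative_at_within step_kernel_DERIV)
    moreover have "real n * (c - a) \<le> 1" using n0 assms by (smt (verit) mult_nonneg_nonpos)
    ultimately have k1: "(k has_integral 1) {c..d}"
      using n by (simp add: step_eq_1 step_eq_0)
    have near: "\<bar>(h t - h a) * k t\<bar> \<le> e / 2 * k t" for t
    proof (cases "n * (t - a) \<in> {1..2}")
      case True
      then have "0 < t - a" using n0 by (smt (verit) atLeastAtMost_iff mult_nonneg_nonpos)
      moreover have "n * (t - a) < n * r" using True n by simp
      then have "t - a < r" using n0 by simp
      ultimately have "\<bar>h t - h a\<bar> < e / 2" using r by simp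
      then show ?thesis using k0[of t] mult_right_mono[of "\<bar>h t - h a\<bar>" "e / 2" "k t"] by (simp add: abs_mult)
    next
      case False
      then show ?thesis by (simp add: k_def deriv_step_eq_0)
    qed
    have hk: "(\<lambda>t. h t * k t) integrable_on {c..d}" "(\<lambda>t. (h t - h a) * k t) integrable_on {c..d}"
      by (intro integrable_continuous_real continuous_intros h kc)+
    have "integral {c..d} (\<lambda>t. h t * k t) - h a = integral {c..d} (\<lambda>t. (h t - h a) * k t)"
    proof -
      have "((\<lambda>t. h t * k t - h a * k t) has_integral (integral {c..d} (\<lambda>t. h t * k t) - h a * 1)) {c..d}"
        by (intro has_integral_diff has_integral_mult_right k1 integrable_integral hk)
      then show ?thesis by (simp add: left_diff_distrib integral_unique)
    qed
    moreover have "norm (integral {c..d} (\<lambda>t. (h t - h a) * k t)) \<le> integral {c..d} (\<lambda>t. e / 2 * k t)"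
      by (rule integral_norm_bound_integral[OF hk(2)])
         (use near has_integral_integrable[OF has_integral_mult_right[OF k1, of "e / 2"]] in auto)
    moreover have "integral {c..d} (\<lambda>t. e / 2 * k t) = e / 2"
      using integral_unique[OF has_integral_mult_right[OF k1, of "e / 2"]] by simp
    ultimately show ?thesis using \<open>e > 0\<close> by (simp add: k_def)
  qed
  then show "\<exists>m. \<forall>n\<ge>m. norm (integral {c..d} (\<lambda>t. h t * (real n * deriv step (n * (t - a)))) - h a) < e"
    by blast
qed


lemma integral_lebesgue_on_zero_outside:
  fixes f :: "real \<Rightarrow> real"
  assumes "A \<subseteq> B" "A \<in> sets lebesgue" "B \<in> sets lebesgue" "\<And>x. x \<in> B - A \<Longrightarrow> f x = 0"
  shows "integral\<^sup>L (lebesgue_on B) f = integral\<^sup>L (lebesgue_on A) f"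
proof -
  have "indicator B x * f x = indicator A x * f x" for x
    using assms by (auto simp: indicator_def)
  then have "(\<lambda>x. indicator B x * f x) = (\<lambda>x. indicator A x * f x)" by (rule ext)
  then show ?thesis using assms(2,3) by (simp add: integral_restrict_space)
qed

text \<open>The du Bois-Reymond argument: h = f - F, with F an antiderivative of g, has vanishing
  distributional derivative. Testing with the difference of two steps starting at a and b compares
  smoothed values of h near these points, so h is constant.\<close>

lemma distributional_derivative_continuous:
  fixes f g :: "real \<Rightarrow> real"
  assumes cf: "continuous_on {0<..} f" and cg: "continuous_on {0<..} g"
    and weak: "\<And>\<eta> c d. smooth1 \<eta> \<Longrightarrow> 0 < c \<Longrightarrow> (\<And>t. t \<notin> {c..d} \<Longrightarrow> \<eta> t = 0) \<Longrightarrow>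
       (\<integral>t. f t * deriv \<eta> t + g t * \<eta> t \<partial>lebesgue_on {0<..}) = 0"
    and t: "t > 0"
  shows "(f has_real_derivative g t) (at t)"
proof -
  define c d where "c = t / 2" and "d = 2 * t"
  have cd: "0 < c" "c < t" "t < d" using t by (auto simp: c_def d_def)
  have cf': "continuous_on {c..d} f" and cg': "continuous_on {c..d} g"
    using cd by (auto intro: continuous_on_subset[OF cf] continuous_on_subset[OF cg])
  define F where "F s = integral {c..s} g" for s
  have FD: "(F has_real_derivative g s) (at s within {c..d})" if "s \<in> {c..d}" for s
    unfolding F_def by (rule integral_has_real_derivative[OF cg' that])
  then have cF: "continuous_on {c..d} F" by (rule DERIV_continuous_on)
  define h where "h s = f s - F s" for s
  have ch: "continuous_on {c..d} h" unfolding h_def by (intro continuous_intros cf' cF)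
  have eq: "h a = h b" if ab: "c < a" "a < b" "b < d" for a b
  proof (rule LIMSEQ_unique)
    show "(\<lambda>n. integral {c..d} (\<lambda>t. h t * (real n * deriv step (n * (t - a))))) \<longlonglongrightarrow> h a"
      using ab by (intro step_kernel_tendsto ch) auto
    have "(\<lambda>n. integral {c..d} (\<lambda>t. h t * (real n * deriv step (n * (t - b))))) \<longlonglongrightarrow> h b"
      using ab by (intro step_kernel_tendsto ch) auto
    moreover have "\<forall>\<^sub>F n in sequentially. integral {c..d} (\<lambda>t. h t * (real n * deriv step (n * (t - b)))) =
      integral {c..d} (\<lambda>t. h t * (real n * deriv step (n * (t - a))))"
    proof -
      \<comment> \<open>From n = m on, both steps have reached the value 1 at d, so their difference
        is supported in \<open>{a..d}\<close> and is an admissible test function.\<close>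
      obtain m :: nat where m: "real m > 2 / (d - b)" using reals_Archimedean2 by blast
      have "integral {c..d} (\<lambda>t. h t * (real n * deriv step (n * (t - b)))) =
         integral {c..d} (\<lambda>t. h t * (real n * deriv step (n * (t - a))))" if "n \<ge> m" for n
      proof -
        have n2: "real n * (d - b) > 2"
        proof -
          have "2 / (d - b) < real n" using m that by linarith
          then show ?thesis using ab by (simp add: field_simps)
        qed
        then have n0: "real n > 0" by (intro gr_zeroI of_nat_0_less_iff[THEN iffD2]) auto
        define \<eta> where "\<eta> s = step (n * (s - a)) - step (n * (s - b))" for s
        define \<eta>' where "\<eta>' s = real n * deriv step (n * (s - a)) - real n * deriv step (n * (s - b))" for s
        have \<eta>: "smooth1 \<eta>" unfolding \<eta>_def by (intro smooth1_diff step_kernel_smooth)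
        have \<eta>D: "(\<eta> has_real_derivative \<eta>' s) (at s)" for s
          unfolding \<eta>_def \<eta>'_def by (intro derivative_intros step_kernel_DERIV)
        have c\<eta>': "continuous_on {c..d} \<eta>'" unfolding \<eta>'_def by (intro continuous_intros)
        have \<eta>0: "\<eta> s = 0" if "s \<notin> {a..d}" for s
        proof (cases "s < a")
          case True
          then have "real n * (s - a) \<le> 1" "real n * (s - b) \<le> 1"
            using n0 ab by (smt (verit) mult_nonneg_nonpos)+
          then show ?thesis by (simp add: \<eta>_def step_eq_0)
        next
          case False
          then have "s > d" using that by auto
          then have "real n * (d - b) \<le> real n * (s - b)" "real n * (s - b) \<le> real n * (s - a)"
            using n0 ab by auto
          then show ?thesis using n2 by (simp add: \<eta>_def step_eq_1)
        qed
        have "\<eta> d = 0"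
        proof -
          have "real n * (d - b) \<le> real n * (d - a)" using n0 ab by auto
          then show ?thesis using n2 by (simp add: \<eta>_def step_eq_1)
        qed
        have "\<eta> c = 0" using \<eta>0 ab by auto
        have d\<eta>: "deriv \<eta> = \<eta>'" using \<eta>D by (auto intro: DERIV_imp_deriv)
        have cfg: "continuous_on {c..d} (\<lambda>s. f s * \<eta>' s + g s * \<eta> s)"
          by (intro continuous_intros cf' cg' c\<eta>' smooth1_continuous_on[OF \<eta>])
        have "0 = (\<integral>s. f s * \<eta>' s + g s * \<eta> s \<partial>lebesgue_on {0<..})"
          using weak[OF \<eta>, of a d] \<eta>0 cd ab unfolding d\<eta> by simp
        also have "\<dots> = (\<integral>s. f s * \<eta>' s + g s * \<eta> s \<partial>lebesgue_on {c..d})"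
        proof (rule integral_lebesgue_on_zero_outside)
          fix s assume "s \<in> {0<..} - {c..d}"
          then have "s \<notin> {a..d}" using ab by auto
          then have "\<eta> s = 0" "deriv \<eta> s = 0"
            by (rule \<eta>0, intro deriv_zero_outside[of a d \<eta>] \<eta>0)
          then show "f s * \<eta>' s + g s * \<eta> s = 0" unfolding d\<eta> by simp
        qed (use cd in auto)
        also have "\<dots> = integral {c..d} (\<lambda>s. f s * \<eta>' s + g s * \<eta> s)"
          by (rule lebesgue_integral_eq_integral) (auto intro!: continuous_imp_integrable_real cfg)
        finally have i1: "((\<lambda>s. f s * \<eta>' s + g s * \<eta> s) has_integral 0) {c..d}"
          using integrable_integral[OF integrable_continuous_real[OF cfg]] by simp
        \<comment> \<open>Integration by parts: this integrand is the derivative of F \<eta>, which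
          vanishes at c and d. Subtracting it from the weak identity leaves h \<eta>'.\<close>
        have "((\<lambda>s. g s * \<eta> s + \<eta>' s * F s) has_integral (F d * \<eta> d - F c * \<eta> c)) {c..d}"
          using cd
          by (intro fundamental_theorem_of_calculus)
             (auto simp: has_real_derivative_iff_has_vector_derivative[symmetric]
               intro!: DERIV_mult FD has_field_derivative_at_within[OF \<eta>D])
        then have i2: "((\<lambda>s. g s * \<eta> s + \<eta>' s * F s) has_integral 0) {c..d}"
          using \<open>\<eta> d = 0\<close> \<open>\<eta> c = 0\<close> by simp
        have i3: "((\<lambda>s. h s * \<eta>' s) has_integral 0) {c..d}"
          using has_integral_diff[OF i1 i2] by (simp add: h_def algebra_simps)
        have "(\<lambda>s. h s * (real n * deriv step (n * (s - r)))) integrable_on {c..d}" for r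
          by (intro integrable_continuous_real continuous_intros ch)
        then have "integral {c..d} (\<lambda>s. h s * \<eta>' s) =
          integral {c..d} (\<lambda>t. h t * (real n * deriv step (n * (t - a)))) -
          integral {c..d} (\<lambda>t. h t * (real n * deriv step (n * (t - b))))"
          unfolding \<eta>'_def right_diff_distrib[of "h _"] by (intro integral_diff)
        then show ?thesis using integral_unique[OF i3] by simp
      qed
      then show ?thesis unfolding eventually_sequentially by blast
    qed
    ultimately show "(\<lambda>n. integral {c..d} (\<lambda>t. h t * (real n * deriv step (n * (t - a))))) \<longlonglongrightarrow> h b"
      by (rule Lim_transform_eventually)
  qed
  have hs: "h s = h t" if "s \<in> {c<..<d}" for s
  proof -
    consider "s < t" | "t < s" | "s = t" by linarith
    then show ?thesis
    proof cases
      case 1 then show ?thesis by (rule eq[rotated]) (use that cd in simp_all)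
    next
      case 2 then show ?thesis by (rule eq[symmetric, rotated]) (use that cd in simp_all)
    next
      case 3 then show ?thesis by (rule arg_cong)
    qed
  qed
  have fs: "F s + h t = f s" if "s \<in> {c<..<d}" for s
    using hs[OF that] unfolding h_def by linarith
  have "(F has_real_derivative g t) (at t)"
    using FD[of t] cd at_within_Icc_at[of c t d] by auto
  then have "((\<lambda>s. F s + h t) has_real_derivative g t) (at t)"
    by (auto intro!: derivative_eq_intros)
  then show ?thesis
    by (rule has_field_derivative_transform_within_open[where S = "{c<..<d}"]) (use cd fs in simp_all)
qed

text \<open>A test function \<psi>(x) \<eta>(t) turns the space-time identity into a scalar
  distributional equation for the pairing with \<psi>. Both sides of that equation are continuous in
  t because G is a continuous path in L^2, so it holds classically.\<close>

lemma weak_eq_DERIV: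
  assumes w: "weak_eq lam G" and G: "L2_path G" and psi: "test1 \<psi>" and t: "t > 0"
  shows "((\<lambda>s. ip (\<lambda>x. G x s) \<psi>) has_real_derivative
     lam / 2 * ip (\<lambda>x. G x t) (deriv (deriv (\<lambda>y. (1 - y^2) * \<psi> y)))) (at t)"
proof (rule distributional_derivative_continuous[OF _ _ _ t])
  define \<rho> where "\<rho> = (\<lambda>y. (1 - y^2) * \<psi> y)"
  have s\<psi>: "smooth1 \<psi>" using psi by (rule test1_smooth)
  then have s\<rho>: "smooth1 \<rho>" unfolding \<rho>_def by (intro smooth1_mult smooth1_diff smooth1_power smooth1_const smooth1_ident)
  have L: "L2 \<psi>" "L2 (deriv (deriv \<rho>))" using s\<psi> s\<rho> by (auto intro!: L2_smooth1 smooth1_deriv)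
  show "continuous_on {0<..} (\<lambda>s. ip (\<lambda>x. G x s) \<psi>)"
    by (rule L2_path_ip_continuous_on[OF G L(1)]) simp
  show "continuous_on {0<..} (\<lambda>t. lam / 2 * ip (\<lambda>x. G x t) (deriv (deriv (\<lambda>y. (1 - y\<^sup>2) * \<psi> y))))"
    using L2_path_ip_continuous_on[OF G L(2), of "{0<..}"] by (intro continuous_intros) (simp add: \<rho>_def)
  fix \<eta> c d assume \<eta>: "smooth1 \<eta>" and c: "0 < (c::real)" and supp: "\<And>t. t \<notin> {c..d} \<Longrightarrow> \<eta> t = 0"
  have T: "test2 (\<lambda>x t. \<psi> x * \<eta> t)"
  proof -
    obtain a b where "-1 < a" "b < 1" "\<And>x. \<psi> x \<noteq> 0 \<Longrightarrow> x \<in> {a..b}"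
      using psi unfolding test1_def by blast
    then have "-1 < a \<and> b < 1 \<and> 0 < c \<and> (\<forall>x t. \<psi> x * \<eta> t \<noteq> 0 \<longrightarrow> x \<in> {a..b} \<and> t \<in> {c..d})"
      using c supp by (metis mult_eq_0_iff)
    then show ?thesis unfolding test2_def using smooth2_tensor[OF s\<psi> \<eta>] by blast
  qed
  have p1: "pt (\<lambda>x t. \<psi> x * \<eta> t) x t = \<psi> x * deriv \<eta> t" for x t
    unfolding pt_def by (rule DERIV_imp_deriv) (auto intro!: derivative_eq_intros smooth1_DERIV \<eta>)
  have p2: "px (\<lambda>y s. (1 - y^2) * (\<psi> y * \<eta> s)) = (\<lambda>x t. deriv \<rho> x * \<eta> t)"
  proof (intro ext)
    fix x t
    have "((\<lambda>y. \<rho> y * \<eta> t) has_real_derivative deriv \<rho> x * \<eta> t) (at x)"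
      by (auto intro!: derivative_eq_intros smooth1_DERIV s\<rho>)
    then show "px (\<lambda>y s. (1 - y^2) * (\<psi> y * \<eta> s)) x t = deriv \<rho> x * \<eta> t"
      unfolding px_def by (intro DERIV_imp_deriv) (simp add: \<rho>_def mult.assoc)
  qed
  have p3: "px (\<lambda>x t. deriv \<rho> x * \<eta> t) x t = deriv (deriv \<rho>) x * \<eta> t" for x t
    unfolding px_def
    by (rule DERIV_imp_deriv) (auto intro!: derivative_eq_intros smooth1_DERIV smooth1_deriv s\<rho>)
  have "0 = (\<integral>t. (\<integral>x. G x t * (\<psi> x * deriv \<eta> t + lam / 2 * (deriv (deriv \<rho>) x * \<eta> t)) \<partial>lebesgue_on I) \<partial>lebesgue_on {0<..})"
    using w[unfolded weak_eq_def, rule_format, OF T] unfolding p1 p2 p3 by simp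
  also have "\<dots> = (\<integral>t. ip (\<lambda>x. G x t) \<psi> * deriv \<eta> t + lam / 2 * ip (\<lambda>x. G x t) (deriv (deriv \<rho>)) * \<eta> t \<partial>lebesgue_on {0<..})"
  proof (rule Bochner_Integration.integral_cong[OF refl])
    fix t assume "t \<in> space (lebesgue_on {0::real<..})"
    then have "L2 (\<lambda>x. G x t)" using G L2_pathD by auto
    then have i: "integrable (lebesgue_on I) (\<lambda>x. G x t * \<psi> x)" "integrable (lebesgue_on I) (\<lambda>x. G x t * deriv (deriv \<rho>) x)"
      using L L2_mult_integrable by blast+
    have "(\<integral>x. G x t * (\<psi> x * deriv \<eta> t + lam / 2 * (deriv (deriv \<rho>) x * \<eta> t)) \<partial>lebesgue_on I) =
       (\<integral>x. deriv \<eta> t * (G x t * \<psi> x) + lam / 2 * \<eta> t * (G x t * deriv (deriv \<rho>) x) \<partial>lebesgue_on I)"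
      by (simp add: algebra_simps)
    also have "\<dots> = deriv \<eta> t * ip (\<lambda>x. G x t) \<psi> + lam / 2 * \<eta> t * ip (\<lambda>x. G x t) (deriv (deriv \<rho>))"
      using i by (simp add: ip_def)
    finally show "(\<integral>x. G x t * (\<psi> x * deriv \<eta> t + lam / 2 * (deriv (deriv \<rho>) x * \<eta> t)) \<partial>lebesgue_on I) =
       ip (\<lambda>x. G x t) \<psi> * deriv \<eta> t + lam / 2 * ip (\<lambda>x. G x t) (deriv (deriv \<rho>)) * \<eta> t"
      by (simp add: algebra_simps)
  qed
  finally show "(\<integral>t. ip (\<lambda>x. G x t) \<psi> * deriv \<eta> t + lam / 2 * ip (\<lambda>x. G x t) (deriv (deriv (\<lambda>y. (1 - y\<^sup>2) * \<psi> y))) * \<eta> t \<partial>lebesgue_on {0<..}) = 0"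
    by (simp add: \<rho>_def)
qed

subsection \<open>Energy densities near an endpoint\<close>

lemma integrable_smooth1_I: "smooth1 f \<Longrightarrow> integrable (lebesgue_on I) f"
  using L2_mult_integrable[OF L2_smooth1[of f] L2_smooth1[OF smooth1_const[of 1]]] by simp

lemma integral_I_FTC:
  fixes F f :: "real \<Rightarrow> real"
  assumes D: "\<And>x. (F has_real_derivative f x) (at x)" and i: "integrable (lebesgue_on I) f"
  shows "integral\<^sup>L (lebesgue_on I) f = F 1 - F (-1)"
proof -
  have "(f has_integral (F 1 - F (-1))) {-1..1}"
    by (rule fundamental_theorem_of_calculus)
       (auto simp: has_real_derivative_iff_has_vector_derivative[symmetric]
          intro!: has_field_derivative_at_within D)
  then have "integral I f = F 1 - F (-1)"
    by (simp add: I_def integral_open_interval_real[symmetric] integral_unique)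
  then show ?thesis using lebesgue_integral_eq_integral[OF i] by simp
qed

text \<open>\<open>D\<close> plays the role of \<open>(1 - x\<^sup>2) (\<partial>\<^sub>x v)\<^sup>2\<close>; the inequality is what remains of it after
  Cauchy-Schwarz, and it passes to differences and reflections directly.\<close>
definition energy_density :: "(real \<Rightarrow> real) \<Rightarrow> (real \<Rightarrow> real) \<Rightarrow> bool" where
  "energy_density v D \<longleftrightarrow> integrable (lebesgue_on I) D \<and> (\<forall>x\<in>I. D x \<ge> 0) \<and>
     (\<forall>g a b. smooth1 g \<longrightarrow> -1 < a \<longrightarrow> b < 1 \<longrightarrow> (\<forall>x. x \<notin> {a..b} \<longrightarrow> g x = 0) \<longrightarrow>
       (ip v (deriv g))^2 \<le> (\<integral>x. (g x)^2 / (1 - x^2) \<partial>lebesgue_on I) *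
          (\<integral>x. indicator {a..b} x * D x \<partial>lebesgue_on I))"

lemma weight_pos: "x \<in> I \<Longrightarrow> 1 - x^2 > (0::real)"
  by (auto simp: I_def abs_square_less_1)

lemma integrable_indicator_mult:
  fixes D :: "real \<Rightarrow> real"
  assumes "integrable (lebesgue_on I) D"
  shows "integrable (lebesgue_on I) (\<lambda>x. indicator {a..b} x * D x)"
proof (rule Bochner_Integration.integrable_bound[OF assms])
  have [measurable]: "D \<in> borel_measurable (lebesgue_on I)" using assms by auto
  have [measurable]: "(\<lambda>x. indicator {a..b} x :: real) \<in> borel_measurable (lebesgue_on I)"
    by (intro measurable_restrict_space1 borel_measurable_indicator) simp
  show "(\<lambda>x. indicator {a..b} x * D x) \<in> borel_measurable (lebesgue_on I)" by measurable
qed (auto simp: indicator_def)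

text \<open>Write w g = (sqrt (1 - x^2) w) (g / sqrt (1 - x^2)) and apply Cauchy-Schwarz. Since g
  vanishes outside \<open>{a..b}\<close>, an indicator may be put on the first factor, and this is
  what localises the energy to a strip.\<close>

lemma H1rho_energy_density:
  assumes "H1rho_with v w"
  shows "energy_density v (\<lambda>x. (1 - x^2) * (w x)^2)"
  unfolding energy_density_def
proof (intro conjI allI impI ballI)
  have L: "L2 (\<lambda>x. sqrt (1 - x^2) * w x)" and wd: "weak_deriv v w"
    using assms by (auto simp: H1rho_with_def)
  have sq: "(sqrt (1 - x^2) * w x)^2 = (1 - x^2) * (w x)^2" if "x \<in> I" for x
    using weight_pos[OF that] by (simp add: power_mult_distrib)
  show iD: "integrable (lebesgue_on I) (\<lambda>x. (1 - x^2) * (w x)^2)"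
    using L2_square_integrable[OF L] by (rule Bochner_Integration.integrable_cong[THEN iffD1, rotated -1]) (auto simp: sq)
  show "(1 - x^2) * (w x)^2 \<ge> 0" if "x \<in> I" for x using weight_pos[OF that] by simp
  fix g :: "real \<Rightarrow> real" and a b :: real
  assume g: "smooth1 g" and ab: "-1 < a" "b < 1" and supp: "\<forall>x. x \<notin> {a..b} \<longrightarrow> g x = 0"
  have [measurable]: "(\<lambda>x. sqrt (1 - x^2) * w x) \<in> borel_measurable (lebesgue_on I)"
    using L by auto
  have [measurable]: "(\<lambda>x. indicator {a..b} x :: real) \<in> borel_measurable (lebesgue_on I)"
    by (intro measurable_restrict_space1 borel_measurable_indicator) simp
  have gc: "continuous_on I (\<lambda>x. g x / sqrt (1 - x^2))"
    using weight_pos by (intro continuous_intros smooth1_continuous_on[OF g]) fastforce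
  have gm [measurable]: "(\<lambda>x. g x / sqrt (1 - x^2)) \<in> borel_measurable (lebesgue_on I)"
    by (rule continuous_measurable_I[OF gc])
  have gsq: "(g x / sqrt (1 - x^2))^2 = (g x)^2 / (1 - x^2)" if "x \<in> I" for x
    using weight_pos[OF that] by (simp add: power_divide)
  have "smooth1 (\<lambda>x. (g x)^2 / (1 - x^2))"
    using supp by (intro smooth1_divide_weight[OF smooth1_power[OF g] ab]) auto
  then have ig: "integrable (lebesgue_on I) (\<lambda>x. (g x / sqrt (1 - x^2))^2)"
    by (intro Bochner_Integration.integrable_cong[THEN iffD1, OF refl _ integrable_smooth1_I]) (auto simp: gsq)
  have fsq: "(indicator {a..b} x * (sqrt (1 - x^2) * w x))^2 = indicator {a..b} x * ((1 - x^2) * (w x)^2)" if "x \<in> I" for x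
    using sq[OF that] by (auto simp: indicator_def)
  have if2: "integrable (lebesgue_on I) (\<lambda>x. (indicator {a..b} x * (sqrt (1 - x^2) * w x))^2)"
    by (intro Bochner_Integration.integrable_cong[THEN iffD1, OF refl _ integrable_indicator_mult[OF iD]]) (auto simp: fsq)
  have "test1 g" using test1I[OF g ab] supp by blast
  then have "ip v (deriv g) = - (\<integral>x. w x * g x \<partial>lebesgue_on I)"
    using wd by (simp add: weak_deriv_def ip_def)
  also have "(\<integral>x. w x * g x \<partial>lebesgue_on I) =
      (\<integral>x. (indicator {a..b} x * (sqrt (1 - x^2) * w x)) * (g x / sqrt (1 - x^2)) \<partial>lebesgue_on I)"
  proof (rule Bochner_Integration.integral_cong[OF refl])
    fix x assume "x \<in> space (lebesgue_on I)"
    then have "1 - x^2 > 0" using weight_pos by simp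
    then show "w x * g x = (indicator {a..b} x * (sqrt (1 - x^2) * w x)) * (g x / sqrt (1 - x^2))"
      using supp by (cases "x \<in> {a..b}") auto
  qed
  finally have "(ip v (deriv g))^2 = (\<integral>x. (indicator {a..b} x * (sqrt (1 - x^2) * w x)) * (g x / sqrt (1 - x^2)) \<partial>lebesgue_on I)^2"
    by simp
  also have "\<dots> \<le> (\<integral>x. (indicator {a..b} x * (sqrt (1 - x^2) * w x))^2 \<partial>lebesgue_on I) * (\<integral>x. (g x / sqrt (1 - x^2))^2 \<partial>lebesgue_on I)"
    by (rule Cauchy_Schwarz_integral(2)[OF _ gm if2 ig]) measurable
  also have "(\<integral>x. (indicator {a..b} x * (sqrt (1 - x^2) * w x))^2 \<partial>lebesgue_on I) = (\<integral>x. indicator {a..b} x * ((1 - x^2) * (w x)^2) \<partial>lebesgue_on I)"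
    by (rule Bochner_Integration.integral_cong[OF refl]) (simp add: fsq)
  also have "(\<integral>x. (g x / sqrt (1 - x^2))^2 \<partial>lebesgue_on I) = (\<integral>x. (g x)^2 / (1 - x^2) \<partial>lebesgue_on I)"
    by (rule Bochner_Integration.integral_cong[OF refl]) (simp add: gsq)
  finally show "(ip v (deriv g))^2 \<le> (\<integral>x. (g x)^2 / (1 - x^2) \<partial>lebesgue_on I) *
          (\<integral>x. indicator {a..b} x * ((1 - x^2) * (w x)^2) \<partial>lebesgue_on I)"
    by (simp add: mult.commute)
qed

text \<open>The factor 2 is that of (a - b)^2 \<le> 2 a^2 + 2 b^2.\<close>

lemma energy_density_diff:
  assumes v: "L2 v1" "L2 v2" and "energy_density v1 D1" "energy_density v2 D2"
  shows "energy_density (\<lambda>x. v1 x - v2 x) (\<lambda>x. 2 * (D1 x + D2 x))"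
  unfolding energy_density_def
proof (intro conjI allI impI ballI)
  have i: "integrable (lebesgue_on I) D1" "integrable (lebesgue_on I) D2"
    and e: "\<And>g a b. smooth1 g \<Longrightarrow> -1 < a \<Longrightarrow> b < 1 \<Longrightarrow> \<forall>x. x \<notin> {a..b} \<longrightarrow> g x = 0 \<Longrightarrow>
       (ip v1 (deriv g))^2 \<le> (\<integral>x. (g x)^2 / (1 - x^2) \<partial>lebesgue_on I) * (\<integral>x. indicator {a..b} x * D1 x \<partial>lebesgue_on I)"
      "\<And>g a b. smooth1 g \<Longrightarrow> -1 < a \<Longrightarrow> b < 1 \<Longrightarrow> \<forall>x. x \<notin> {a..b} \<longrightarrow> g x = 0 \<Longrightarrow>
       (ip v2 (deriv g))^2 \<le> (\<integral>x. (g x)^2 / (1 - x^2) \<partial>lebesgue_on I) * (\<integral>x. indicator {a..b} x * D2 x \<partial>lebesgue_on I)"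
    using assms(3,4) unfolding energy_density_def by blast+
  show "integrable (lebesgue_on I) (\<lambda>x. 2 * (D1 x + D2 x))" using i by auto
  show "0 \<le> 2 * (D1 x + D2 x)" if "x \<in> I" for x using assms(3,4) that unfolding energy_density_def by simp
  fix g :: "real \<Rightarrow> real" and a b :: real
  assume g: "smooth1 g" and ab: "-1 < a" "b < 1" and supp: "\<forall>x. x \<notin> {a..b} \<longrightarrow> g x = 0"
  have L: "L2 (deriv g)" using g by (intro L2_smooth1 smooth1_deriv)
  have "(\<integral>x. indicator {a..b} x * (2 * (D1 x + D2 x)) \<partial>lebesgue_on I) =
     (\<integral>x. 2 * (indicator {a..b} x * D1 x) + 2 * (indicator {a..b} x * D2 x) \<partial>lebesgue_on I)"
    by (simp add: algebra_simps)
  also have "\<dots> = 2 * (\<integral>x. indicator {a..b} x * D1 x \<partial>lebesgue_on I) + 2 * (\<integral>x. indicator {a..b} x * D2 x \<partial>lebesgue_on I)"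
    using integrable_indicator_mult[OF i(1)] integrable_indicator_mult[OF i(2)] by simp
  finally have R: "(\<integral>x. indicator {a..b} x * (2 * (D1 x + D2 x)) \<partial>lebesgue_on I) =
     2 * (\<integral>x. indicator {a..b} x * D1 x \<partial>lebesgue_on I) + 2 * (\<integral>x. indicator {a..b} x * D2 x \<partial>lebesgue_on I)" .
  have "ip (\<lambda>x. v1 x - v2 x) (deriv g) = ip v1 (deriv g) - ip v2 (deriv g)"
    by (rule ip_diff_left[OF v L])
  also have "(ip v1 (deriv g) - ip v2 (deriv g))^2 \<le> 2 * (ip v1 (deriv g))^2 + 2 * (ip v2 (deriv g))^2"
    using zero_le_power2[of "ip v1 (deriv g) + ip v2 (deriv g)"] unfolding power2_sum power2_diff by linarith
  also have "\<dots> \<le> 2 * ((\<integral>x. (g x)^2 / (1 - x^2) \<partial>lebesgue_on I) * (\<integral>x. indicator {a..b} x * D1 x \<partial>lebesgue_on I))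
      + 2 * ((\<integral>x. (g x)^2 / (1 - x^2) \<partial>lebesgue_on I) * (\<integral>x. indicator {a..b} x * D2 x \<partial>lebesgue_on I))"
    by (intro add_mono mult_left_mono e g ab supp) auto
  finally show "(ip (\<lambda>x. v1 x - v2 x) (deriv g))^2 \<le> (\<integral>x. (g x)^2 / (1 - x^2) \<partial>lebesgue_on I) *
     (\<integral>x. indicator {a..b} x * (2 * (D1 x + D2 x)) \<partial>lebesgue_on I)"
    unfolding R by (simp add: algebra_simps)
qed

text \<open>In the variable z = k (1 - x) this is 1/2 \<le> z \<le> 4. It contains the transition
  layers of the cut-offs at the three scales 2 k, k and k / 2, that is z in [1/2, 1], [1, 2] and
  [2, 4].\<close>

definition strip :: "real \<Rightarrow> real set" where
  "strip k = {1 - 4 / k .. 1 - 1 / (2 * k)}"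

definition mass :: "(real \<Rightarrow> real) \<Rightarrow> real \<Rightarrow> real" where
  "mass D k = (\<integral>x. indicator (strip k) x * D x \<partial>lebesgue_on I)"

lemma strip_bounds: "k \<ge> 4 \<Longrightarrow> x \<in> strip k \<Longrightarrow> 0 \<le> x \<and> x < 1 \<and> 1 - x^2 \<ge> 1 / (2 * k)"
proof -
  assume k: "k \<ge> 4" and x: "x \<in> strip k"
  have "4 / k \<le> 1" "1 / (2 * k) > 0" using k by auto
  then have x01: "0 \<le> x" "x < 1" using x unfolding strip_def atLeastAtMost_iff by linarith+
  have "1 - x \<ge> 1 / (2 * k)" using x unfolding strip_def by auto
  moreover have "1 - x^2 \<ge> 1 - x" using x01 by (simp add: power2_eq_square mult_left_le)
  ultimately show ?thesis using x01 by linarith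
qed

lemma strip_subset: "k \<ge> 4 \<Longrightarrow> strip k \<subseteq> I"
  using strip_bounds unfolding I_def by fastforce

lemma measure_strip: "k \<ge> 4 \<Longrightarrow> (\<integral>x. indicator (strip k) x \<partial>lebesgue_on I) \<le> 4 / k"
proof -
  assume k: "k \<ge> 4"
  have "(\<integral>x. indicator (strip k) x \<partial>lebesgue_on I) = (\<integral>x. (1::real) \<partial>lebesgue_on (strip k))"
    using strip_subset[OF k] integral_lebesgue_on_zero_outside[of "strip k" I "indicator (strip k)"]
    by (auto simp: strip_def intro!: Bochner_Integration.integral_cong)
  also have "\<dots> = measure lebesgue (strip k)"
    by (simp add: strip_def measure_restrict_space)
  also have "\<dots> \<le> 4 / k" using k by (simp add: strip_def field_simps)
  finally show ?thesis .
qed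

lemma integrable_indicator_strip: "integrable (lebesgue_on I) (\<lambda>x. indicator (strip k) x :: real)"
  using integrable_indicator_mult[OF integrable_smooth1_I[OF smooth1_const[of 1]]] by (simp add: strip_def)

text \<open>On the strip 1 / (1 - x^2) is at most 2 k, while the strip has length at most 4 / k. The
  product 8 does not depend on the scale, so the estimate loses nothing as k grows.\<close>

lemma energy_density_strip:
  assumes e: "energy_density v D" and k: "k \<ge> 4" and g: "smooth1 g"
    and supp: "\<And>x. x \<notin> strip k \<Longrightarrow> g x = 0" and C: "\<And>x. \<bar>g x\<bar> \<le> C"
  shows "(ip v (deriv g))^2 \<le> 8 * C^2 * mass D k"
proof -
  have ab: "-1 < 1 - 4 / k" "1 - 1 / (2 * k) < 1" using k by (auto simp: field_simps)
  have m0: "mass D k \<ge> 0" unfolding mass_def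
    using e by (intro Bochner_Integration.integral_nonneg_AE AE_I2) (auto simp: energy_density_def)
  have "smooth1 (\<lambda>x. (g x)^2 / (1 - x^2))"
    using supp by (intro smooth1_divide_weight[OF smooth1_power[OF g] ab]) (auto simp: strip_def)
  then have i: "integrable (lebesgue_on I) (\<lambda>x. (g x)^2 / (1 - x^2))" by (rule integrable_smooth1_I)
  have "(\<integral>x. (g x)^2 / (1 - x^2) \<partial>lebesgue_on I) \<le> (\<integral>x. C^2 * (2 * k) * indicator (strip k) x \<partial>lebesgue_on I)"
  proof (rule integral_mono[OF i])
    show "integrable (lebesgue_on I) (\<lambda>x. C^2 * (2 * k) * indicator (strip k) x)"
      by (intro integrable_mult_right integrable_indicator_strip)
    fix x
    show "(g x)^2 / (1 - x^2) \<le> C^2 * (2 * k) * indicator (strip k) x"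
    proof (cases "x \<in> strip k")
      case True
      have r: "1 - x^2 \<ge> 1 / (2 * k)" using strip_bounds[OF k True] by simp
      have "(g x)^2 \<le> C^2" using C[of x] by (metis abs_le_square_iff abs_of_nonneg abs_ge_zero order_trans)
      then have "(g x)^2 / (1 - x^2) \<le> C^2 / (1 / (2 * k))"
        using r k by (intro frac_le) auto
      then show ?thesis using True by simp
    next
      case False
      then show ?thesis using supp by simp
    qed
  qed
  also have "\<dots> = C^2 * (2 * k) * (\<integral>x. indicator (strip k) x \<partial>lebesgue_on I)"
    by (rule integral_mult_right_zero)
  also have "\<dots> \<le> C^2 * (2 * k) * (4 / k)"
    by (rule mult_left_mono[OF measure_strip[OF k]]) (use k in simp)
  also have "\<dots> = 8 * C^2" using k by simp
  finally have "(\<integral>x. (g x)^2 / (1 - x^2) \<partial>lebesgue_on I) * mass D k \<le> 8 * C^2 * mass D k"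
    by (rule mult_right_mono[OF _ m0])
  moreover have "(ip v (deriv g))^2 \<le> (\<integral>x. (g x)^2 / (1 - x^2) \<partial>lebesgue_on I) * mass D k"
    using e g ab supp unfolding energy_density_def mass_def strip_def by blast
  ultimately show ?thesis by linarith
qed

text \<open>At most four dyadic strips meet at any point.\<close>
lemma sum_strip_le:
  assumes i: "integrable (lebesgue_on I) D" and D: "\<And>x. x \<in> I \<Longrightarrow> D x \<ge> 0"
  shows "(\<Sum>j=2..J. mass D (2^j)) \<le> 4 * (\<integral>x. D x \<partial>lebesgue_on I)"
proof -
  have ij: "integrable (lebesgue_on I) (\<lambda>x. indicator (strip k) x * D x)" for k
    unfolding strip_def by (rule integrable_indicator_mult[OF i])
  have "(\<Sum>j=2..J. mass D (2^j)) = (\<integral>x. (\<Sum>j=2..J. indicator (strip (2^j)) x * D x) \<partial>lebesgue_on I)"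
    unfolding mass_def by (rule Bochner_Integration.integral_sum[symmetric]) (rule ij)
  also have "\<dots> \<le> (\<integral>x. 4 * D x \<partial>lebesgue_on I)"
  proof (rule integral_mono)
    show "integrable (lebesgue_on I) (\<lambda>x. \<Sum>j=2..J. indicator (strip (2^j)) x * D x)"
      by (intro Bochner_Integration.integrable_sum ij)
    fix x assume "x \<in> space (lebesgue_on I)"
    then have x: "x < 1" "D x \<ge> 0" using D by (auto simp: I_def)
    let ?A = "{j\<in>{2..J}. x \<in> strip (2^j)}"
    \<comment> \<open>The bounds 1/2 and 4 of a strip in the variable k (1 - x) have ratio 8 =
      2^3.\<close>
    have close: "j' \<le> j + 3" if "j \<in> ?A" "j' \<in> ?A" for j j'
    proof -
      have "1 / (2 * 2^j) \<le> 1 - x" "1 - x \<le> 4 / 2^j'" using that by (auto simp: strip_def)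
      then have "1 / (2 * 2^j) \<le> (4::real) / 2^j'" by linarith
      then have "(2::real)^j' \<le> 2^(j + 3)" by (simp add: field_simps power_add)
      then show ?thesis by simp
    qed
    have "card ?A \<le> 4"
    proof (cases "?A = {}")
      case False
      define m where "m = Min ?A"
      have m: "m \<in> ?A" using False Min_in[of ?A] unfolding m_def by simp
      have "?A \<subseteq> {m..m + 3}"
      proof
        fix j assume j: "j \<in> ?A"
        then have "m \<le> j" unfolding m_def by (intro Min_le) auto
        then show "j \<in> {m..m + 3}" using close[OF m j] by simp
      qed
      then have "card ?A \<le> card {m..m + 3}" by (intro card_mono) auto
      then show ?thesis by simp
    next
      case True
      show ?thesis unfolding True by simp
    qed
    then have "real (card ?A) * D x \<le> 4 * D x" using x by (intro mult_right_mono) auto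
    moreover have "(\<Sum>j=2..J. indicator (strip (2^j)) x * D x) = real (card ?A) * D x"
    proof -
      have "(\<Sum>j=2..J. indicator (strip (2^j)) x * D x) = (\<Sum>j=2..J. if x \<in> strip (2^j) then D x else 0)"
        by (intro sum.cong) (auto simp: indicator_def)
      also have "\<dots> = (\<Sum>j\<in>?A. D x)" by (simp add: sum.If_cases Int_def)
      finally show ?thesis by simp
    qed
    ultimately show "(\<Sum>j=2..J. indicator (strip (2^j)) x * D x) \<le> 4 * D x" by simp
  qed (use i in auto)
  finally show ?thesis by simp
qed

text \<open>Each point of the interval lies outside all strips of large index, so dominated
  convergence with majorant |D| applies.\<close>

lemma mass_tendsto_0:
  assumes i: "integrable (lebesgue_on I) D"
  shows "(\<lambda>j. mass D (2^j)) \<longlonglongrightarrow> 0"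
proof -
  have "(\<lambda>j. \<integral>x. indicator (strip (2^j)) x * D x \<partial>lebesgue_on I) \<longlonglongrightarrow> (\<integral>x. 0 \<partial>lebesgue_on I)"
  proof (rule integral_dominated_convergence[where w = "\<lambda>x. \<bar>D x\<bar>"])
    show "(\<lambda>x. indicator (strip (2^j)) x * D x) \<in> borel_measurable (lebesgue_on I)" for j
      using integrable_indicator_mult[OF i] unfolding strip_def by blast
    show "AE x in lebesgue_on I. (\<lambda>j. indicator (strip (2^j)) x * D x) \<longlonglongrightarrow> 0"
    proof (rule AE_I2)
      fix x assume "x \<in> space (lebesgue_on I)"
      then have x: "1 - x > 0" by (simp add: I_def)
      obtain m where m: "4 / (1 - x) < 2^m" using real_arch_pow[of 2 "4 / (1 - x)"] by auto
      have "indicator (strip (2^j)) x * D x = 0" if "j \<ge> m" for j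
      proof -
        have "(2::real)^m \<le> 2^j" using that by simp
        then have "4 / (1 - x) < 2^j" using m by linarith
        then have "4 / 2^j < 1 - x" using x by (simp add: field_simps)
        then show ?thesis by (auto simp: strip_def indicator_def)
      qed
      then show "(\<lambda>j. indicator (strip (2^j)) x * D x) \<longlonglongrightarrow> 0"
        by (intro tendsto_eventually) (auto simp: eventually_sequentially)
    qed
  qed (use i in \<open>auto simp: indicator_def\<close>)
  then show ?thesis by (simp add: mass_def)
qed

subsection \<open>Dyadic kernels near the right endpoint\<close>

lemma DERIV_zero_between:
  fixes F f :: "real \<Rightarrow> real"
  assumes D: "\<And>x. (F has_real_derivative f x) (at x)"
    and z: "\<And>z. min x y < z \<Longrightarrow> z < max x y \<Longrightarrow> f z = 0"
  shows "F x = F y"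
proof (cases "x = y")
  case False
  then have "min x y < max x y" by auto
  then obtain u where "min x y < u" "u < max x y" "F (max x y) - F (min x y) = (max x y - min x y) * f u"
    using MVT2[of "min x y" "max x y" F f] D by blast
  then have "F (max x y) = F (min x y)" using z by simp
  then show ?thesis by (cases "x \<le> y") (auto simp: min_def max_def)
qed simp

definition ramp :: "real \<Rightarrow> real" where
  "ramp = (SOME R. (\<forall>x. (R has_real_derivative step x) (at x)) \<and> R 0 = 0)"

lemma ramp_DERIV: "(ramp has_real_derivative step x) (at x)" and ramp_at_0: "ramp 0 = 0"
  using someI_ex[OF ex_antiderivative[OF smooth1_continuous_on[OF smooth1_step]], folded ramp_def] by auto

lemma smooth1_ramp: "smooth1 ramp"
  by (rule smooth1_of_DERIV[OF ramp_DERIV smooth1_step])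

lemma ramp_eq_0: "z \<le> 1 \<Longrightarrow> ramp z = 0"
  using DERIV_zero_between[of ramp step z 0] by (auto simp: ramp_DERIV step_eq_0 ramp_at_0)

lemma ramp_eq_affine: "z \<ge> 2 \<Longrightarrow> ramp z = z - (2 - ramp 2)"
proof -
  assume "z \<ge> 2"
  have "ramp z - z = ramp 2 - 2"
    by (rule DERIV_zero_between[where f = "\<lambda>x. step x - 1"])
       (use \<open>z \<ge> 2\<close> in \<open>auto intro!: derivative_eq_intros ramp_DERIV simp: step_eq_1\<close>)
  then show ?thesis by simp
qed

text \<open>z is the convex combination of z / 2 and 2 z with weights 2/3 and 1/3; the inequality is
  the nonnegativity of \<open>hat\<close>.\<close>

lemma ramp_convex: "3 * ramp z \<le> ramp (2 * z) + 2 * ramp (z / 2)"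
proof -
  have c: "convex_on UNIV ramp"
    by (rule convex_on_realI[where f' = step]) (auto intro: ramp_DERIV monoD[OF mono_step])
  have "ramp ((1 - 1/3) *\<^sub>R (z / 2) + (1/3) *\<^sub>R (2 * z)) \<le> (1 - 1/3) * ramp (z / 2) + (1/3) * ramp (2 * z)"
    by (rule convex_onD[OF c]) auto
  then show ?thesis by simp
qed

text \<open>Smoothed version of the piecewise linear hat with nodes \<open>1/2, 1, 2\<close>; its second derivative is a
  combination of \<open>deriv step\<close> at three consecutive dyadic scales.\<close>
definition hat :: "real \<Rightarrow> real" where
  "hat z = ramp (2 * z) - 3 * ramp z + 2 * ramp (z / 2)"

lemma smooth1_hat: "smooth1 hat"
proof -
  have "smooth1 (\<lambda>z. ramp (2 * z + 0) - 3 * ramp z + 2 * ramp ((1/2) * z + 0))"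
    by (intro smooth1_add smooth1_diff smooth1_mult smooth1_const smooth1_affine smooth1_ramp)
  then show ?thesis by (simp add: hat_def[abs_def])
qed

lemma hat_nonneg: "hat z \<ge> 0"
  using ramp_convex[of z] by (simp add: hat_def)

lemma hat_eq_0: "z \<notin> {1/2..4} \<Longrightarrow> hat z = 0"
proof -
  assume "z \<notin> {1/2..4}"
  then consider "z < 1/2" | "z > 4" by fastforce
  then show ?thesis
  proof cases
    case 1 then show ?thesis by (simp add: hat_def ramp_eq_0)
  next
    \<comment> \<open>All three arguments exceed 2, where \<open>ramp\<close> is affine. The slopes
      cancel because 2 - 3 + 1 = 0 and the offsets because 1 - 3 + 2 = 0.\<close>
    case 2 then show ?thesis
      using ramp_eq_affine[of "2 * z"] ramp_eq_affine[of z] ramp_eq_affine[of "z / 2"]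
      by (simp add: hat_def)
  qed
qed

text \<open>The number \<open>ramp 2\<close> is unknown, but \<open>hat 1\<close> and
  \<open>hat 2\<close> are \<open>ramp 2\<close> and 2 - 2 \<open>ramp 2\<close>, which cannot both
  be nonpositive. The purpose is that \<open>hat\<close> is not identically zero, so that
  \<open>psi_mass\<close> can be divided by.\<close>

lemma hat_pos: "hat 1 > 0 \<or> hat 2 > 0"
proof -
  have "hat 1 = ramp 2" by (simp add: hat_def ramp_eq_0)
  moreover have "hat 2 = 2 - 2 * ramp 2"
    using ramp_eq_affine[of 4] by (simp add: hat_def ramp_eq_0)
  ultimately show ?thesis by linarith
qed

lemma hat_bounded: obtains H where "H \<ge> 0" "\<And>z. hat z \<le> H"
proof -
  have "compact (hat ` {1/2..4})"
    by (intro compact_continuous_image smooth1_continuous_on smooth1_hat compact_Icc)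
  then obtain H where "\<forall>y\<in>hat ` {1/2..4}. norm y \<le> H"
    using compact_imp_bounded bounded_iff by blast
  then have H: "\<bar>hat z\<bar> \<le> H" if "z \<in> {1/2..4}" for z using that by auto
  have "H \<ge> 0" by (rule order_trans[OF abs_ge_zero H[of 1]]) simp
  moreover have "hat z \<le> H" for z
    using H[of z] hat_eq_0[of z] \<open>H \<ge> 0\<close> by (cases "z \<in> {1/2..4}") auto
  ultimately show ?thesis using that by blast
qed

text \<open>A bump of unit mass at distance between 1 / k and 2 / k from the right endpoint;
  \<open>ip v (kern (2^j))\<close> is the boundary average w_j.\<close>

definition kern :: "real \<Rightarrow> real \<Rightarrow> real" where
  "kern k x = k * deriv step (k * (1 - x))"

lemma step_reflected_DERIV: "((\<lambda>x. step (k * (1 - x))) has_real_derivative - kern k x) (at x)"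
  unfolding kern_def by (rule DERIV_cong[OF DERIV_chain2[OF step_DERIV]]) (auto intro!: derivative_eq_intros)

lemma smooth1_scaled: "smooth1 f \<Longrightarrow> smooth1 (\<lambda>x. f (k * (1 - x)))"
  using smooth1_affine[of f "-k" k] by (simp add: algebra_simps)

lemma smooth1_kern: "smooth1 (kern k)"
  unfolding kern_def[abs_def]
  by (intro smooth1_mult smooth1_const smooth1_scaled smooth1_deriv smooth1_step)

lemma kern_nonneg: "k \<ge> 0 \<Longrightarrow> kern k x \<ge> 0"
  by (simp add: kern_def deriv_step_nonneg)

lemma kern_eq_0: "k * (1 - x) \<notin> {1..2} \<Longrightarrow> kern k x = 0"
  by (simp add: kern_def deriv_step_eq_0)

lemma integral_kern: assumes "k \<ge> 1" shows "(\<integral>x. kern k x \<partial>lebesgue_on I) = 1"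
proof -
  have "(\<integral>x. - kern k x \<partial>lebesgue_on I) = step (k * (1 - 1)) - step (k * (1 - (-1)))"
    by (rule integral_I_FTC[OF step_reflected_DERIV])
       (use integrable_smooth1_I[OF smooth1_kern] in auto)
  then show ?thesis using assms by (simp add: step_eq_0 step_eq_1)
qed

text \<open>Differentiating the three ramps twice gives the factors 4, -3 and 1/2 in front of
  \<open>deriv step\<close>. Since \<open>kern\<close> at scale c already contains one factor c,
  these become the coefficients 2, -3 and 1, whose sum is 0.\<close>

lemma hat_scaled_deriv2:
  "deriv (deriv (\<lambda>x. hat (k * (1 - x)))) x = k * (2 * kern (2 * k) x - 3 * kern k x + kern (k / 2) x)"
proof -
  have ch: "((\<lambda>x. f (c * (1 - x))) has_real_derivative f' (c * (1 - x)) * (- c)) (at x)"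
    if "\<And>z. (f has_real_derivative f' z) (at z)" for f f' :: "real \<Rightarrow> real" and c x
    by (rule DERIV_chain2[OF that]) (auto intro!: derivative_eq_intros)
  have h: "(\<lambda>x. hat (k * (1 - x))) = (\<lambda>x. ramp (2 * k * (1 - x)) - 3 * ramp (k * (1 - x)) + 2 * ramp (k / 2 * (1 - x)))"
    by (auto simp: hat_def field_simps)
  have "((\<lambda>x. hat (k * (1 - x))) has_real_derivative
     - k * (2 * step (2 * k * (1 - x)) - 3 * step (k * (1 - x)) + step (k / 2 * (1 - x)))) (at x)" for x
    unfolding h
    by (rule DERIV_cong[OF DERIV_add[OF DERIV_diff[OF ch[OF ramp_DERIV] DERIV_cmult[OF ch[OF ramp_DERIV]]]
          DERIV_cmult[OF ch[OF ramp_DERIV]]]]) (simp add: algebra_simps)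
  then have d1: "deriv (\<lambda>x. hat (k * (1 - x))) =
     (\<lambda>x. - k * (2 * step (2 * k * (1 - x)) - 3 * step (k * (1 - x)) + step (k / 2 * (1 - x))))"
    by (intro ext DERIV_imp_deriv)
  show ?thesis unfolding d1
    by (rule DERIV_imp_deriv, rule DERIV_cong[OF DERIV_cmult[OF DERIV_add[OF DERIV_diff[OF
            DERIV_cmult[OF step_reflected_DERIV] DERIV_cmult[OF step_reflected_DERIV]] step_reflected_DERIV]]])
       (simp add: algebra_simps)
qed

text \<open>The division cancels the weight of the equation: its adjoint operator applied to
  \<open>psi\<close> is a multiple of the second derivative of the scaled \<open>hat\<close>.
  Pairing with \<open>psi\<close> gives the averages Q_j, up to the normalisation by
  \<open>psi_mass\<close>.\<close>

definition psi :: "real \<Rightarrow> real \<Rightarrow> real" where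
  "psi k x = hat (k * (1 - x)) / (1 - x^2)"

definition psi_mass :: "real \<Rightarrow> real" where
  "psi_mass k = (\<integral>x. psi k x \<partial>lebesgue_on I)"

lemma mem_strip: "k > 0 \<Longrightarrow> x \<in> strip k \<longleftrightarrow> k * (1 - x) \<in> {1/2..4}"
  by (auto simp: strip_def field_simps)

lemma psi_eq_0: "k > 0 \<Longrightarrow> x \<notin> strip k \<Longrightarrow> psi k x = 0"
  using hat_eq_0 by (simp add: mem_strip psi_def)

lemma smooth1_psi: assumes "k \<ge> 4" shows "smooth1 (psi k)"
  unfolding psi_def[abs_def]
proof (rule smooth1_divide_weight)
  show "smooth1 (\<lambda>x. hat (k * (1 - x)))" by (rule smooth1_scaled[OF smooth1_hat])
  show "-1 < 1 - 4 / k" "1 - 1 / (2 * k) < 1" using assms by (auto simp: field_simps)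
  show "hat (k * (1 - x)) = 0" if "x \<notin> {1 - 4 / k..1 - 1 / (2 * k)}" for x
    using that assms mem_strip[of k x] hat_eq_0 by (auto simp: strip_def)
qed

lemma test1_psi: assumes "k \<ge> 4" shows "test1 (psi k)"
proof (rule test1I[OF smooth1_psi[OF assms]])
  show "-1 < 1 - 4 / k" "1 - 1 / (2 * k) < 1" using assms by (auto simp: field_simps)
  show "psi k x = 0" if "x \<notin> {1 - 4 / k..1 - 1 / (2 * k)}" for x
    using that assms psi_eq_0[of k x] by (auto simp: strip_def)
qed

lemma weight_psi: assumes "k \<ge> 4" shows "(\<lambda>x. (1 - x^2) * psi k x) = (\<lambda>x. hat (k * (1 - x)))"
proof
  fix x show "(1 - x^2) * psi k x = hat (k * (1 - x))"
  proof (cases "x \<in> strip k")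
    case True
    then have "1 - x^2 > 0" using weight_pos strip_subset[OF assms] by blast
    then show ?thesis by (simp add: psi_def)
  next
    case False
    then show ?thesis using assms hat_eq_0 mem_strip[of k x] by (simp add: psi_def)
  qed
qed

lemma psi_nonneg: assumes "k \<ge> 4" shows "psi k x \<ge> 0"
proof (cases "x \<in> strip k")
  case True
  then have "1 - x^2 > 0" using weight_pos strip_subset[OF assms] by blast
  then show ?thesis using hat_nonneg by (simp add: psi_def)
next
  case False
  then show ?thesis using psi_eq_0[of k x] assms by simp
qed

lemma psi_le: assumes "k \<ge> 4" "\<And>z. hat z \<le> H" "H \<ge> 0" shows "psi k x \<le> 2 * k * H"
proof (cases "x \<in> strip k")
  case True
  then have "1 - x^2 \<ge> 1 / (2 * k)" using strip_bounds assms by blast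
  then have "psi k x \<le> H / (1 / (2 * k))"
    unfolding psi_def using assms hat_nonneg by (intro frac_le) auto
  then show ?thesis by (simp add: mult_ac)
next
  case False
  then show ?thesis using assms psi_eq_0 by simp
qed

lemma psi_antiderivative:
  assumes k: "k \<ge> 4"
  obtains P where "\<And>x. (P has_real_derivative psi k x) (at x)" "mono P"
    "\<And>x. x \<le> 1 - 4 / k \<Longrightarrow> P x = 0" "\<And>x. x \<ge> 1 - 1 / (2 * k) \<Longrightarrow> P x = psi_mass k"
proof -
  have b: "-1 < 1 - 4 / k" "1 - 1 / (2 * k) < 1" using k by (auto simp: field_simps)
  obtain F where F: "\<And>x. (F has_real_derivative psi k x) (at x)"
    using ex_antiderivative[OF smooth1_continuous_on[OF smooth1_psi[OF k]]] by blast
  define P where "P x = F x - F (-1)" for x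
  have P: "(P has_real_derivative psi k x) (at x)" for x
    unfolding P_def using F by (auto intro!: derivative_eq_intros)
  have m: "psi_mass k = P 1" unfolding psi_mass_def P_def
    by (rule integral_I_FTC[OF F integrable_smooth1_I[OF smooth1_psi[OF k]]])
  show ?thesis
  proof
    show "mono P"
      by (rule monoI, rule DERIV_nonneg_imp_nondecreasing) (use P psi_nonneg[OF k] in blast)+
    show "P x = 0" if "x \<le> 1 - 4 / k" for x
    proof -
      have "P x = P (-1)"
        by (rule DERIV_zero_between[OF P]) (rule psi_eq_0, use k that b in \<open>auto simp: strip_def\<close>)
      then show ?thesis by (simp add: P_def)
    qed
    show "P x = psi_mass k" if "x \<ge> 1 - 1 / (2 * k)" for x
      unfolding m
      by (rule DERIV_zero_between[OF P]) (rule psi_eq_0, use k that b in \<open>auto simp: strip_def\<close>)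
  qed (rule P)
qed

text \<open>If the total mass were 0, the monotone antiderivative would vanish identically, and with
  it \<open>psi\<close> and \<open>hat\<close>.\<close>

lemma psi_mass_pos: assumes k: "k \<ge> 4" shows "psi_mass k > 0"
proof -
  obtain P where P: "\<And>x. (P has_real_derivative psi k x) (at x)" "mono P"
    "\<And>x. x \<le> 1 - 4 / k \<Longrightarrow> P x = 0" "\<And>x. x \<ge> 1 - 1 / (2 * k) \<Longrightarrow> P x = psi_mass k"
    using psi_antiderivative[OF k] by blast
  have b: "-1 \<le> 1 - 4 / k" "1 - 1 / (2 * k) \<le> 1" using k by (auto simp: field_simps)
  have ends: "P x = 0" if "x \<le> -1" for x using P(3) that b by simp
  have ends': "P x = psi_mass k" if "x \<ge> 1" for x using that b(2) by (intro P(4)) linarith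
  have "psi_mass k \<ge> 0"
    using monoD[OF P(2), of "-1" 1] ends[of "-1"] ends'[of 1] by simp
  moreover have "psi_mass k \<noteq> 0"
  proof
    assume 0: "psi_mass k = 0"
    have "P x = 0" for x
      using monoD[OF P(2), of "min x (-1)" x] monoD[OF P(2), of x "max x 1"]
        ends[of "min x (-1)"] ends'[of "max x 1"] 0 by simp
    then have "P = (\<lambda>x. 0)" by auto
    then have "psi k x = 0" for x using P(1)[of x] DERIV_unique[OF _ DERIV_const] by blast
    then have "(\<lambda>x. hat (k * (1 - x))) = (\<lambda>x. 0)" using weight_psi[OF k] by auto
    then have "hat (k * (1 - (1 - z / k))) = 0" for z by meson
    then show False using hat_pos k by simp
  qed
  ultimately show ?thesis by simp
qed

text \<open>The difference of two kernels of equal mass is the derivative of a function supported in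
  one strip, here a difference of two cut-offs with values in [-1, 1]. The two choices of c compare
  w_j with its upper and its lower neighbour at the cost of the same strip.\<close>

lemma kern_doubling:
  assumes v: "L2 v" and e: "energy_density v D" and k: "k \<ge> 4" and c: "c = k \<or> c = k / 2"
  shows "(ip v (kern (2 * c)) - ip v (kern c))^2 \<le> 8 * mass D k"
proof -
  define g where "g x = step (c * (1 - x)) - step (2 * c * (1 - x))" for x
  have g: "smooth1 g" unfolding g_def by (intro smooth1_diff smooth1_scaled smooth1_step)
  have "(g has_real_derivative kern (2 * c) x - kern c x) (at x)" for x
    unfolding g_def by (auto intro!: derivative_eq_intros step_reflected_DERIV[of "2 * c"] step_reflected_DERIV[of c])
  then have d: "deriv g = (\<lambda>x. kern (2 * c) x - kern c x)" by (intro ext DERIV_imp_deriv)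
  have c0: "c > 0" using c k by auto
  have "(ip v (deriv g))^2 \<le> 8 * 1^2 * mass D k"
  proof (rule energy_density_strip[OF e k g])
    fix x show "\<bar>g x\<bar> \<le> 1"
      using step_nonneg[of "c * (1 - x)"] step_le_1[of "c * (1 - x)"]
        step_nonneg[of "2 * c * (1 - x)"] step_le_1[of "2 * c * (1 - x)"] unfolding g_def by linarith
    assume "x \<notin> strip k"
    then consider "k * (1 - x) < 1/2" | "k * (1 - x) > 4" using k mem_strip[of k x] by fastforce
    then show "g x = 0"
    proof cases
      case 1
      then have "c * (1 - x) \<le> 1/2" "2 * c * (1 - x) \<le> 1" using c by auto
      then show ?thesis by (simp add: g_def step_eq_0)
    next
      case 2
      then have "c * (1 - x) \<ge> 2" "2 * c * (1 - x) \<ge> 2" using c by auto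
      then show ?thesis by (simp add: g_def step_eq_1)
    qed
  qed
  then show ?thesis
    unfolding d using v by (simp add: ip_diff_right L2_smooth1 smooth1_kern)
qed

text \<open>The normalised \<open>psi\<close> and \<open>kern\<close> both have unit mass, so the
  antiderivative of their difference vanishes on both sides of the strip: there
  \<open>P x / m\<close> and the cut-off take the values 0 and 1 on the left, 1 and 0 on the
  right.\<close>

lemma psi_average:
  assumes v: "L2 v" and e: "energy_density v D" and k: "k \<ge> 4"
  shows "(ip v (psi k) / psi_mass k - ip v (kern k))^2 \<le> 8 * mass D k"
proof -
  obtain P where P: "\<And>x. (P has_real_derivative psi k x) (at x)" "mono P"
    "\<And>x. x \<le> 1 - 4 / k \<Longrightarrow> P x = 0" "\<And>x. x \<ge> 1 - 1 / (2 * k) \<Longrightarrow> P x = psi_mass k"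
    using psi_antiderivative[OF k] by blast
  define m where "m = psi_mass k"
  have m0: "m > 0" unfolding m_def by (rule psi_mass_pos[OF k])
  define g where "g x = P x / m + step (k * (1 - x)) - 1" for x
  have "smooth1 P" by (rule smooth1_of_DERIV[OF P(1) smooth1_psi[OF k]])
  then have g: "smooth1 g" unfolding g_def
    by (intro smooth1_diff smooth1_add smooth1_divide_const smooth1_const smooth1_scaled smooth1_step)
  have "(g has_real_derivative (1 / m) * psi k x - kern k x) (at x)" for x
    unfolding g_def using m0 by (auto intro!: derivative_eq_intros step_reflected_DERIV P(1))
  then have d: "deriv g = (\<lambda>x. (1 / m) * psi k x - kern k x)" by (intro ext DERIV_imp_deriv)
  have "(ip v (deriv g))^2 \<le> 8 * 1^2 * mass D k"
  proof (rule energy_density_strip[OF e k g])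
    fix x
    have "0 \<le> P x" "P x \<le> m"
      using monoD[OF P(2), of "min x (1 - 4 / k)" x] monoD[OF P(2), of x "max x (1 - 1 / (2 * k))"]
        P(3)[of "min x (1 - 4 / k)"] P(4)[of "max x (1 - 1 / (2 * k))"] by (auto simp: m_def)
    then have "0 \<le> P x / m" "P x / m \<le> 1" using m0 by auto
    then show "\<bar>g x\<bar> \<le> 1"
      using step_nonneg[of "k * (1 - x)"] step_le_1[of "k * (1 - x)"] unfolding g_def by linarith
    assume "x \<notin> strip k"
    then consider "x < 1 - 4 / k" | "x > 1 - 1 / (2 * k)" unfolding strip_def by fastforce
    then show "g x = 0"
    proof cases
      case 1
      then have "k * (1 - x) \<ge> 2" using k by (simp add: field_simps)
      then show ?thesis using 1 P(3) by (simp add: g_def step_eq_1)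
    next
      case 2
      then have "k * (1 - x) \<le> 1" using k by (simp add: field_simps)
      then show ?thesis using 2 P(4) m0 by (simp add: g_def step_eq_0 m_def)
    qed
  qed
  moreover have "ip v (deriv g) = ip v (psi k) / m - ip v (kern k)"
    unfolding d using v
    by (subst ip_diff_right) (auto simp: ip_cmult_right[of v "1 / m" "psi k", simplified] intro!: L2_cmult L2_smooth1 smooth1_kern smooth1_psi k)
  ultimately show ?thesis by (simp add: m_def)
qed

text \<open>Bounding one of the two factors in the square of \<open>psi\<close> by 2 k H leaves
  \<open>psi_mass k\<close> once, which cancels the denominator. Summed over dyadic k this controls
  the terminal value of the telescoped sum by the L^2 norm alone.\<close>

lemma psi_square_le:
  assumes v: "L2 v" and k: "k \<ge> 4" and H: "\<And>z. hat z \<le> H" "H \<ge> 0"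
  shows "(ip v (psi k))^2 / (k * psi_mass k) \<le> 2 * H * mass (\<lambda>x. (v x)^2) k"
proof -
  have v2: "integrable (lebesgue_on I) (\<lambda>x. (v x)^2)" using v by (rule L2_square_integrable)
  define f where "f x = indicator (strip k) x * v x" for x
  have [measurable]: "v \<in> borel_measurable (lebesgue_on I)" using v by (rule L2_measurable)
  have [measurable]: "(\<lambda>x. indicator (strip k) x :: real) \<in> borel_measurable (lebesgue_on I)"
    using integrable_indicator_strip by blast
  have f [measurable]: "f \<in> borel_measurable (lebesgue_on I)" unfolding f_def by measurable
  have fsq: "(\<lambda>x. (f x)^2) = (\<lambda>x. indicator (strip k) x * (v x)^2)"
    by (auto simp: f_def indicator_def)
  have "L2 f" unfolding L2_def fsq using f integrable_indicator_mult[OF v2] by (simp add: strip_def)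
  have ff: "ip f f = mass (\<lambda>x. (v x)^2) k"
    using fsq by (simp add: ip_def mass_def power2_eq_square[symmetric])
  have "ip v (psi k) = ip f (psi k)"
    unfolding ip_def f_def using psi_eq_0[of k] k
    by (intro Bochner_Integration.integral_cong) (auto simp: indicator_def)
  then have "(ip v (psi k))^2 \<le> ip f f * ip (psi k) (psi k)"
    using ip_Cauchy_Schwarz[OF \<open>L2 f\<close> L2_smooth1[OF smooth1_psi[OF k]]] by simp
  also have "ip (psi k) (psi k) \<le> (\<integral>x. 2 * k * H * psi k x \<partial>lebesgue_on I)"
    unfolding ip_def
    using psi_le[OF k H] psi_nonneg[OF k]
    by (intro integral_mono integrable_smooth1_I smooth1_mult smooth1_const smooth1_psi k mult_right_mono) auto
  also have "\<dots> = 2 * k * H * psi_mass k" by (simp add: psi_mass_def)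
  finally have "(ip v (psi k))^2 \<le> ip f f * (2 * k * H * psi_mass k)"
    using ip_self_nonneg[of f] by (simp add: mult_left_mono)
  then show ?thesis
    using psi_mass_pos[OF k] k unfolding ff by (simp add: field_simps)
qed

text \<open>The kernels are nonnegative, of unit mass, and eventually supported where |u| < e /
  2.\<close>

lemma kern_trace_tendsto:
  assumes u: "continuous_on I u" and v: "AE x in lebesgue_on I. u x = v x" and "L2 v"
    and lim: "(u \<longlongrightarrow> 0) (at_left 1)"
  shows "(\<lambda>j. ip v (kern (2^j))) \<longlonglongrightarrow> 0"
proof (rule LIMSEQ_I)
  fix e :: real assume e: "e > 0"
  have "\<forall>\<^sub>F x in at_left 1. \<bar>u x\<bar> < e / 2"
    using tendstoD[OF lim, of "e / 2"] e by (simp add: dist_real_def)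
  then obtain b where b: "b < 1" "\<And>x. b < x \<Longrightarrow> x < 1 \<Longrightarrow> \<bar>u x\<bar> < e / 2"
    by (auto simp: eventually_at_left_field)
  obtain m where m: "2 / (1 - b) < 2^m" using real_arch_pow[of 2 "2 / (1 - b)"] by auto
  have um: "u \<in> borel_measurable (lebesgue_on I)" by (rule continuous_measurable_I[OF u])
  have "norm (ip v (kern (2^j)) - 0) < e" if "j \<ge> m" for j
  proof -
    define k where "k = (2::real)^j"
    have k1: "k \<ge> 1" by (simp add: k_def)
    have "(2::real)^m \<le> 2^j" using that by simp
    then have "2 / (1 - b) < k" using m unfolding k_def by linarith
    then have k2: "2 < k * (1 - b)" using b by (simp add: field_simps)
    have ae: "AE x in lebesgue_on I. norm (v x * kern k x) \<le> e / 2 * kern k x"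
      using v
    proof (rule AE_mp, intro AE_I2 impI)
      fix x assume x: "x \<in> space (lebesgue_on I)" and uv: "u x = v x"
      show "norm (v x * kern k x) \<le> e / 2 * kern k x"
      proof (cases "k * (1 - x) \<le> 2")
        case True
        then have "k * (1 - x) < k * (1 - b)" using k2 by linarith
        then have "b < x" using k1 by simp
        then have "\<bar>v x\<bar> \<le> e / 2" using b(2)[of x] x uv by (auto simp: I_def)
        then show ?thesis using kern_nonneg[of k x] k1 mult_right_mono[of "\<bar>v x\<bar>" "e / 2" "kern k x"]
          by (simp add: abs_mult)
      next
        case False
        then show ?thesis by (simp add: kern_eq_0)
      qed
    qed
    have "norm (ip v (kern k)) \<le> (\<integral>x. norm (v x * kern k x) \<partial>lebesgue_on I)"
      unfolding ip_def by (rule integral_norm_bound)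
    also have "\<dots> \<le> (\<integral>x. e / 2 * kern k x \<partial>lebesgue_on I)"
    proof (rule integral_mono_AE[OF _ _ ae])
      show "integrable (lebesgue_on I) (\<lambda>x. norm (v x * kern k x))"
        by (intro integrable_norm L2_mult_integrable \<open>L2 v\<close> L2_smooth1 smooth1_kern)
      show "integrable (lebesgue_on I) (\<lambda>x. e / 2 * kern k x)"
        by (intro integrable_mult_right integrable_smooth1_I smooth1_kern)
    qed
    also have "\<dots> = e / 2" using integral_kern[OF k1] by simp
    finally show ?thesis using e by (simp add: k_def)
  qed
  then show "\<exists>m. \<forall>j\<ge>m. norm (ip v (kern (2^j)) - 0) < e" by blast
qed

subsection \<open>Discrete energy estimate\<close>

text \<open>Discrete form of \<open>\<integral> \<chi> W W\<^sub>x\<^sub>x = - \<integral> \<chi> W\<^sub>x\<^sup>2 + \<integral> \<chi>\<^sub>x\<^sub>x W\<^sup>2 / 2\<close> on a dyadic grid: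
  the sum telescopes up to squares of increments.\<close>
lemma dyadic_summation:
  fixes w q m :: "nat \<Rightarrow> real"
  assumes d: "\<And>j. j \<ge> 2 \<Longrightarrow> (w (Suc j) - w j)^2 \<le> 8 * m j" "\<And>j. j \<ge> 2 \<Longrightarrow> (w j - w (j - 1))^2 \<le> 8 * m j"
    and e: "\<And>j. j \<ge> 2 \<Longrightarrow> (q j - w j)^2 \<le> 8 * m j" and J: "J \<ge> 2"
  shows "(w (Suc J))^2 / 4 \<le> (\<Sum>j=2..J. q j * (2 * w (Suc j) - 3 * w j + w (j - 1))) + (w 2)^2 + 68 * (\<Sum>j=2..J. m j)"
proof -
  define P where "P j = 2 * w (Suc j) - 3 * w j + w (j - 1)" for j
  have incr: "(w (Suc j))^2 - (w j)^2 / 2 - ((w j)^2 - (w (j - 1))^2 / 2) \<le> q j * P j + 56 * m j" if "j \<ge> 2" for j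
  proof -
    define D E Z where "D = w (Suc j) - w j" and "E = w j - w (j - 1)" and "Z = q j - w j"
    have P: "P j = 2 * D - E" by (simp add: P_def D_def E_def)
    have "(w (Suc j))^2 - (w j)^2 / 2 - ((w j)^2 - (w (j - 1))^2 / 2) = w j * P j + D^2 + E^2 / 2"
      by (simp add: P_def D_def E_def power2_eq_square field_simps)
    moreover have "w j * P j = q j * P j - Z * P j" by (simp add: Z_def algebra_simps)
    \<comment> \<open>Half of (Z + P)^2 \<ge> 0 gives Z^2 / 2 + P^2 / 2, and P^2 = (2 D - E)^2 \<le>
      8 D^2 + 2 E^2. Altogether the errors are 5 D^2 + 3/2 E^2 + Z^2 / 2, and 8 (5 + 3/2 + 1/2) =
      56.\<close>
    moreover have "- (Z * P j) \<le> Z^2 / 2 + 4 * D^2 + E^2"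
    proof -
      have "0 \<le> (Z + P j)^2" "0 \<le> (2 * D + E)^2" by simp_all
      then show ?thesis unfolding P by (simp add: power2_eq_square algebra_simps)
    qed
    moreover have "D^2 \<le> 8 * m j" "E^2 \<le> 8 * m j" "Z^2 \<le> 8 * m j"
      using d e that by (simp_all add: D_def E_def Z_def)
    ultimately show ?thesis by linarith
  qed
  have main: "(w (Suc J))^2 - (w J)^2 / 2 \<le> (\<Sum>j=2..J. q j * P j) + (w 2)^2 + 56 * (\<Sum>j=2..J. m j)"
    using J
  proof (induction J rule: dec_induct)
    case base
    show ?case using incr[of 2] by (simp, use zero_le_power2[of "w (Suc 0)"] in linarith)
  next
    case (step n)
    then show ?case using incr[of "Suc n"] by simp
  qed
  have m0: "m j \<ge> 0" if "j \<ge> 2" for j using d(1)[OF that] zero_le_power2[of "w (Suc j) - w j"] by linarith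
  have "m J \<le> (\<Sum>j=2..J. m j)" using J m0 by (intro member_le_sum) auto
  \<comment> \<open>The term (w J)^2 / 2 is absorbed into three quarters of (w (J + 1))^2, which
    leaves the factor 1/4 of the claim; the increment adds 3/2 times 8 = 12 to 56, hence 68.\<close>
  moreover have "(w J)^2 / 2 \<le> 3 / 4 * (w (Suc J))^2 + 3 / 2 * (w (Suc J) - w J)^2"
  proof -
    have "0 \<le> (3 / 2 * w (Suc J) - w J)^2" by simp
    then show ?thesis by (simp add: power2_eq_square field_simps)
  qed
  ultimately show ?thesis using main d(1)[OF J] unfolding P_def by linarith
qed

text \<open>\<open>dyadic_summation\<close> applied to the boundary averages at one fixed time; 272
  = 68 times 4, the 4 being the overlap of the strips.\<close>

lemma dyadic_energy:
  assumes v: "L2 v" and e: "energy_density v D" and J: "J \<ge> 2"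
  shows "(ip v (kern (2^Suc J)))^2 / 4 \<le>
    (\<Sum>j=2..J. ip v (psi (2^j)) / psi_mass (2^j) *
       (2 * ip v (kern (2^Suc j)) - 3 * ip v (kern (2^j)) + ip v (kern (2^(j - 1))))) +
    (ip v (kern (2^2)))^2 + 272 * (\<integral>x. D x \<partial>lebesgue_on I)"
proof -
  have k: "(2::real)^j \<ge> 4" if "j \<ge> 2" for j
    using power_increasing[OF that, of "2::real"] by simp
  have half: "(2::real)^(j - 1) = 2^j / 2" if "j \<ge> 2" for j
    using that by (cases j) auto
  have "(ip v (kern (2^Suc J)))^2 / 4 \<le>
    (\<Sum>j=2..J. ip v (psi (2^j)) / psi_mass (2^j) *
       (2 * ip v (kern (2^Suc j)) - 3 * ip v (kern (2^j)) + ip v (kern (2^(j - 1))))) +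
    (ip v (kern (2^2)))^2 + 68 * (\<Sum>j=2..J. mass D (2^j))"
  proof (rule dyadic_summation[OF _ _ _ J, where w = "\<lambda>j. ip v (kern (2^j))"])
    fix j :: nat assume j: "j \<ge> 2"
    show "(ip v (kern (2^Suc j)) - ip v (kern (2^j)))^2 \<le> 8 * mass D (2^j)"
      using kern_doubling[OF v e k[OF j], of "2^j"] by simp
    show "(ip v (kern (2^j)) - ip v (kern (2^(j - 1))))^2 \<le> 8 * mass D (2^j)"
      unfolding half[OF j] using kern_doubling[OF v e k[OF j], of "2^j / 2"] by simp
    show "(ip v (psi (2^j)) / psi_mass (2^j) - ip v (kern (2^j)))^2 \<le> 8 * mass D (2^j)"
      by (rule psi_average[OF v e k[OF j]])
  qed
  moreover have "(\<Sum>j=2..J. mass D (2^j)) \<le> 4 * (\<integral>x. D x \<partial>lebesgue_on I)"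
    using e by (intro sum_strip_le) (auto simp: energy_density_def)
  ultimately show ?thesis by linarith
qed

text \<open>A bound on second moments gives uniform integrability: |f| \<le> min |f| R + f^2 / R
  splits off a part with small integral, uniformly in n, and the truncated part converges by
  dominated convergence on the finite measure.\<close>

lemma tendsto_L1_of_L2_bounded:
  fixes f :: "nat \<Rightarrow> 'a \<Rightarrow> real"
  assumes M: "finite_measure M" and f [measurable]: "\<And>n. f n \<in> borel_measurable M"
    and lim: "AE x in M. (\<lambda>n. f n x) \<longlonglongrightarrow> 0"
    and i: "\<And>n. integrable M (\<lambda>x. (f n x)^2)" and C: "\<And>n. (\<integral>x. (f n x)^2 \<partial>M) \<le> C"
  shows "(\<lambda>n. \<integral>x. \<bar>f n x\<bar> \<partial>M) \<longlonglongrightarrow> 0"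
proof (rule LIMSEQ_I)
  interpret finite_measure M by (rule M)
  fix e :: real assume e: "e > 0"
  have "0 \<le> (\<integral>x. (f 0 x)^2 \<partial>M)" by simp
  then have C0: "C \<ge> 0" using C[of 0] by linarith
  \<comment> \<open>Chosen so that C / R < e / 2, with the summand 1 covering C = 0.\<close>
  define R where "R = (2 * C + 1) / e"
  have R: "R > 0" using C0 e by (simp add: R_def)
  have im: "integrable M (\<lambda>x. min \<bar>f n x\<bar> R)" for n
    by (rule integrable_const_bound[where B = R]) (use R in auto)
  have "(\<lambda>n. \<integral>x. min \<bar>f n x\<bar> R \<partial>M) \<longlonglongrightarrow> (\<integral>x. 0 \<partial>M)"
  proof (rule integral_dominated_convergence[where w = "\<lambda>x. R"])
    show "AE x in M. (\<lambda>n. min \<bar>f n x\<bar> R) \<longlonglongrightarrow> 0"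
      using lim
    proof eventually_elim
      case (elim x)
      then have "(\<lambda>n. min \<bar>f n x\<bar> R) \<longlonglongrightarrow> min \<bar>0\<bar> R" by (intro tendsto_min tendsto_rabs tendsto_const)
      then show ?case using R by simp
    qed
  qed (use R in auto)
  then obtain m where m: "\<And>n. n \<ge> m \<Longrightarrow> norm ((\<integral>x. min \<bar>f n x\<bar> R \<partial>M) - 0) < e / 2"
    using LIMSEQ_D[of "\<lambda>n. \<integral>x. min \<bar>f n x\<bar> R \<partial>M" 0 "e / 2"] e by auto
  have "norm ((\<integral>x. \<bar>f n x\<bar> \<partial>M) - 0) < e" if "n \<ge> m" for n
  proof -
    have le: "\<bar>f n x\<bar> \<le> min \<bar>f n x\<bar> R + (f n x)^2 / R" for x
    proof (cases "\<bar>f n x\<bar> \<le> R")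
      case True then show ?thesis using R by simp
    next
      case False
      then have "\<bar>f n x\<bar> * R \<le> \<bar>f n x\<bar> * \<bar>f n x\<bar>" by (intro mult_left_mono) auto
      then have "\<bar>f n x\<bar> \<le> (f n x)^2 / R" using R by (simp add: field_simps power2_eq_square)
      then show ?thesis using R by (simp add: min_def)
    qed
    have ir: "integrable M (\<lambda>x. min \<bar>f n x\<bar> R + (f n x)^2 / R)" using im i by auto
    have "(\<integral>x. \<bar>f n x\<bar> \<partial>M) \<le> (\<integral>x. min \<bar>f n x\<bar> R + (f n x)^2 / R \<partial>M)"
    proof (rule integral_mono[OF _ ir le])
      show "integrable M (\<lambda>x. \<bar>f n x\<bar>)"
        by (rule Bochner_Integration.integrable_bound[OF ir]) (use le R in \<open>auto intro: order_trans[OF _ abs_ge_self]\<close>)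
    qed
    also have "\<dots> = (\<integral>x. min \<bar>f n x\<bar> R \<partial>M) + (\<integral>x. (f n x)^2 \<partial>M) / R"
      using im i by simp
    also have "(\<integral>x. (f n x)^2 \<partial>M) / R \<le> C / R" using C R by (simp add: divide_right_mono)
    also have "C / R < e / 2" using C0 e by (simp add: R_def field_simps add_strict_increasing)
    finally have "(\<integral>x. \<bar>f n x\<bar> \<partial>M) < (\<integral>x. min \<bar>f n x\<bar> R \<partial>M) + e / 2" by simp
    moreover have "(\<integral>x. min \<bar>f n x\<bar> R \<partial>M) < e / 2" using m[OF that] by simp
    ultimately show ?thesis by simp
  qed
  then show "\<exists>m. \<forall>n\<ge>m. norm ((\<integral>x. \<bar>f n x\<bar> \<partial>M) - 0) < e" by blast
qed

text \<open>The kernel is of size k, but on its support 1 - x \<le> 2 / k, so the Lipschitz bound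
  for q at the endpoint compensates it.\<close>

lemma kern_lipschitz:
  assumes q: "smooth1 q"
  obtains C where "C \<ge> 0" "\<And>k x. k \<ge> 4 \<Longrightarrow> \<bar>kern k x * (q x - q 1)\<bar> \<le> C * indicator (strip k) x"
proof -
  have "compact (deriv q ` {0..1})" "compact (deriv step ` {1..2})"
    by (intro compact_continuous_image smooth1_continuous_on smooth1_deriv q smooth1_step compact_Icc)+
  then obtain L B where "\<forall>y\<in>deriv q ` {0..1}. norm y \<le> L" "\<forall>y\<in>deriv step ` {1..2}. norm y \<le> B"
    using compact_imp_bounded bounded_iff by metis
  then have L: "\<And>x. x \<in> {0..1} \<Longrightarrow> \<bar>deriv q x\<bar> \<le> L" and B: "\<And>z. z \<in> {1..2} \<Longrightarrow> \<bar>deriv step z\<bar> \<le> B"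
    by auto
  have L0: "L \<ge> 0" by (rule order_trans[OF abs_ge_zero L[of 0]]) simp
  have B0: "B \<ge> 0" by (rule order_trans[OF abs_ge_zero B[of 1]]) simp
  have lip: "\<bar>q x - q 1\<bar> \<le> L * (1 - x)" if x: "x \<in> {0..<1}" for x
  proof -
    obtain z where z: "x < z" "z < 1" "q 1 - q x = (1 - x) * deriv q z"
      using MVT2[of x 1 q "deriv q"] smooth1_DERIV[OF q] x by (meson atLeastLessThan_iff)
    have "\<bar>q 1 - q x\<bar> = (1 - x) * \<bar>deriv q z\<bar>" using z that by (simp add: abs_mult)
    also have "\<dots> \<le> (1 - x) * L" using L[of z] z that by (intro mult_left_mono) auto
    finally show ?thesis by (simp add: abs_minus_commute mult.commute)
  qed
  have "\<bar>kern k x * (q x - q 1)\<bar> \<le> (2 * B * L) * indicator (strip k) x" if k: "k \<ge> 4" for k x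
  proof (cases "k * (1 - x) \<in> {1..2}")
    case True
    then have s: "x \<in> strip k" using k mem_strip[of k x] by auto
    have x: "x \<in> {0..<1}" using strip_bounds[OF k s] by auto
    have "\<bar>kern k x\<bar> \<le> k * B" using B[OF True] k by (simp add: kern_def abs_mult)
    then have "\<bar>kern k x * (q x - q 1)\<bar> \<le> (k * B) * (L * (1 - x))"
      unfolding abs_mult using lip[OF x] k B0 by (intro mult_mono) auto
    also have "\<dots> = B * L * (k * (1 - x))" by simp
    also have "\<dots> \<le> B * L * 2" using True B0 L0 by (intro mult_left_mono) auto
    finally show ?thesis using s by simp
  next
    case False
    then show ?thesis using B0 L0 by (simp add: kern_eq_0)
  qed
  then show ?thesis using that[of "2 * B * L"] B0 L0 by simp
qed

text \<open>For the cut-off \<open>\<theta> = step (k (1 - x))\<close> this is \<open>2 \<theta>' q' + \<theta>'' q\<close>, so \<open>(\<theta> q)'' = \<theta> q'' + cutoff_rem k q\<close>.\<close>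
definition cutoff_rem :: "real \<Rightarrow> (real \<Rightarrow> real) \<Rightarrow> real \<Rightarrow> real" where
  "cutoff_rem k q x = - 2 * kern k x * deriv q x - deriv (kern k) x * q x"

lemma smooth1_cutoff_rem: "smooth1 q \<Longrightarrow> smooth1 (cutoff_rem k q)"
  unfolding cutoff_rem_def[abs_def]
  by (intro smooth1_diff smooth1_mult smooth1_const smooth1_kern smooth1_deriv)

text \<open>The derivative of \<open>kern k\<close> is of order k^2 and cannot be estimated
  directly. It is hidden in the derivative of g = \<open>kern k\<close> q, which is bounded on the
  strip because q vanishes at 1, so the energy controls the pairing with it. What is left is a
  boundary average and a bounded function on a set of measure at most 4 / k.\<close>

lemma cutoff_rem_bound:
  assumes q: "smooth1 q" and q1: "q 1 = 0"
  obtains C where "C \<ge> 0" "\<And>v D k. L2 v \<Longrightarrow> energy_density v D \<Longrightarrow> k \<ge> 4 \<Longrightarrow>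
    (ip v (cutoff_rem k q))^2 \<le> C * (mass D k + (ip v (kern k))^2 + ip v v / k)"
proof -
  obtain A where A: "A \<ge> 0" "\<And>k x. k \<ge> 4 \<Longrightarrow> \<bar>kern k x * (q x - q 1)\<bar> \<le> A * indicator (strip k) x"
    using kern_lipschitz[OF q] by blast
  obtain B where B: "B \<ge> 0" "\<And>k x. k \<ge> 4 \<Longrightarrow> \<bar>kern k x * (deriv q x - deriv q 1)\<bar> \<le> B * indicator (strip k) x"
    using kern_lipschitz[OF smooth1_deriv[OF q]] by blast
  define c where "c = deriv q 1"
  define C where "C = 3 * (8 * A^2) + 3 * c^2 + 3 * (4 * B^2)"
  show ?thesis
  proof
    show "C \<ge> 0" by (simp add: C_def)
    fix v D k assume v: "L2 v" and e: "energy_density v D" and k: "k \<ge> (4::real)"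
    define g where "g x = kern k x * q x" for x
    define s where "s x = kern k x * (deriv q x - c)" for x
    have g: "smooth1 g" unfolding g_def by (intro smooth1_mult smooth1_kern q)
    have s: "smooth1 s" unfolding s_def by (intro smooth1_mult smooth1_diff smooth1_const smooth1_kern smooth1_deriv q)
    have "(g has_real_derivative deriv (kern k) x * q x + deriv q x * kern k x) (at x)" for x
      unfolding g_def by (intro DERIV_mult smooth1_DERIV smooth1_kern q)
    then have dg: "deriv g x = deriv (kern k) x * q x + deriv q x * kern k x" for x by (rule DERIV_imp_deriv)
    \<comment> \<open>The remainder is -g' - \<open>kern k\<close> q', and q' is split into its
      endpoint value c and q' - c, which vanishes at 1.\<close>
    have "cutoff_rem k q = (\<lambda>x. (- deriv g x - c * kern k x) - s x)"
      by (auto simp: cutoff_rem_def dg s_def algebra_simps)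
    then have split: "ip v (cutoff_rem k q) = - ip v (deriv g) - c * ip v (kern k) - ip v s"
      using v by (simp add: ip_diff_right ip_cmult_right ip_minus_right L2_diff L2_cmult L2_smooth1 smooth1_minus smooth1_deriv g s smooth1_kern)
    have gA: "\<bar>g x\<bar> \<le> A * indicator (strip k) x" for x
      using A(2)[OF k, of x] q1 by (simp add: g_def)
    have 1: "(ip v (deriv g))^2 \<le> 8 * A^2 * mass D k"
    proof (rule energy_density_strip[OF e k g])
      show "g x = 0" if "x \<notin> strip k" for x using gA[of x] that by simp
      show "\<bar>g x\<bar> \<le> A" for x
        using gA[of x] A(1) by (cases "x \<in> strip k") auto
    qed
    have "ip s s \<le> (\<integral>x. B^2 * indicator (strip k) x \<partial>lebesgue_on I)"
      unfolding ip_def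
    proof (rule integral_mono)
      show "integrable (lebesgue_on I) (\<lambda>x. s x * s x)" by (intro L2_mult_integrable L2_smooth1 s)
      show "integrable (lebesgue_on I) (\<lambda>x. B^2 * indicator (strip k) x)"
        by (intro integrable_mult_right integrable_indicator_strip)
      fix x
      have "\<bar>s x\<bar> \<le> B * indicator (strip k) x" using B(2)[OF k, of x] by (simp add: s_def c_def)
      then have "\<bar>s x\<bar> * \<bar>s x\<bar> \<le> (B * indicator (strip k) x) * (B * indicator (strip k) x)"
        by (intro mult_mono) auto
      then show "s x * s x \<le> B^2 * indicator (strip k) x"
        by (cases "x \<in> strip k") (auto simp: power2_eq_square)
    qed
    also have "\<dots> = B^2 * (\<integral>x. indicator (strip k) x \<partial>lebesgue_on I)" by (rule integral_mult_right_zero)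
    also have "\<dots> \<le> B^2 * (4 / k)" by (rule mult_left_mono[OF measure_strip[OF k]]) simp
    finally have "ip v v * ip s s \<le> ip v v * (B^2 * (4 / k))"
      by (intro mult_left_mono ip_self_nonneg)
    then have 2: "(ip v s)^2 \<le> 4 * B^2 * (ip v v / k)"
      using ip_Cauchy_Schwarz[OF v L2_smooth1[OF s]] by (simp add: mult_ac)
    have three: "(- x - y - z)^2 \<le> 3 * x^2 + 3 * y^2 + 3 * z^2" for x y z :: real
    proof -
      have "0 \<le> (x - y)^2 + (y - z)^2 + (x - z)^2" by simp
      then show ?thesis by (simp add: power2_eq_square algebra_simps)
    qed
    have m0: "mass D k \<ge> 0" unfolding mass_def
      using e by (intro Bochner_Integration.integral_nonneg_AE AE_I2) (auto simp: energy_density_def)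
    have "(ip v (cutoff_rem k q))^2 \<le> 3 * (ip v (deriv g))^2 + 3 * (c * ip v (kern k))^2 + 3 * (ip v s)^2"
      unfolding split by (rule three)
    also have "\<dots> \<le> 3 * (8 * A^2 * mass D k) + 3 * c^2 * (ip v (kern k))^2 + 3 * (4 * B^2 * (ip v v / k))"
      using 1 2 by (simp add: power_mult_distrib)
    also have "\<dots> \<le> C * mass D k + C * (ip v (kern k))^2 + C * (ip v v / k)"
      using m0 ip_self_nonneg[of v] k
      by (intro add_mono) (auto simp: C_def algebra_simps intro!: mult_right_mono add_nonneg_nonneg)
    finally show "(ip v (cutoff_rem k q))^2 \<le> C * (mass D k + (ip v (kern k))^2 + ip v v / k)"
      by (simp add: algebra_simps)
  qed
qed

subsection \<open>Uniform bound on boundary averages\<close>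

text \<open>What the boundary analysis needs from a difference of two solutions. Integrability in
  time is asked only of the majorant N, so no joint measurability of the densities D in x and t is
  involved. Every assumption is invariant under x -> -x, so each estimate at the right endpoint also
  yields one at the left.\<close>

locale null_solution =
  fixes lam :: real and W :: "real \<Rightarrow> real \<Rightarrow> real" and N :: "real \<Rightarrow> real"
  assumes lam_pos: "lam > 0"
    and path: "L2_path W"
    and evolution: "\<And>f t. test1 f \<Longrightarrow> t > 0 \<Longrightarrow> ((\<lambda>s. ip (\<lambda>x. W x s) f) has_real_derivative
       lam / 2 * ip (\<lambda>x. W x t) (deriv (deriv (\<lambda>y. (1 - y^2) * f y)))) (at t)"
    and N_integrable: "\<And>a b. 0 < a \<Longrightarrow> set_integrable lborel {a..b} N"
    and density: "AE t in lborel. t > 0 \<longrightarrow> (\<exists>D. energy_density (\<lambda>x. W x t) D \<and> (\<integral>x. D x \<partial>lebesgue_on I) \<le> N t)"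
    and traces: "AE t in lborel. t > 0 \<longrightarrow> has_traces (\<lambda>x. W x t) 0 0"
begin

lemma L2_W: "t > 0 \<Longrightarrow> L2 (\<lambda>x. W x t)"
  by (rule L2_pathD[OF path])

lemma continuous_on_ip_W: "0 < a \<Longrightarrow> smooth1 f \<Longrightarrow> continuous_on {a..b} (\<lambda>t. ip (\<lambda>x. W x t) f)"
  by (rule L2_path_ip_continuous_on[OF path L2_smooth1]) auto

lemma AE_lebesgue_on_Icc:
  assumes "AE t in lborel. t > 0 \<longrightarrow> P t" "0 < (a::real)"
  shows "AE t in lebesgue_on {a..b}. P t"
proof -
  have "AE t in lebesgue. t > 0 \<longrightarrow> P t" using assms(1) by (rule AE_completion)
  then have "AE t in lebesgue. t \<in> {a..b} \<longrightarrow> P t" by eventually_elim (use assms(2) in auto)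
  then show ?thesis by (subst AE_restrict_space_iff) auto
qed

lemma N_integrable_on: "0 < a \<Longrightarrow> integrable (lebesgue_on {a..b}) N"
  using N_integrable[of a b] unfolding set_integrable_def
  by (subst integrable_restrict_space) (auto intro!: integrable_completion[THEN iffD2] simp: mult.commute)

lemma psi_evolution:
  assumes j: "j \<ge> 2" and t: "t > 0"
  shows "((\<lambda>s. ip (\<lambda>x. W x s) (psi (2^j))) has_real_derivative
     lam / 2 * (2^j * (2 * ip (\<lambda>x. W x t) (kern (2^Suc j)) - 3 * ip (\<lambda>x. W x t) (kern (2^j))
       + ip (\<lambda>x. W x t) (kern (2^(j - 1)))))) (at t)"
proof -
  have k: "(2::real)^j \<ge> 4" using power_increasing[OF j, of "2::real"] by simp
  have half: "(2::real)^j / 2 = 2^(j - 1)" using j by (cases j) auto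
  have L: "L2 (\<lambda>x. W x t)" by (rule L2_W[OF t])
  have "deriv (deriv (\<lambda>y. (1 - y^2) * psi (2^j) y)) =
     (\<lambda>x. 2^j * (2 * kern (2^Suc j) x - 3 * kern (2^j) x + kern (2^(j - 1)) x))"
    unfolding weight_psi[OF k] half[symmetric] by (intro ext) (simp add: hat_scaled_deriv2)
  then have "ip (\<lambda>x. W x t) (deriv (deriv (\<lambda>y. (1 - y^2) * psi (2^j) y))) =
     2^j * (2 * ip (\<lambda>x. W x t) (kern (2^Suc j)) - 3 * ip (\<lambda>x. W x t) (kern (2^j))
       + ip (\<lambda>x. W x t) (kern (2^(j - 1))))"
    using L by (simp add: ip_cmult_right ip_add_right ip_diff_right L2_smooth1 smooth1_kern L2_cmult L2_diff)
  then show ?thesis using evolution[OF test1_psi[OF k] t] by simp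
qed

text \<open>Integrating \<open>dyadic_energy\<close> in time over [a, b] makes the sum on its right
  a total derivative, F / lam. The value at a is nonnegative and is dropped, the value at b is at
  most a multiple of the squared L^2 norm, and the energy contributes the integral of N; none of
  these depends on J.\<close>

lemma kern_square_bound:
  assumes a: "0 < a" and ab: "a \<le> b"
  obtains C where "\<And>J. J \<ge> 3 \<Longrightarrow> (\<integral>t. (ip (\<lambda>x. W x t) (kern (2^J)))^2 \<partial>lebesgue_on {a..b}) \<le> C"
proof -
  obtain K where K: "\<And>t. t \<in> {a..b} \<Longrightarrow> L2_norm (\<lambda>x. W x t) \<le> K" "K \<ge> 0"
    using L2_path_bounded[OF path a] by blast
  obtain H where H: "H \<ge> 0" "\<And>z. hat z \<le> H" using hat_bounded by blast
  define NN where "NN = (\<integral>t. N t \<partial>lebesgue_on {a..b})"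
  define Y where "Y = 8 * H * K^2 / lam"
  define A where "A = (\<integral>t. (ip (\<lambda>x. W x t) (kern (2^2)))^2 \<partial>lebesgue_on {a..b})"
  have bound: "(\<integral>t. (ip (\<lambda>x. W x t) (kern (2^Suc J)))^2 \<partial>lebesgue_on {a..b}) \<le> 4 * (Y + A + 272 * NN)"
    if J: "J \<ge> 2" for J
  proof -
    define Q where "Q j t = ip (\<lambda>x. W x t) (psi (2^j))" for j t
    define P where "P j t = 2 * ip (\<lambda>x. W x t) (kern (2^Suc j)) - 3 * ip (\<lambda>x. W x t) (kern (2^j))
       + ip (\<lambda>x. W x t) (kern (2^(j - 1)))" for j t
    \<comment> \<open>The weights compensate the factor 2^j in \<open>psi_evolution\<close> and the
      normalisation of Q, so that F' is exactly lam times the sum in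
      \<open>dyadic_energy\<close>.\<close>
    define F where "F t = (\<Sum>j=2..J. (Q j t)^2 / (2^j * psi_mass (2^j)))" for t
    define f where "f t = (\<Sum>j=2..J. Q j t / psi_mass (2^j) * P j t)" for t
    have k: "(2::real)^j \<ge> 4" if "j \<ge> 2" for j
      using power_increasing[OF that, of "2::real"] by simp
    have FD: "(F has_real_derivative lam * f t) (at t)" if "t > 0" for t
    proof -
      have "((\<lambda>t. (Q j t)^2 / (2^j * psi_mass (2^j))) has_real_derivative lam * (Q j t / psi_mass (2^j) * P j t)) (at t)"
        if "j \<in> {2..J}" for j
      proof -
        have j: "j \<ge> 2" using that by simp
        have "(Q j has_real_derivative lam / 2 * (2^j * P j t)) (at t)"
          unfolding Q_def P_def by (rule psi_evolution[OF j \<open>t > 0\<close>])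
        from DERIV_cdivide[OF DERIV_power[OF this, of 2], of "2^j * psi_mass (2^j)"]
        show ?thesis by (rule DERIV_cong) (use psi_mass_pos[OF k[OF j]] in \<open>simp add: field_simps\<close>)
      qed
      then show ?thesis unfolding F_def f_def sum_distrib_left by (intro DERIV_sum)
    qed
    have cf: "continuous_on {a..b} f"
      unfolding f_def Q_def P_def divide_inverse
      by (intro continuous_intros continuous_on_ip_W a smooth1_kern smooth1_psi k) auto
    have "((\<lambda>t. lam * f t) has_integral (F b - F a)) {a..b}"
      by (rule fundamental_theorem_of_calculus[OF ab])
         (use a in \<open>auto simp: has_real_derivative_iff_has_vector_derivative[symmetric]
             intro!: has_field_derivative_at_within FD\<close>)
    then have "((\<lambda>t. lam * f t / lam) has_integral ((F b - F a) / lam)) {a..b}"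
      by (rule has_integral_divide)
    then have "integral {a..b} f = (F b - F a) / lam" using lam_pos by (simp add: integral_unique)
    then have fint: "(\<integral>t. f t \<partial>lebesgue_on {a..b}) = (F b - F a) / lam"
      using lebesgue_integral_eq_integral[OF continuous_imp_integrable_real[OF cf]] by simp
    have "F a \<ge> 0" unfolding F_def using psi_mass_pos k
      by (intro sum_nonneg divide_nonneg_nonneg) (auto simp: less_imp_le)
    have "F b \<le> 8 * H * K^2"
    proof -
      have b: "b > 0" "b \<in> {a..b}" using a ab by auto
      have "F b \<le> (\<Sum>j=2..J. 2 * H * mass (\<lambda>x. (W x b)^2) (2^j))"
        unfolding F_def Q_def using H k by (intro sum_mono psi_square_le L2_W b) auto
      also have "\<dots> = 2 * H * (\<Sum>j=2..J. mass (\<lambda>x. (W x b)^2) (2^j))" by (simp add: sum_distrib_left)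
      also have "\<dots> \<le> 2 * H * (4 * (\<integral>x. (W x b)^2 \<partial>lebesgue_on I))"
        using H L2_square_integrable[OF L2_W[OF b(1)]] by (intro mult_left_mono sum_strip_le) auto
      also have "(\<integral>x. (W x b)^2 \<partial>lebesgue_on I) = (L2_norm (\<lambda>x. W x b))^2" by (simp add: L2_norm_def)
      also have "2 * H * (4 * (L2_norm (\<lambda>x. W x b))^2) \<le> 2 * H * (4 * K^2)"
        using H K(1)[OF b(2)] L2_norm_nonneg by (intro mult_left_mono power_mono) auto
      finally show ?thesis by simp
    qed
    have iw: "integrable (lebesgue_on {a..b}) (\<lambda>t. (ip (\<lambda>x. W x t) (kern c))^2)" for c
      by (intro continuous_imp_integrable_real continuous_intros continuous_on_ip_W a smooth1_kern)
    have "AE t in lebesgue_on {a..b}. (ip (\<lambda>x. W x t) (kern (2^Suc J)))^2 / 4 \<le> f t + (ip (\<lambda>x. W x t) (kern (2^2)))^2 + 272 * N t"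
    proof -
      have "AE t in lborel. t > 0 \<longrightarrow> (ip (\<lambda>x. W x t) (kern (2^Suc J)))^2 / 4 \<le> f t + (ip (\<lambda>x. W x t) (kern (2^2)))^2 + 272 * N t"
        using density
      proof eventually_elim
        case (elim t)
        show ?case
        proof
          assume t: "t > 0"
          then obtain D where D: "energy_density (\<lambda>x. W x t) D" "(\<integral>x. D x \<partial>lebesgue_on I) \<le> N t"
            using elim by blast
          show "(ip (\<lambda>x. W x t) (kern (2^Suc J)))^2 / 4 \<le> f t + (ip (\<lambda>x. W x t) (kern (2^2)))^2 + 272 * N t"
            using dyadic_energy[OF L2_W[OF t] D(1) J] D(2) unfolding f_def Q_def P_def by linarith
        qed
      qed
      then show ?thesis by (rule AE_lebesgue_on_Icc[OF _ a])
    qed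
    then have "(\<integral>t. (ip (\<lambda>x. W x t) (kern (2^Suc J)))^2 / 4 \<partial>lebesgue_on {a..b}) \<le>
       (\<integral>t. f t + (ip (\<lambda>x. W x t) (kern (2^2)))^2 + 272 * N t \<partial>lebesgue_on {a..b})"
      using iw N_integrable_on[OF a] continuous_imp_integrable_real[OF cf] by (intro integral_mono_AE) auto
    also have "\<dots> = (F b - F a) / lam + A + 272 * NN"
      using iw N_integrable_on[OF a] continuous_imp_integrable_real[OF cf] by (simp add: fint A_def NN_def)
    finally have "(\<integral>t. (ip (\<lambda>x. W x t) (kern (2^Suc J)))^2 \<partial>lebesgue_on {a..b}) / 4 \<le> (F b - F a) / lam + A + 272 * NN"
      by simp
    moreover have "(F b - F a) / lam \<le> Y" unfolding Y_def
      using \<open>F a \<ge> 0\<close> \<open>F b \<le> 8 * H * K^2\<close> lam_pos by (intro divide_right_mono) auto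
    ultimately have "(\<integral>t. (ip (\<lambda>x. W x t) (kern (2^Suc J)))^2 \<partial>lebesgue_on {a..b}) / 4 \<le> Y + A + 272 * NN"
      by (meson add_right_mono order_trans)
    then show ?thesis by simp
  qed
  show ?thesis
  proof
    fix J :: nat assume "J \<ge> 3"
    then show "(\<integral>t. (ip (\<lambda>x. W x t) (kern (2^J)))^2 \<partial>lebesgue_on {a..b}) \<le> 4 * (Y + A + 272 * NN)"
      using bound[of "J - 1"] by (cases J) auto
  qed
qed

text \<open>At almost every time all three terms in \<open>cutoff_rem_bound\<close> tend to 0, the
  average because of the trace. Their time integrals are bounded by
  \<open>kern_square_bound\<close>, so the square-integral criterion gives convergence in L^1 in
  time.\<close>

lemma cutoff_rem_tendsto:
  assumes a: "0 < a" and ab: "a \<le> b" and q: "smooth1 q" and q1: "q 1 = 0"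
  shows "(\<lambda>j. \<integral>t. \<bar>ip (\<lambda>x. W x t) (cutoff_rem (2^j) q)\<bar> \<partial>lebesgue_on {a..b}) \<longlonglongrightarrow> 0"
proof -
  obtain C where C: "C \<ge> 0" "\<And>v D k. L2 v \<Longrightarrow> energy_density v D \<Longrightarrow> k \<ge> 4 \<Longrightarrow>
    (ip v (cutoff_rem k q))^2 \<le> C * (mass D k + (ip v (kern k))^2 + ip v v / k)"
    using cutoff_rem_bound[OF q q1] by blast
  obtain B where B: "\<And>J. J \<ge> 3 \<Longrightarrow> (\<integral>t. (ip (\<lambda>x. W x t) (kern (2^J)))^2 \<partial>lebesgue_on {a..b}) \<le> B"
    using kern_square_bound[OF a ab] by blast
  obtain K where K: "\<And>t. t \<in> {a..b} \<Longrightarrow> L2_norm (\<lambda>x. W x t) \<le> K" "K \<ge> 0"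
    using L2_path_bounded[OF path a] by blast
  \<comment> \<open>The shift by 3 starts at the first index covered by
    \<open>kern_square_bound\<close>; it also guarantees scales of at least 4.\<close>
  define r where "r n t = ip (\<lambda>x. W x t) (cutoff_rem (2^(n + 3)) q)" for n t
  have k4: "(2::real)^(n + 3) \<ge> 4" for n
    using power_increasing[of 2 "n + 3" "2::real"] by simp
  have cr: "continuous_on {a..b} (r n)" for n
    unfolding r_def by (rule continuous_on_ip_W[OF a smooth1_cutoff_rem[OF q]])
  have "(\<lambda>n. \<integral>t. \<bar>r n t\<bar> \<partial>lebesgue_on {a..b}) \<longlonglongrightarrow> 0"
  proof (rule tendsto_L1_of_L2_bounded)
    show "finite_measure (lebesgue_on {a..b})" by (rule finite_measure_lebesgue_on) simp
    show "r n \<in> borel_measurable (lebesgue_on {a..b})" for n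
      by (rule continuous_imp_measurable_on_sets_lebesgue[OF cr]) simp
    show i2: "integrable (lebesgue_on {a..b}) (\<lambda>t. (r n t)^2)" for n
      by (intro continuous_imp_integrable_real continuous_intros cr)
    have "AE t in lborel. t > 0 \<longrightarrow> (\<lambda>n. r n t) \<longlonglongrightarrow> 0"
      using density traces
    proof eventually_elim
      case (elim t)
      show ?case
      proof
        assume t: "t > 0"
        obtain D where D: "energy_density (\<lambda>x. W x t) D" using elim t by blast
        obtain u where u: "continuous_on I u" "AE x in lebesgue_on I. u x = W x t" "(u \<longlongrightarrow> 0) (at_left 1)"
          using elim t unfolding has_traces_def by blast
        have i: "integrable (lebesgue_on I) D" using D by (simp add: energy_density_def)
        have "(\<lambda>n. C * (mass D (2^(n + 3)) + (ip (\<lambda>x. W x t) (kern (2^(n + 3))))^2 + ip (\<lambda>x. W x t) (\<lambda>x. W x t) / 2^(n + 3)))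
           \<longlonglongrightarrow> C * (0 + 0^2 + 0)"
        proof (intro tendsto_intros)
          show "(\<lambda>n. mass D (2^(n + 3))) \<longlonglongrightarrow> 0"
            by (rule LIMSEQ_ignore_initial_segment[OF mass_tendsto_0[OF i]])
          show "(\<lambda>n. ip (\<lambda>x. W x t) (kern (2^(n + 3)))) \<longlonglongrightarrow> 0"
            by (rule LIMSEQ_ignore_initial_segment[OF kern_trace_tendsto[OF u(1,2) L2_W[OF t] u(3)]])
          have "(\<lambda>n. ip (\<lambda>x. W x t) (\<lambda>x. W x t) / 2^n) \<longlonglongrightarrow> 0"
            by (rule LIMSEQ_divide_realpow_zero) simp
          from LIMSEQ_ignore_initial_segment[OF this, of 3]
          show "(\<lambda>n. ip (\<lambda>x. W x t) (\<lambda>x. W x t) / 2^(n + 3)) \<longlonglongrightarrow> 0" .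
        qed
        then have up: "(\<lambda>n. C * (mass D (2^(n + 3)) + (ip (\<lambda>x. W x t) (kern (2^(n + 3))))^2 + ip (\<lambda>x. W x t) (\<lambda>x. W x t) / 2^(n + 3))) \<longlonglongrightarrow> 0"
          by simp
        have "(\<lambda>n. (r n t)^2) \<longlonglongrightarrow> 0"
          by (rule tendsto_sandwich[OF _ _ tendsto_const up])
             (auto simp: r_def intro!: always_eventually C(2)[OF L2_W[OF t] D k4])
        then show "(\<lambda>n. r n t) \<longlonglongrightarrow> 0"
          by (rule power_tendsto_0_iff[THEN iffD1, rotated]) simp
      qed
    qed
    then show "AE t in lebesgue_on {a..b}. (\<lambda>n. r n t) \<longlonglongrightarrow> 0"
      by (rule AE_lebesgue_on_Icc[OF _ a])
    fix n
    have iw: "integrable (lebesgue_on {a..b}) (\<lambda>t. (ip (\<lambda>x. W x t) (kern c))^2)" for c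
      by (intro continuous_imp_integrable_real continuous_intros continuous_on_ip_W a smooth1_kern)
    have "AE t in lborel. t > 0 \<longrightarrow> (t \<in> {a..b} \<longrightarrow> (r n t)^2 \<le> C * (N t + (ip (\<lambda>x. W x t) (kern (2^(n + 3))))^2 + K^2))"
      using density
    proof eventually_elim
      case (elim t)
      show ?case
      proof (intro impI)
        assume t: "t > 0" and tab: "t \<in> {a..b}"
        obtain D where D: "energy_density (\<lambda>x. W x t) D" "(\<integral>x. D x \<partial>lebesgue_on I) \<le> N t" using elim t by blast
        have i: "integrable (lebesgue_on I) D" and D0: "\<And>x. x \<in> I \<Longrightarrow> D x \<ge> 0"
          using D by (auto simp: energy_density_def)
        have "mass D (2^(n + 3)) \<le> (\<integral>x. D x \<partial>lebesgue_on I)"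
          unfolding mass_def strip_def using i D0
          by (intro integral_mono integrable_indicator_mult) (auto simp: indicator_def)
        then have 1: "mass D (2^(n + 3)) \<le> N t" using D(2) by linarith
        have "ip (\<lambda>x. W x t) (\<lambda>x. W x t) = (L2_norm (\<lambda>x. W x t))^2"
          by (simp add: L2_norm_eq ip_self_nonneg)
        also have "\<dots> \<le> K^2" using K(1)[OF tab] L2_norm_nonneg by (intro power_mono) auto
        finally have "ip (\<lambda>x. W x t) (\<lambda>x. W x t) / 2^(n + 3) \<le> K^2 / 1"
          by (intro frac_le) auto
        then have "C * (mass D (2^(n + 3)) + (ip (\<lambda>x. W x t) (kern (2^(n + 3))))^2 + ip (\<lambda>x. W x t) (\<lambda>x. W x t) / 2^(n + 3))
          \<le> C * (N t + (ip (\<lambda>x. W x t) (kern (2^(n + 3))))^2 + K^2)"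
          using 1 C(1) by (intro mult_left_mono add_mono) auto
        then show "(r n t)^2 \<le> C * (N t + (ip (\<lambda>x. W x t) (kern (2^(n + 3))))^2 + K^2)"
          using C(2)[OF L2_W[OF t] D(1) k4, of n] unfolding r_def by linarith
      qed
    qed
    from AE_lebesgue_on_Icc[OF this a]
    have "AE t in lebesgue_on {a..b}. (r n t)^2 \<le> C * (N t + (ip (\<lambda>x. W x t) (kern (2^(n + 3))))^2 + K^2)"
      by (rule AE_mp) (auto intro: AE_I2)
    then have "(\<integral>t. (r n t)^2 \<partial>lebesgue_on {a..b}) \<le> (\<integral>t. C * (N t + (ip (\<lambda>x. W x t) (kern (2^(n + 3))))^2 + K^2) \<partial>lebesgue_on {a..b})"
      using i2 iw N_integrable_on[OF a]
      by (intro integral_mono_AE) (auto intro!: continuous_imp_integrable_real)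
    also have "\<dots> = C * ((\<integral>t. N t \<partial>lebesgue_on {a..b}) + (\<integral>t. (ip (\<lambda>x. W x t) (kern (2^(n + 3))))^2 \<partial>lebesgue_on {a..b}) + (\<integral>t. K^2 \<partial>lebesgue_on {a..b}))"
      using iw N_integrable_on[OF a] continuous_imp_integrable_real[OF continuous_on_const, of a b "K^2"] by simp
    also have "\<dots> \<le> C * ((\<integral>t. N t \<partial>lebesgue_on {a..b}) + B + (\<integral>t. K^2 \<partial>lebesgue_on {a..b}))"
      using B[of "n + 3"] C(1) by (intro mult_left_mono add_mono) auto
    finally show "(\<integral>t. (r n t)^2 \<partial>lebesgue_on {a..b}) \<le> C * ((\<integral>t. N t \<partial>lebesgue_on {a..b}) + B + (\<integral>t. K^2 \<partial>lebesgue_on {a..b}))" .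
  qed
  then show ?thesis unfolding r_def by (rule LIMSEQ_offset)
qed

end

subsection \<open>Reflection and two-sided cut-offs\<close>

lemma uminus_measurable_I: "uminus \<in> measurable (lebesgue_on I) (lebesgue_on I)"
proof -
  have "(uminus :: real \<Rightarrow> real) \<in> measurable lebesgue lebesgue"
    using lebesgue_affine_measurable[where c = "\<lambda>x::real. -1" and t = 0] by simp
  then show ?thesis
    by (intro measurable_restrict_space2 measurable_restrict_space1) (auto simp: I_def)
qed

lemma distr_uminus_I: "distr (lebesgue_on I) (lebesgue_on I) uminus = lebesgue_on I"
proof (rule measure_eqI)
  fix A assume "A \<in> sets (distr (lebesgue_on I) (lebesgue_on I) uminus)"
  then have A: "A \<in> sets (lebesgue_on I)" by simp
  then have AI: "A \<subseteq> I" and Al: "A \<in> sets lebesgue" by (auto simp: sets_restrict_space_iff)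
  have m: "(uminus :: real \<Rightarrow> real) \<in> measurable lebesgue lebesgue"
    using lebesgue_affine_measurable[where c = "\<lambda>x::real. -1" and t = 0] by simp
  have "(lebesgue :: real measure) = density (distr lebesgue lebesgue uminus) (\<lambda>_. 1)"
    using lebesgue_real_affine[of "-1" 0] by simp
  then have l: "distr lebesgue lebesgue (uminus :: real \<Rightarrow> real) = lebesgue"
    by (simp add: density_1)
  have v: "uminus -` A \<subseteq> I" using AI by (auto simp: I_def)
  have "emeasure (distr (lebesgue_on I) (lebesgue_on I) uminus) A = emeasure (lebesgue_on I) (uminus -` A)"
    using v A by (subst emeasure_distr[OF uminus_measurable_I]) (auto simp: Int_absorb2)
  also have "\<dots> = emeasure lebesgue (uminus -` A)"
    using v by (simp add: emeasure_restrict_space)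
  also have "\<dots> = emeasure (distr lebesgue lebesgue uminus) A"
    using Al by (subst emeasure_distr[OF m]) auto
  also have "\<dots> = emeasure (lebesgue_on I) A"
    unfolding l using AI by (simp add: emeasure_restrict_space)
  finally show "emeasure (distr (lebesgue_on I) (lebesgue_on I) uminus) A = emeasure (lebesgue_on I) A" .
qed simp

lemma measurable_reflect_I:
  "f \<in> borel_measurable (lebesgue_on I) \<Longrightarrow> (\<lambda>x. f (- x)) \<in> borel_measurable (lebesgue_on I)" for f :: "real \<Rightarrow> real"
  by (rule measurable_compose[OF uminus_measurable_I])

lemma integral_reflect_I:
  fixes f :: "real \<Rightarrow> real"
  assumes "f \<in> borel_measurable (lebesgue_on I)"
  shows "(\<integral>x. f (- x) \<partial>lebesgue_on I) = (\<integral>x. f x \<partial>lebesgue_on I)"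
  using integral_distr[OF uminus_measurable_I assms] by (simp add: distr_uminus_I)

lemma integrable_reflect_I:
  fixes f :: "real \<Rightarrow> real"
  assumes "integrable (lebesgue_on I) f"
  shows "integrable (lebesgue_on I) (\<lambda>x. f (- x))"
  using assms integrable_distr_eq[OF uminus_measurable_I, of f] by (simp add: distr_uminus_I)

lemma AE_reflect_I: "AE x in lebesgue_on I. P x \<Longrightarrow> AE x in lebesgue_on I. P (- x)"
  using AE_distrD[OF uminus_measurable_I, of P] unfolding distr_uminus_I by blast

lemma L2_reflect: "L2 v \<Longrightarrow> L2 (\<lambda>x. v (- x))"
  unfolding L2_def using integrable_reflect_I[of "\<lambda>x. (v x)^2"] measurable_reflect_I by simp

lemma L2_norm_reflect: "L2 v \<Longrightarrow> L2_norm (\<lambda>x. v (- x)) = L2_norm v"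
  unfolding L2_norm_def
  using integral_reflect_I[OF borel_measurable_integrable[OF L2_square_integrable[of v]]] by simp

lemma ip_reflect:
  assumes "L2 v" "L2 f" shows "ip (\<lambda>x. v (- x)) f = ip v (\<lambda>x. f (- x))"
proof -
  have "(\<lambda>x. v x * f (- x)) \<in> borel_measurable (lebesgue_on I)"
    using L2_mult_integrable[OF assms(1) L2_reflect[OF assms(2)]] by auto
  from integral_reflect_I[OF this] show ?thesis by (simp add: ip_def)
qed

lemma smooth1_reflect: "smooth1 f \<Longrightarrow> smooth1 (\<lambda>x. f (- x))"
  using smooth1_affine[of f "-1" 0] by simp

lemma deriv_reflect: "smooth1 f \<Longrightarrow> deriv (\<lambda>x. f (- x)) = (\<lambda>x. - deriv f (- x))"
proof (intro ext DERIV_imp_deriv)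
  fix x assume f: "smooth1 f"
  show "((\<lambda>x. f (- x)) has_real_derivative - deriv f (- x)) (at x)"
    by (rule DERIV_cong[OF DERIV_chain2[OF smooth1_DERIV[OF f]]]) (auto intro!: derivative_eq_intros)
qed

lemma deriv2_reflect: "smooth1 f \<Longrightarrow> deriv (deriv (\<lambda>x. f (- x))) = (\<lambda>x. deriv (deriv f) (- x))"
proof -
  assume f: "smooth1 f"
  have "((\<lambda>x. - deriv f (- x)) has_real_derivative deriv (deriv f) (- x)) (at x)" for x
    by (rule DERIV_cong[OF DERIV_minus[OF DERIV_chain2[OF smooth1_DERIV[OF smooth1_deriv[OF f]]]]])
       (auto intro!: derivative_eq_intros)
  then have "deriv (\<lambda>x. - deriv f (- x)) = (\<lambda>x. deriv (deriv f) (- x))"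
    by (intro ext DERIV_imp_deriv)
  then show ?thesis by (simp add: deriv_reflect[OF f])
qed

text \<open>Reflection turns \<open>{a..b}\<close> into \<open>{- b..- a}\<close> and changes the
  sign of the derivative, which squaring removes; the weight 1 - x^2 is even.\<close>

lemma energy_density_reflect:
  assumes v: "L2 v" and e: "energy_density v D"
  shows "energy_density (\<lambda>x. v (- x)) (\<lambda>x. D (- x))"
  unfolding energy_density_def
proof (intro conjI allI impI ballI)
  have i: "integrable (lebesgue_on I) D" using e by (simp add: energy_density_def)
  show "integrable (lebesgue_on I) (\<lambda>x. D (- x))" by (rule integrable_reflect_I[OF i])
  show "D (- x) \<ge> 0" if "x \<in> I" for x using e that by (auto simp: energy_density_def I_def)
  fix g :: "real \<Rightarrow> real" and a b :: real
  assume g: "smooth1 g" and ab: "-1 < a" "b < 1" and supp: "\<forall>x. x \<notin> {a..b} \<longrightarrow> g x = 0"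
  define h where "h x = g (- x)" for x
  have h: "smooth1 h" unfolding h_def by (rule smooth1_reflect[OF g])
  have "(ip v (deriv h))^2 \<le> (\<integral>x. (h x)^2 / (1 - x^2) \<partial>lebesgue_on I) *
          (\<integral>x. indicator {- b..- a} x * D x \<partial>lebesgue_on I)"
    by (rule e[unfolded energy_density_def, THEN conjunct2, THEN conjunct2, rule_format, OF h])
       (use ab supp in \<open>auto simp: h_def\<close>)
  moreover have "ip v (deriv h) = - ip (\<lambda>x. v (- x)) (deriv g)"
    using ip_reflect[OF v L2_smooth1[OF smooth1_deriv[OF g]]] deriv_reflect[OF g]
    by (simp add: h_def[abs_def] ip_minus_right)
  moreover have "(\<integral>x. (h x)^2 / (1 - x^2) \<partial>lebesgue_on I) = (\<integral>x. (g x)^2 / (1 - x^2) \<partial>lebesgue_on I)"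
  proof -
    have "smooth1 (\<lambda>x. (g x)^2 / (1 - x^2))"
      using supp by (intro smooth1_divide_weight[OF smooth1_power[OF g] ab]) auto
    from integral_reflect_I[OF borel_measurable_integrable[OF integrable_smooth1_I[OF this]]]
    show ?thesis by (simp add: h_def)
  qed
  moreover have "(\<integral>x. indicator {- b..- a} x * D x \<partial>lebesgue_on I) = (\<integral>x. indicator {a..b} x * D (- x) \<partial>lebesgue_on I)"
  proof -
    have "(\<lambda>x. indicator {- b..- a} (- x) * D (- x)) = (\<lambda>x. indicator {a..b} x * D (- x))"
      by (auto simp: indicator_def)
    then show ?thesis
      using integral_reflect_I[OF borel_measurable_integrable[OF integrable_indicator_mult[OF i, of "- b" "- a"]]]
      by simp
  qed
  ultimately show "(ip (\<lambda>x. v (- x)) (deriv g))^2 \<le> (\<integral>x. (g x)^2 / (1 - x^2) \<partial>lebesgue_on I) *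
          (\<integral>x. indicator {a..b} x * D (- x) \<partial>lebesgue_on I)" by simp
qed

lemma has_traces_reflect:
  assumes "has_traces v a b" shows "has_traces (\<lambda>x. v (- x)) b a"
proof -
  obtain u where u: "continuous_on I u" "AE x in lebesgue_on I. u x = v x"
    "(u \<longlongrightarrow> a) (at_left 1)" "(u \<longlongrightarrow> b) (at_right (-1))"
    using assms unfolding has_traces_def by blast
  have "continuous_on I (\<lambda>x. u (- x))"
    by (rule continuous_on_compose2[OF u(1)]) (auto simp: I_def intro!: continuous_intros)
  moreover have "((\<lambda>x. u (- x)) \<longlongrightarrow> b) (at_left 1)"
    using u(4) filterlim_at_left_to_right[of "\<lambda>x. u (- x)" "nhds b" 1] by simp
  moreover have "((\<lambda>x. u (- x)) \<longlongrightarrow> a) (at_right (-1))"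
    using u(3) filterlim_at_left_to_right[of u "nhds a" 1] by simp
  ultimately show ?thesis
    unfolding has_traces_def using AE_reflect_I[OF u(2)] by blast
qed

context null_solution
begin

text \<open>The operator commutes with x -> -x because the weight and the second derivative are
  even. All estimates at the right endpoint thereby become available at the left one.\<close>

lemma null_solution_reflect: "null_solution lam (\<lambda>x. W (- x)) N"
proof
  show "lam > 0" by (rule lam_pos)
  show "L2_path (\<lambda>x. W (- x))"
    unfolding L2_path_def
  proof (intro conjI allI impI)
    fix t :: real assume t: "t > 0"
    show "L2 (\<lambda>x. W (- x) t)" by (rule L2_reflect[OF L2_W[OF t]])
    have "((\<lambda>s. L2_norm (\<lambda>x. W x s - W x t)) \<longlongrightarrow> 0) (at t)"
      using path t by (simp add: L2_path_def)
    then show "((\<lambda>s. L2_norm (\<lambda>x. W (- x) s - W (- x) t)) \<longlongrightarrow> 0) (at t)"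
    proof (rule Lim_transform_eventually)
      have "\<forall>\<^sub>F s in at t. s \<in> {0<..}" using t by (intro eventually_at_in_open') auto
      then show "\<forall>\<^sub>F s in at t. L2_norm (\<lambda>x. W x s - W x t) = L2_norm (\<lambda>x. W (- x) s - W (- x) t)"
      proof eventually_elim
        case (elim s)
        then show ?case using L2_norm_reflect[OF L2_diff[OF L2_W L2_W[OF t]], of s] by simp
      qed
    qed
  qed
  show "AE t in lborel. t > 0 \<longrightarrow> has_traces (\<lambda>x. W (- x) t) 0 0"
    using traces by eventually_elim (auto dest: has_traces_reflect)
  show "AE t in lborel. t > 0 \<longrightarrow> (\<exists>D. energy_density (\<lambda>x. W (- x) t) D \<and> (\<integral>x. D x \<partial>lebesgue_on I) \<le> N t)"
    using density
  proof eventually_elim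
    case (elim t)
    show ?case
    proof
      assume t: "t > 0"
      then obtain D where D: "energy_density (\<lambda>x. W x t) D" "(\<integral>x. D x \<partial>lebesgue_on I) \<le> N t"
        using elim by blast
      have "(\<integral>x. D (- x) \<partial>lebesgue_on I) = (\<integral>x. D x \<partial>lebesgue_on I)"
        using D by (intro integral_reflect_I) (auto simp: energy_density_def)
      then show "\<exists>D. energy_density (\<lambda>x. W (- x) t) D \<and> (\<integral>x. D x \<partial>lebesgue_on I) \<le> N t"
        using energy_density_reflect[OF L2_W[OF t] D(1)] D(2) by (intro exI[of _ "\<lambda>x. D (- x)"]) auto
    qed
  qed
  show "set_integrable lborel {a..b} N" if "0 < a" for a b using N_integrable[OF that] .
  fix f t assume f: "test1 f" and t: "t > (0::real)"
  have sf: "smooth1 f" using f by (rule test1_smooth)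
  have tr: "test1 (\<lambda>x. f (- x))"
  proof -
    obtain a b where "-1 < a" "b < 1" "\<forall>x. f x \<noteq> 0 \<longrightarrow> x \<in> {a..b}" using f unfolding test1_def by blast
    then show ?thesis
      by (intro test1I[where a = "- b" and b = "- a"] smooth1_reflect[OF sf]) force+
  qed
  define h where "h y = (1 - y^2) * f y" for y
  have h: "smooth1 h" unfolding h_def by (intro smooth1_mult smooth1_diff smooth1_power smooth1_const smooth1_ident sf)
  have "(\<lambda>y. (1 - y^2) * f (- y)) = (\<lambda>y. h (- y))" by (auto simp: h_def)
  then have 1: "deriv (deriv (\<lambda>y. (1 - y^2) * f (- y))) = (\<lambda>x. deriv (deriv h) (- x))"
    using deriv2_reflect[OF h] by simp
  have 2: "ip (\<lambda>x. W (- x) t) (deriv (deriv h)) = ip (\<lambda>x. W x t) (\<lambda>x. deriv (deriv h) (- x))"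
    by (intro ip_reflect L2_W[OF t] L2_smooth1 smooth1_deriv h)
  have "((\<lambda>s. ip (\<lambda>x. W x s) (\<lambda>x. f (- x))) has_real_derivative lam / 2 * ip (\<lambda>x. W (- x) t) (deriv (deriv h))) (at t)"
    using evolution[OF tr t] unfolding 1 2 .
  then show "((\<lambda>s. ip (\<lambda>x. W (- x) s) f) has_real_derivative
       lam / 2 * ip (\<lambda>x. W (- x) t) (deriv (deriv (\<lambda>y. (1 - y^2) * f y)))) (at t)"
    unfolding h_def[symmetric]
  proof (rule has_field_derivative_transform_within_open[where S = "{0<..}"])
    fix s :: real assume "s \<in> {0<..}"
    then show "ip (\<lambda>x. W x s) (\<lambda>x. f (- x)) = ip (\<lambda>x. W (- x) s) f"
      using ip_reflect[OF L2_W L2_smooth1[OF sf], of s] by simp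
  qed (use t in auto)
qed

end

section \<open>Cut-offs at both endpoints\<close>

definition cutoff :: "real \<Rightarrow> real \<Rightarrow> real" where
  "cutoff k x = step (k * (1 - x)) * step (k * (1 + x))"

lemma smooth1_cutoff: "smooth1 (cutoff k)"
proof -
  have "smooth1 (\<lambda>x. step (k * (1 - (- x))))"
    by (rule smooth1_reflect) (rule smooth1_scaled[OF smooth1_step])
  then show ?thesis unfolding cutoff_def[abs_def]
    by (intro smooth1_mult smooth1_scaled[OF smooth1_step]) simp
qed

lemma cutoff_bounds: "0 \<le> cutoff k x" "cutoff k x \<le> 1"
  using step_nonneg step_le_1 by (auto simp: cutoff_def intro: mult_le_one)

lemma cutoff_eq_0: assumes "k > 0" "x \<notin> {-1 + 1 / k..1 - 1 / k}" shows "cutoff k x = 0"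
proof -
  have "k * (1 - x) \<le> 1 \<or> k * (1 + x) \<le> 1"
    using assms by (auto simp: field_simps)
  then show ?thesis by (auto simp: cutoff_def step_eq_0)
qed

lemma cutoff_tendsto: assumes "x \<in> I" shows "(\<lambda>j. cutoff (2^j) x) \<longlonglongrightarrow> 1"
proof -
  have x: "1 - x > 0" "1 + x > 0" using assms by (auto simp: I_def)
  obtain m where m: "2 / (1 - x) < 2^m" using real_arch_pow[of 2 "2 / (1 - x)"] by auto
  obtain n where n: "2 / (1 + x) < 2^n" using real_arch_pow[of 2 "2 / (1 + x)"] by auto
  have "cutoff (2^j) x = 1" if "j \<ge> max m n" for j
  proof -
    have "(2::real)^m \<le> 2^j" "(2::real)^n \<le> 2^j" using that by auto
    then have "2 / (1 - x) < 2^j" "2 / (1 + x) < 2^j" using m n by linarith+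
    then have "2^j * (1 - x) \<ge> 2" "2^j * (1 + x) \<ge> 2" using x by (simp_all add: field_simps)
    then show ?thesis by (simp add: cutoff_def step_eq_1)
  qed
  then show ?thesis by (intro tendsto_eventually, unfold eventually_sequentially) blast
qed

lemma deriv2_cong_open:
  fixes f g :: "real \<Rightarrow> real"
  assumes "open S" "x \<in> S" "\<And>y. y \<in> S \<Longrightarrow> f y = g y"
  shows "deriv (deriv f) x = deriv (deriv g) x"
proof -
  have ev: "\<forall>\<^sub>F y in nhds z. y \<in> S" if "z \<in> S" for z
    using assms(1) that by (rule eventually_nhds_in_open)
  have "deriv f z = deriv g z" if "z \<in> S" for z
    using ev[OF that] by (intro deriv_cong_ev) (auto elim!: eventually_mono simp: assms(3))
  then show ?thesis
    using ev[OF assms(2)] by (intro deriv_cong_ev) (auto elim!: eventually_mono)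
qed

lemma step_cutoff_deriv2:
  assumes q: "smooth1 q"
  shows "deriv (deriv (\<lambda>x. step (k * (1 - x)) * q x)) x = step (k * (1 - x)) * deriv (deriv q) x + cutoff_rem k q x"
proof -
  have "((\<lambda>x. step (k * (1 - x)) * q x) has_real_derivative - kern k x * q x + deriv q x * step (k * (1 - x))) (at x)" for x
    by (intro DERIV_mult step_reflected_DERIV smooth1_DERIV q)
  then have 1: "deriv (\<lambda>x. step (k * (1 - x)) * q x) = (\<lambda>x. - kern k x * q x + deriv q x * step (k * (1 - x)))"
    by (intro ext DERIV_imp_deriv)
  show ?thesis unfolding 1
    by (rule DERIV_imp_deriv,
        rule DERIV_cong[OF DERIV_add[OF DERIV_mult[OF DERIV_minus[OF smooth1_DERIV[OF smooth1_kern]] smooth1_DERIV[OF q]]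
           DERIV_mult[OF smooth1_DERIV[OF smooth1_deriv[OF q]] step_reflected_DERIV]]])
       (simp add: cutoff_rem_def algebra_simps)
qed

lemma cutoff_rem_eq_0: "k > 0 \<Longrightarrow> k * (1 - x) > 2 \<Longrightarrow> cutoff_rem k q x = 0"
proof -
  assume k: "k > 0" and x: "k * (1 - x) > 2"
  then have "x < 1 - 2 / k" by (simp add: field_simps)
  then have "deriv (kern k) x = 0"
    by (intro deriv_zero_outside[of "1 - 2 / k" "1 - 1 / k"] kern_eq_0) (use k in \<open>auto simp: field_simps\<close>)
  moreover have "kern k x = 0" using x by (intro kern_eq_0) auto
  ultimately show ?thesis by (simp add: cutoff_rem_def)
qed

text \<open>For k \<ge> 4 the two transition layers are disjoint: on x > -1/2 the left factor is
  constantly 1, on x < 1/2 the right one. Each half-line thus sees a one-sided cut-off, and the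
  second one is treated by reflection.\<close>

lemma cutoff_deriv2:
  assumes q: "smooth1 q" and k: "k \<ge> 4"
  shows "deriv (deriv (\<lambda>x. cutoff k x * q x)) x =
    cutoff k x * deriv (deriv q) x + cutoff_rem k q x + cutoff_rem k (\<lambda>x. q (- x)) (- x)"
proof (cases "x > - 1 / 2")
  case True
  have far: "k * (1 + y) > 2" if "y > - 1 / 2" for y
    using k that mult_less_le_imp_less[of "1/2" "1 + y" 4 k] by (simp add: mult.commute)
  then have c: "cutoff k y = step (k * (1 - y))" if "y > - 1 / 2" for y
    using that by (simp add: cutoff_def step_eq_1 less_imp_le)
  have "deriv (deriv (\<lambda>x. cutoff k x * q x)) x = deriv (deriv (\<lambda>x. step (k * (1 - x)) * q x)) x"
    by (rule deriv2_cong_open[of "{- 1 / 2<..}"]) (use True c in auto)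
  moreover have "cutoff_rem k (\<lambda>x. q (- x)) (- x) = 0"
    using far[OF True] k by (intro cutoff_rem_eq_0) auto
  ultimately show ?thesis using c[OF True] by (simp add: step_cutoff_deriv2[OF q])
next
  case False
  define p where "p x = q (- x)" for x
  have p: "smooth1 p" unfolding p_def by (rule smooth1_reflect[OF q])
  have far: "k * (1 - y) > 2" if "y < 1 / 2" for y
    using k that mult_less_le_imp_less[of "1/2" "1 - y" 4 k] by (simp add: mult.commute)
  then have c: "cutoff k y = step (k * (1 - (- y)))" if "y < 1 / 2" for y
    using that by (simp add: cutoff_def step_eq_1 less_imp_le)
  define F where "F x = step (k * (1 - x)) * p x" for x
  have F: "smooth1 F" unfolding F_def by (intro smooth1_mult smooth1_scaled smooth1_step p)
  have x: "x < 1 / 2" using False by simp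
  have "deriv (deriv (\<lambda>x. cutoff k x * q x)) x = deriv (deriv (\<lambda>x. F (- x))) x"
    by (rule deriv2_cong_open[of "{..<1 / 2}"]) (use x c in \<open>auto simp: F_def p_def\<close>)
  also have "\<dots> = deriv (deriv F) (- x)" by (simp add: deriv2_reflect[OF F])
  also have "\<dots> = step (k * (1 - (- x))) * deriv (deriv p) (- x) + cutoff_rem k p (- x)"
    unfolding F_def by (rule step_cutoff_deriv2[OF p])
  also have "deriv (deriv p) (- x) = deriv (deriv q) x"
    unfolding p_def by (simp add: deriv2_reflect[OF q])
  finally show ?thesis
    using c[OF x] cutoff_rem_eq_0[of k x q] far[OF x] k by (simp add: p_def[abs_def])
qed

lemma L2_cutoff_mult: "smooth1 g \<Longrightarrow> L2 (\<lambda>x. cutoff k x * g x)"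
  by (intro L2_smooth1 smooth1_mult smooth1_cutoff)

lemma cutoff_ip_tendsto:
  assumes v: "L2 v" and g: "smooth1 g"
  shows "(\<lambda>j. ip v (\<lambda>x. cutoff (2^j) x * g x)) \<longlonglongrightarrow> ip v g"
  unfolding ip_def
proof (rule integral_dominated_convergence[where w = "\<lambda>x. \<bar>v x * g x\<bar>"])
  have i: "integrable (lebesgue_on I) (\<lambda>x. v x * g x)" by (rule L2_mult_integrable[OF v L2_smooth1[OF g]])
  then show "(\<lambda>x. v x * g x) \<in> borel_measurable (lebesgue_on I)" "integrable (lebesgue_on I) (\<lambda>x. \<bar>v x * g x\<bar>)" by auto
  show "(\<lambda>x. v x * (cutoff (2^j) x * g x)) \<in> borel_measurable (lebesgue_on I)" for j
    using L2_mult_integrable[OF v L2_cutoff_mult[OF g]] by auto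
  show "AE x in lebesgue_on I. (\<lambda>j. v x * (cutoff (2^j) x * g x)) \<longlonglongrightarrow> v x * g x"
  proof (rule AE_I2)
    fix x assume "x \<in> space (lebesgue_on I)"
    then have "(\<lambda>j. cutoff (2^j) x) \<longlonglongrightarrow> 1" by (intro cutoff_tendsto) simp
    then have "(\<lambda>j. v x * (cutoff (2^j) x * g x)) \<longlonglongrightarrow> v x * (1 * g x)" by (intro tendsto_intros)
    then show "(\<lambda>j. v x * (cutoff (2^j) x * g x)) \<longlonglongrightarrow> v x * g x" by simp
  qed
  show "AE x in lebesgue_on I. norm (v x * (cutoff (2^j) x * g x)) \<le> \<bar>v x * g x\<bar>" for j
    using cutoff_bounds[of "2^j"] by (intro AE_I2) (auto simp: abs_mult intro!: mult_left_mono mult_left_le_one_le)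
qed

lemma L2_norm_cutoff_le: assumes g: "smooth1 g" shows "L2_norm (\<lambda>x. cutoff k x * g x) \<le> L2_norm g"
  unfolding L2_norm_def
proof (intro real_sqrt_le_mono integral_mono L2_square_integrable L2_cutoff_mult g L2_smooth1)
  fix x show "(cutoff k x * g x)^2 \<le> (g x)^2"
    using cutoff_bounds[of k x] by (auto simp: power_mult_distrib intro!: mult_left_le_one_le power_le_one)
qed

subsection \<open>Moments and uniqueness\<close>

text \<open>Truncated subtraction in the exponent n - 2 is harmless: for n < 2 the coefficient n (n
  - 1) is 0.\<close>

lemma deriv2_weighted_power:
  "deriv (deriv (\<lambda>x::real. (1 - x^2) * x^n)) x = real n * real (n - 1) * x^(n - 2) - real (n + 2) * real (n + 1) * x^n"
proof -
  have e: "(\<lambda>x::real. (1 - x^2) * x^n) = (\<lambda>x. x^n - x^(n + 2))"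
    by (auto simp: algebra_simps power2_eq_square)
  have p: "((\<lambda>x::real. x^m) has_real_derivative real m * x^(m - 1)) (at x)" for m x
    by (auto intro!: derivative_eq_intros)
  have "((\<lambda>x::real. x^n - x^(n + 2)) has_real_derivative real n * x^(n - 1) - real (n + 2) * x^(n + 1)) (at x)" for x
    by (rule DERIV_cong[OF DERIV_diff[OF p p]]) simp
  then have 1: "deriv (\<lambda>x::real. x^n - x^(n + 2)) = (\<lambda>x. real n * x^(n - 1) - real (n + 2) * x^(n + 1))"
    by (intro ext DERIV_imp_deriv)
  show ?thesis unfolding e 1
    by (rule DERIV_imp_deriv, rule DERIV_cong[OF DERIV_diff[OF DERIV_cmult[OF p] DERIV_cmult[OF p]]])
       (simp add: numeral_2_eq_2)
qed

lemma smooth1_monomial: "smooth1 (\<lambda>x. x^n)"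
  by (intro smooth1_power smooth1_ident)

context null_solution
begin

text \<open>The identity is integrated in time because the cut-off remainders vanish only in L^1 in
  time, not at each time. They are estimated for q = (1 - x^2) x^n, which is 0 at both endpoints as
  \<open>cutoff_rem_bound\<close> demands.\<close>

lemma moment_increment:
  assumes a: "0 < a" and ab: "a \<le> b"
  shows "ip (\<lambda>x. W x b) (\<lambda>x. x^n) - ip (\<lambda>x. W x a) (\<lambda>x. x^n) =
    (\<integral>t. lam / 2 * ip (\<lambda>x. W x t) (deriv (deriv (\<lambda>x. (1 - x^2) * x^n))) \<partial>lebesgue_on {a..b})"
proof -
  interpret R: null_solution lam "\<lambda>x. W (- x)" N by (rule null_solution_reflect)
  define q :: "real \<Rightarrow> real" where "q x = (1 - x^2) * x^n" for x
  have q: "smooth1 q" unfolding q_def by (intro smooth1_mult smooth1_diff smooth1_power smooth1_const smooth1_ident)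
  have q2: "smooth1 (deriv (deriv q))" by (intro smooth1_deriv q)
  have qr: "smooth1 (\<lambda>x. q (- x))" by (rule smooth1_reflect[OF q])
  have q1: "q 1 = 0" "q (- 1) = 0" by (auto simp: q_def)
  define c where "c j t = ip (\<lambda>x. W x t) (\<lambda>x. cutoff (2^j) x * deriv (deriv q) x)" for j :: nat and t
  define r where "r j t = ip (\<lambda>x. W x t) (cutoff_rem (2^j) q)" for j :: nat and t
  define s where "s j t = ip (\<lambda>x. W (- x) t) (cutoff_rem (2^j) (\<lambda>x. q (- x)))" for j :: nat and t
  have cc: "continuous_on {a..b} (c j)" "continuous_on {a..b} (r j)" "continuous_on {a..b} (s j)" for j
    unfolding c_def r_def s_def
    by (intro continuous_on_ip_W R.continuous_on_ip_W a smooth1_cutoff_rem smooth1_mult smooth1_cutoff q2 q qr)+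
  note ci = continuous_imp_integrable_real[OF cc(1)] continuous_imp_integrable_real[OF cc(2)] continuous_imp_integrable_real[OF cc(3)]
  have incr: "ip (\<lambda>x. W x b) (\<lambda>x. cutoff (2^j) x * x^n) - ip (\<lambda>x. W x a) (\<lambda>x. cutoff (2^j) x * x^n) =
     lam / 2 * ((\<integral>t. c j t \<partial>lebesgue_on {a..b}) + (\<integral>t. r j t \<partial>lebesgue_on {a..b}) + (\<integral>t. s j t \<partial>lebesgue_on {a..b}))"
    if j: "j \<ge> 2" for j
  proof -
    define k where "k = (2::real)^j"
    have k: "k \<ge> 4" using power_increasing[OF j, of "2::real"] by (simp add: k_def)
    define f where "f x = cutoff k x * x^n" for x
    have f: "test1 f"
    proof (rule test1I)
      show "smooth1 f" unfolding f_def by (intro smooth1_mult smooth1_cutoff smooth1_monomial)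
      show "-1 < -1 + 1 / k" "1 - 1 / k < 1" using k by auto
      show "f x = 0" if "x \<notin> {-1 + 1 / k..1 - 1 / k}" for x
        using cutoff_eq_0[OF _ that] k by (simp add: f_def)
    qed
    have wf: "(\<lambda>y. (1 - y^2) * f y) = (\<lambda>y. cutoff k y * q y)" by (auto simp: f_def q_def)
    have D: "((\<lambda>t. ip (\<lambda>x. W x t) f) has_real_derivative lam / 2 * (c j t + r j t + s j t)) (at t)" if t: "t > 0" for t
    proof -
      have L: "L2 (\<lambda>x. W x t)" by (rule L2_W[OF t])
      have rs: "smooth1 (cutoff_rem k (\<lambda>x. q (- x)))" by (rule smooth1_cutoff_rem[OF qr])
      have "deriv (deriv (\<lambda>y. cutoff k y * q y)) =
        (\<lambda>x. (cutoff k x * deriv (deriv q) x + cutoff_rem k q x) + cutoff_rem k (\<lambda>x. q (- x)) (- x))"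
        by (intro ext) (simp add: cutoff_deriv2[OF q k])
      then have "ip (\<lambda>x. W x t) (deriv (deriv (\<lambda>y. cutoff k y * q y))) =
        ip (\<lambda>x. W x t) (\<lambda>x. cutoff k x * deriv (deriv q) x) + ip (\<lambda>x. W x t) (cutoff_rem k q) +
        ip (\<lambda>x. W x t) (\<lambda>x. cutoff_rem k (\<lambda>x. q (- x)) (- x))"
        using L by (simp add: ip_add_right L2_add L2_cutoff_mult[OF q2] L2_smooth1 smooth1_cutoff_rem[OF q] smooth1_reflect[OF rs])
      also have "\<dots> = c j t + r j t + s j t"
        using ip_reflect[OF L L2_smooth1[OF rs]] by (simp add: c_def r_def s_def k_def)
      finally show ?thesis using evolution[OF f t] unfolding wf by simp
    qed
    have "((\<lambda>t. lam / 2 * (c j t + r j t + s j t)) has_integral (ip (\<lambda>x. W x b) f - ip (\<lambda>x. W x a) f)) {a..b}"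
    proof (rule fundamental_theorem_of_calculus[OF ab])
      fix t assume "t \<in> {a..b}"
      then have "t > 0" using a by simp
      then show "((\<lambda>t. ip (\<lambda>x. W x t) f) has_vector_derivative lam / 2 * (c j t + r j t + s j t)) (at t within {a..b})"
        unfolding has_real_derivative_iff_has_vector_derivative[symmetric]
        by (rule has_field_derivative_at_within[OF D])
    qed
    moreover have "(\<integral>t. lam / 2 * (c j t + r j t + s j t) \<partial>lebesgue_on {a..b}) = integral {a..b} (\<lambda>t. lam / 2 * (c j t + r j t + s j t))"
      by (intro lebesgue_integral_eq_integral continuous_imp_integrable_real continuous_intros cc) simp
    ultimately have "ip (\<lambda>x. W x b) f - ip (\<lambda>x. W x a) f = (\<integral>t. lam / 2 * (c j t + r j t + s j t) \<partial>lebesgue_on {a..b})"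
      by (simp only: integral_unique)
    also have "\<dots> = lam / 2 * ((\<integral>t. c j t \<partial>lebesgue_on {a..b}) + (\<integral>t. r j t \<partial>lebesgue_on {a..b}) + (\<integral>t. s j t \<partial>lebesgue_on {a..b}))"
      using ci by simp
    finally show ?thesis by (simp add: f_def[abs_def] k_def)
  qed
  have l1: "(\<lambda>j. \<integral>t. r j t \<partial>lebesgue_on {a..b}) \<longlonglongrightarrow> 0"
    by (rule Lim_null_comparison[OF always_eventually cutoff_rem_tendsto[OF a ab q q1(1)]])
       (use integral_norm_bound in \<open>auto simp: r_def\<close>)
  have l2: "(\<lambda>j. \<integral>t. s j t \<partial>lebesgue_on {a..b}) \<longlonglongrightarrow> 0"
    by (rule Lim_null_comparison[OF always_eventually R.cutoff_rem_tendsto[OF a ab qr]])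
       (use integral_norm_bound q1 in \<open>auto simp: s_def\<close>)
  obtain K where K: "\<And>t. t \<in> {a..b} \<Longrightarrow> L2_norm (\<lambda>x. W x t) \<le> K" "K \<ge> 0"
    using L2_path_bounded[OF path a] by blast
  have l3: "(\<lambda>j. \<integral>t. c j t \<partial>lebesgue_on {a..b}) \<longlonglongrightarrow> (\<integral>t. ip (\<lambda>x. W x t) (deriv (deriv q)) \<partial>lebesgue_on {a..b})"
  proof (rule integral_dominated_convergence[where w = "\<lambda>t. K * L2_norm (deriv (deriv q))"])
    show "(\<lambda>t. ip (\<lambda>x. W x t) (deriv (deriv q))) \<in> borel_measurable (lebesgue_on {a..b})"
      by (rule continuous_imp_measurable_on_sets_lebesgue[OF continuous_on_ip_W[OF a q2]]) simp
    show "c j \<in> borel_measurable (lebesgue_on {a..b})" for j using ci(1) by blast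
    show "integrable (lebesgue_on {a..b}) (\<lambda>t. K * L2_norm (deriv (deriv q)))"
      by (intro continuous_imp_integrable_real continuous_intros)
    show "AE t in lebesgue_on {a..b}. (\<lambda>j. c j t) \<longlonglongrightarrow> ip (\<lambda>x. W x t) (deriv (deriv q))"
      unfolding c_def using a by (intro AE_I2 cutoff_ip_tendsto L2_W q2) auto
    show "AE t in lebesgue_on {a..b}. norm (c j t) \<le> K * L2_norm (deriv (deriv q))" for j
    proof (rule AE_I2)
      fix t assume "t \<in> space (lebesgue_on {a..b})"
      then have t: "t \<in> {a..b}" "t > 0" using a by auto
      have "norm (c j t) \<le> L2_norm (\<lambda>x. W x t) * L2_norm (\<lambda>x. cutoff (2^j) x * deriv (deriv q) x)"
        unfolding c_def using abs_ip_le[OF L2_W[OF t(2)] L2_cutoff_mult[OF q2]] by simp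
      also have "\<dots> \<le> K * L2_norm (deriv (deriv q))"
        using K t by (intro mult_mono L2_norm_cutoff_le q2 L2_norm_nonneg) auto
      finally show "norm (c j t) \<le> K * L2_norm (deriv (deriv q))" .
    qed
  qed
  have "(\<lambda>j. ip (\<lambda>x. W x b) (\<lambda>x. cutoff (2^j) x * x^n) - ip (\<lambda>x. W x a) (\<lambda>x. cutoff (2^j) x * x^n))
     \<longlonglongrightarrow> ip (\<lambda>x. W x b) (\<lambda>x. x^n) - ip (\<lambda>x. W x a) (\<lambda>x. x^n)"
    using a ab by (intro tendsto_diff cutoff_ip_tendsto L2_W smooth1_monomial) auto
  moreover have "(\<lambda>j. ip (\<lambda>x. W x b) (\<lambda>x. cutoff (2^j) x * x^n) - ip (\<lambda>x. W x a) (\<lambda>x. cutoff (2^j) x * x^n))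
     \<longlonglongrightarrow> lam / 2 * ((\<integral>t. ip (\<lambda>x. W x t) (deriv (deriv q)) \<partial>lebesgue_on {a..b}) + 0 + 0)"
    by (rule Lim_transform_eventually[OF tendsto_mult_left[OF tendsto_add[OF tendsto_add[OF l3 l1] l2], of "lam / 2"]])
       (unfold eventually_sequentially, use incr[symmetric] in blast)
  ultimately have "ip (\<lambda>x. W x b) (\<lambda>x. x^n) - ip (\<lambda>x. W x a) (\<lambda>x. x^n) =
      lam / 2 * ((\<integral>t. ip (\<lambda>x. W x t) (deriv (deriv q)) \<partial>lebesgue_on {a..b}) + 0 + 0)"
    by (rule LIMSEQ_unique)
  then show ?thesis by (simp add: q_def[abs_def])
qed

text \<open>The integrand in \<open>moment_increment\<close> is continuous in time, so the integral
  identity can be differentiated back.\<close>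

lemma moment_DERIV:
  assumes t: "t > 0"
  shows "((\<lambda>s. ip (\<lambda>x. W x s) (\<lambda>x. x^n)) has_real_derivative
    lam / 2 * (real n * real (n - 1) * ip (\<lambda>x. W x t) (\<lambda>x. x^(n - 2)) - real (n + 2) * real (n + 1) * ip (\<lambda>x. W x t) (\<lambda>x. x^n))) (at t)"
proof -
  define q :: "real \<Rightarrow> real" where "q x = (1 - x^2) * x^n" for x
  have q: "smooth1 q" unfolding q_def by (intro smooth1_mult smooth1_diff smooth1_power smooth1_const smooth1_ident)
  define g where "g s = lam / 2 * ip (\<lambda>x. W x s) (deriv (deriv q))" for s
  define a b where "a = t / 2" and "b = 2 * t"
  have ab: "0 < a" "a < t" "t < b" using t by (auto simp: a_def b_def)
  have cg: "continuous_on {a..b} g" unfolding g_def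
    by (intro continuous_intros continuous_on_ip_W ab smooth1_deriv q)
  have m: "ip (\<lambda>x. W x a) (\<lambda>x. x^n) + integral {a..s} g = ip (\<lambda>x. W x s) (\<lambda>x. x^n)" if "s \<in> {a..b}" for s
  proof -
    have "continuous_on {a..s} g" using that by (intro continuous_on_subset[OF cg]) auto
    then have "(\<integral>t. g t \<partial>lebesgue_on {a..s}) = integral {a..s} g"
      by (intro lebesgue_integral_eq_integral continuous_imp_integrable_real) auto
    then show ?thesis using moment_increment[OF ab(1), of s n] that by (simp add: g_def q_def[abs_def])
  qed
  have "((\<lambda>s. integral {a..s} g) has_real_derivative g t) (at t within {a..b})"
    using ab by (intro integral_has_real_derivative[OF cg]) auto
  then have "((\<lambda>s. ip (\<lambda>x. W x a) (\<lambda>x. x^n) + integral {a..s} g) has_real_derivative g t) (at t)"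
    using ab at_within_Icc_at[of a t b] by (auto intro!: derivative_eq_intros)
  then have "((\<lambda>s. ip (\<lambda>x. W x s) (\<lambda>x. x^n)) has_real_derivative g t) (at t)"
    by (rule has_field_derivative_transform_within_open[where S = "{a<..<b}"]) (use ab m in auto)
  moreover have "g t = lam / 2 * (real n * real (n - 1) * ip (\<lambda>x. W x t) (\<lambda>x. x^(n - 2)) - real (n + 2) * real (n + 1) * ip (\<lambda>x. W x t) (\<lambda>x. x^n))"
  proof -
    have "deriv (deriv q) = (\<lambda>x. (real n * real (n - 1)) * x^(n - 2) - (real (n + 2) * real (n + 1)) * x^n)"
      unfolding q_def by (intro ext deriv2_weighted_power)
    then have "ip (\<lambda>x. W x t) (deriv (deriv q)) = (real n * real (n - 1)) * ip (\<lambda>x. W x t) (\<lambda>x. x^(n - 2)) - (real (n + 2) * real (n + 1)) * ip (\<lambda>x. W x t) (\<lambda>x. x^n)"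
      by (simp only: ip_diff_right[OF L2_W[OF t] L2_cmult[OF L2_smooth1[OF smooth1_monomial]] L2_cmult[OF L2_smooth1[OF smooth1_monomial]]] ip_cmult_right)
    then show ?thesis by (simp add: g_def)
  qed
  ultimately show ?thesis by simp
qed

text \<open>The system is triangular: by strong induction the moment of order n - 2 vanishes, which
  leaves m' = - c m. The solution tends to 0 at time 0 because the L^2 norm does, so it is
  zero.\<close>

lemma moments_zero:
  assumes init: "((\<lambda>t. L2_norm (\<lambda>x. W x t)) \<longlongrightarrow> 0) (at_right 0)"
  shows "t > 0 \<Longrightarrow> ip (\<lambda>x. W x t) (\<lambda>x. x^n) = 0"
proof (induction n arbitrary: t rule: less_induct)
  case (less n)
  define m where "m t = ip (\<lambda>x. W x t) (\<lambda>x. x^n)" for t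
  define c where "c = lam / 2 * (real (n + 2) * real (n + 1))"
  have z: "real n * real (n - 1) * ip (\<lambda>x. W x s) (\<lambda>x. x^(n - 2)) = 0" if "s > 0" for s
  proof (cases "n \<ge> 2")
    case True
    then show ?thesis using less.IH[of "n - 2" s] that by simp
  next
    case False
    then have "n = 0 \<or> n = 1" by auto
    then show ?thesis by auto
  qed
  have D: "(m has_real_derivative - c * m s) (at s)" if "s > 0" for s
    unfolding m_def by (rule DERIV_cong[OF moment_DERIV[OF that]]) (simp only: z[OF that], simp add: c_def)
  \<comment> \<open>The integrating factor makes g constant on t > 0; its value is then read off
    from the limit at 0.\<close>
  define g where "g s = m s * exp (c * s)" for s
  have gD: "(g has_real_derivative 0) (at s)" if "s > 0" for s
    unfolding g_def by (auto intro!: derivative_eq_intros D that)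
  have eq: "g x = g y" if "0 < x" "x < y" for x y
  proof -
    have "\<exists>z. x < z \<and> z < y \<and> g y - g x = (y - x) * 0"
      using that gD by (intro MVT2[of x y g "\<lambda>_. 0"]) auto
    then show ?thesis by auto
  qed
  have const: "g t = g s" if "s > 0" for s
  proof -
    consider "s < t" | "t < s" | "s = t" by linarith
    then show ?thesis
    proof cases
      case 1 then show ?thesis using eq[OF that 1] by simp
    next
      case 2 then show ?thesis using eq[OF less.prems 2] by simp
    next
      case 3 then show ?thesis by simp
    qed
  qed
  have "(m \<longlongrightarrow> 0) (at_right 0)"
  proof (rule Lim_null_comparison)
    show "((\<lambda>s. L2_norm (\<lambda>x. W x s) * L2_norm (\<lambda>x. x^n)) \<longlongrightarrow> 0) (at_right 0)"
      by (rule tendsto_mult_left_zero[OF init])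
    show "\<forall>\<^sub>F s in at_right 0. norm (m s) \<le> L2_norm (\<lambda>x. W x s) * L2_norm (\<lambda>x. x^n)"
      unfolding m_def eventually_at_right_field
      using abs_ip_le[OF L2_W L2_smooth1[OF smooth1_monomial]] by (intro exI[of _ 1]) auto
  qed
  moreover have "((\<lambda>s. exp (c * s)) \<longlongrightarrow> exp (c * 0)) (at_right 0)" by (intro tendsto_intros)
  ultimately have "((\<lambda>s. m s * exp (c * s)) \<longlongrightarrow> 0 * exp (c * 0)) (at_right 0)" by (rule tendsto_mult)
  then have "(g \<longlongrightarrow> 0) (at_right 0)" by (simp add: g_def[abs_def])
  moreover have "(g \<longlongrightarrow> g t) (at_right 0)"
    by (rule Lim_transform_eventually[OF tendsto_const])
       (auto simp: eventually_at_right_field intro!: exI[of _ 1] const)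
  ultimately have "g t = 0" using tendsto_unique[OF trivial_limit_at_right_real] by blast
  then show ?case by (simp add: g_def m_def)
qed

end

section \<open>Functions with vanishing moments\<close>

lemma ip_polynomial_zero:
  assumes v: "L2 v" and mom: "\<And>n. ip v (\<lambda>x. x^n) = 0" and p: "real_polynomial_function p"
  shows "ip v p = 0" and "smooth1 p"
proof -
  obtain a n where p: "p = (\<lambda>x. \<Sum>i\<le>n. a i * x^i)" using p real_polynomial_function_iff_sum by blast
  have "smooth1 (\<lambda>x. \<Sum>i\<le>n. a i * x^i) \<and> ip v (\<lambda>x. \<Sum>i\<le>n. a i * x^i) = 0"
  proof (induction n)
    case 0
    then show ?case using ip_cmult_right[of v "a 0" "\<lambda>x. x^0"] mom[of 0] by simp
  next
    case (Suc n)
    have s: "smooth1 (\<lambda>x. a (Suc n) * x^Suc n)" by (intro smooth1_mult smooth1_const smooth1_monomial)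
    have "ip v (\<lambda>x. (\<Sum>i\<le>n. a i * x^i) + a (Suc n) * x^Suc n) = 0"
      using Suc ip_add_right[OF v L2_smooth1 L2_smooth1[OF s]] ip_cmult_right[of v "a (Suc n)" "\<lambda>x. x^Suc n"] mom[of "Suc n"]
      by simp
    then show ?case using smooth1_add[OF conjunct1[OF Suc] s] by simp
  qed
  then show "ip v p = 0" "smooth1 p" by (simp_all add: p)
qed

lemma ip_continuous_zero:
  assumes v: "L2 v" and mom: "\<And>n. ip v (\<lambda>x. x^n) = 0" and g: "continuous_on {-1..1} g"
  shows "ip v g = 0"
proof (rule ccontr)
  assume ne: "ip v g \<noteq> 0"
  \<comment> \<open>sqrt 2 is the L^2 norm of 1 on (-1,1), which converts the uniform error e into
    an L^2 error; the added 1 makes A positive and the final inequality strict.\<close>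
  define A where "A = L2_norm v * sqrt 2 + 1"
  have A: "A > 0" using L2_norm_nonneg[of v] by (simp add: A_def add_nonneg_pos)
  define e where "e = \<bar>ip v g\<bar> / A"
  have e: "e > 0" using ne A by (simp add: e_def)
  obtain p where p: "real_polynomial_function p" "\<And>x. x \<in> {-1..1} \<Longrightarrow> \<bar>g x - p x\<bar> < e"
    using Stone_Weierstrass_real_polynomial_function[OF compact_Icc g e] by blast
  have Lg: "L2 g" by (rule L2_continuous[OF g])
  have p0: "ip v p = 0" and sp: "smooth1 p" using ip_polynomial_zero[OF v mom p(1)] by auto
  have Lp: "L2 p" by (rule L2_smooth1[OF sp])
  have "(\<integral>x. (g x - p x)^2 \<partial>lebesgue_on I) \<le> (\<integral>x. e^2 \<partial>lebesgue_on I)"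
  proof (rule integral_mono)
    show "integrable (lebesgue_on I) (\<lambda>x. (g x - p x)^2)" by (rule L2_square_integrable[OF L2_diff[OF Lg Lp]])
    show "integrable (lebesgue_on I) (\<lambda>x. e^2)" by (rule integrable_smooth1_I[OF smooth1_const])
    fix x assume "x \<in> space (lebesgue_on I)"
    then have "\<bar>g x - p x\<bar> \<le> \<bar>e\<bar>" using p(2)[of x] e by (simp add: I_def)
    then show "(g x - p x)^2 \<le> e^2" by (simp add: abs_le_square_iff)
  qed
  also have "\<dots> = 2 * e^2" using measure_I by simp
  finally have "L2_norm (\<lambda>x. g x - p x) \<le> sqrt (2 * e^2)" unfolding L2_norm_def by (rule real_sqrt_le_mono)
  also have "\<dots> = sqrt 2 * e" using e by (simp add: real_sqrt_mult)
  finally have n: "L2_norm (\<lambda>x. g x - p x) \<le> sqrt 2 * e" .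
  have "\<bar>ip v g\<bar> = \<bar>ip v (\<lambda>x. g x - p x)\<bar>" using ip_diff_right[OF v Lg Lp] p0 by simp
  also have "\<dots> \<le> L2_norm v * L2_norm (\<lambda>x. g x - p x)" by (rule abs_ip_le[OF v L2_diff[OF Lg Lp]])
  also have "\<dots> \<le> L2_norm v * (sqrt 2 * e)" by (rule mult_left_mono[OF n L2_norm_nonneg])
  also have "\<dots> = (A - 1) * e" by (simp add: A_def)
  also have "\<dots> < A * e" using e by simp
  also have "\<dots> = \<bar>ip v g\<bar>" using A by (simp add: e_def)
  finally show False by simp
qed

text \<open>Every measurable function is an almost everywhere limit of continuous ones; this is applied
  to the sign of \<open>v\<close>.\<close>
lemma moments_determine:
  assumes v: "L2 v" and mom: "\<And>n. ip v (\<lambda>x. x^n) = 0"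
  shows "AE x in lebesgue_on I. v x = 0"
proof -
  have [measurable]: "v \<in> borel_measurable (lebesgue_on I)" using v by (rule L2_measurable)
  have sm: "(\<lambda>x. sgn (v x)) \<in> borel_measurable (lebesgue_on I)" by measurable
  then have "(\<lambda>x. sgn (v x)) measurable_on I" by (simp add: measurable_on_iff_borel_measurable)
  then obtain Z g where Z: "negligible Z" and g: "\<And>n. continuous_on UNIV (g n :: real \<Rightarrow> real)"
    and lim: "\<And>x. x \<notin> Z \<Longrightarrow> (\<lambda>n. g n x) \<longlonglongrightarrow> (if x \<in> I then sgn (v x) else 0)"
    unfolding measurable_on_def by blast
  \<comment> \<open>Clamping to [-1, 1] leaves the limit \<open>sgn (v x)\<close> unchanged and
    makes |v| an integrable majorant.\<close>
  define h where "h n x = max (-1) (min 1 (g n x))" for n x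
  have hc: "continuous_on S (h n)" for n S
    unfolding h_def by (intro continuous_intros continuous_on_subset[OF g]) auto
  have iv: "integrable (lebesgue_on I) (\<lambda>x. \<bar>v x\<bar>)"
    using L2_mult_integrable[OF v L2_smooth1[OF smooth1_const[of 1]]] by simp
  have AEZ: "AE x in lebesgue_on I. x \<notin> Z"
  proof -
    have "Z \<in> null_sets lebesgue" using Z by (simp add: negligible_iff_null_sets)
    then have "AE x in lebesgue. x \<notin> Z" by (rule AE_not_in)
    then show ?thesis by (subst AE_restrict_space_iff) (auto elim!: eventually_mono)
  qed
  have "(\<lambda>n. ip v (h n)) \<longlonglongrightarrow> (\<integral>x. \<bar>v x\<bar> \<partial>lebesgue_on I)"
    unfolding ip_def
  proof (rule integral_dominated_convergence[where w = "\<lambda>x. \<bar>v x\<bar>"])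
    show "(\<lambda>x. \<bar>v x\<bar>) \<in> borel_measurable (lebesgue_on I)" by measurable
    show "(\<lambda>x. v x * h n x) \<in> borel_measurable (lebesgue_on I)" for n
      using L2_mult_integrable[OF v L2_continuous[OF hc]] by auto
    show "AE x in lebesgue_on I. (\<lambda>n. v x * h n x) \<longlonglongrightarrow> \<bar>v x\<bar>"
      using AEZ AE_space[of "lebesgue_on I"]
    proof eventually_elim
      case (elim x)
      then have "(\<lambda>n. g n x) \<longlonglongrightarrow> sgn (v x)" using lim[of x] by simp
      then have "(\<lambda>n. v x * h n x) \<longlonglongrightarrow> v x * max (-1) (min 1 (sgn (v x)))"
        unfolding h_def by (intro tendsto_intros)
      moreover have "v x * max (-1) (min 1 (sgn (v x))) = \<bar>v x\<bar>" by (auto simp: sgn_if)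
      ultimately show ?case by simp
    qed
    show "AE x in lebesgue_on I. norm (v x * h n x) \<le> \<bar>v x\<bar>" for n
    proof (rule AE_I2)
      fix x
      have "\<bar>h n x\<bar> \<le> 1" by (simp add: h_def)
      then show "norm (v x * h n x) \<le> \<bar>v x\<bar>" by (simp add: abs_mult mult_left_le)
    qed
  qed (rule iv)
  moreover have "ip v (h n) = 0" for n by (rule ip_continuous_zero[OF v mom hc])
  ultimately have "(\<integral>x. \<bar>v x\<bar> \<partial>lebesgue_on I) = 0" by (simp add: LIMSEQ_const_iff)
  then show ?thesis using integral_nonneg_eq_0_iff_AE[OF iv] by simp
qed

section \<open>The difference of two weak solutions\<close>

lemma has_traces_diff:
  assumes "has_traces v a b" "has_traces w c d" shows "has_traces (\<lambda>x. v x - w x) (a - c) (b - d)"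
proof -
  obtain f g where "continuous_on I f" "AE x in lebesgue_on I. f x = v x"
      "(f \<longlongrightarrow> a) (at_left 1)" "(f \<longlongrightarrow> b) (at_right (-1))"
    and "continuous_on I g" "AE x in lebesgue_on I. g x = w x"
      "(g \<longlongrightarrow> c) (at_left 1)" "(g \<longlongrightarrow> d) (at_right (-1))"
    using assms unfolding has_traces_def by blast
  then show ?thesis
    unfolding has_traces_def
    by (intro exI[of _ "\<lambda>x. f x - g x"] conjI continuous_intros tendsto_intros) auto
qed

text \<open>The difference is formed after the equation has become a derivative formula for
  pairings, where subtraction needs only square integrability at each time; the nested space-time
  integrals are never subtracted. N is twice the sum of the two energies, as in
  \<open>energy_density_diff\<close>.\<close>

lemma weak_solution_difference:
  assumes lam: "lam > 0" and G1: "is_weak_solution lam G0 p G1" and G2: "is_weak_solution lam G0 p G2"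
  obtains N where "null_solution lam (\<lambda>x t. G1 x t - G2 x t) N"
proof -
  have P: "L2_path G1" "L2_path G2" using G1 G2 by (auto simp: is_weak_solution_def L2_path_def)
  obtain D1 where D1: "AE t in lborel. t > 0 \<longrightarrow> H1rho_with (\<lambda>x. G1 x t) (\<lambda>x. D1 x t)"
      "\<And>a b. 0 < a \<Longrightarrow> set_integrable lborel {a..b} (\<lambda>t. \<integral>x. (1 - x^2) * (D1 x t)^2 \<partial>lebesgue_on I)"
    using G1 unfolding is_weak_solution_def by blast
  obtain D2 where D2: "AE t in lborel. t > 0 \<longrightarrow> H1rho_with (\<lambda>x. G2 x t) (\<lambda>x. D2 x t)"
      "\<And>a b. 0 < a \<Longrightarrow> set_integrable lborel {a..b} (\<lambda>t. \<integral>x. (1 - x^2) * (D2 x t)^2 \<partial>lebesgue_on I)"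
    using G2 unfolding is_weak_solution_def by blast
  define N where "N t = 2 * ((\<integral>x. (1 - x^2) * (D1 x t)^2 \<partial>lebesgue_on I) + (\<integral>x. (1 - x^2) * (D2 x t)^2 \<partial>lebesgue_on I))" for t
  have "null_solution lam (\<lambda>x t. G1 x t - G2 x t) N"
  proof
    show "lam > 0" by (rule lam)
    show "L2_path (\<lambda>x t. G1 x t - G2 x t)"
      unfolding L2_path_def
    proof (intro conjI allI impI)
      fix t :: real assume t: "t > 0"
      show "L2 (\<lambda>x. G1 x t - G2 x t)" by (intro L2_diff L2_pathD[OF P(1) t] L2_pathD[OF P(2) t])
      show "((\<lambda>s. L2_norm (\<lambda>x. G1 x s - G2 x s - (G1 x t - G2 x t))) \<longlongrightarrow> 0) (at t)"
      proof (rule Lim_null_comparison)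
        have "((\<lambda>s. L2_norm (\<lambda>x. G1 x s - G1 x t) + L2_norm (\<lambda>x. G2 x s - G2 x t)) \<longlongrightarrow> 0 + 0) (at t)"
          using P t unfolding L2_path_def by (intro tendsto_add) auto
        then show "((\<lambda>s. L2_norm (\<lambda>x. G1 x s - G1 x t) + L2_norm (\<lambda>x. G2 x s - G2 x t)) \<longlongrightarrow> 0) (at t)" by simp
        have "\<forall>\<^sub>F s in at t. s \<in> {0<..}" using t by (intro eventually_at_in_open') auto
        then show "\<forall>\<^sub>F s in at t. norm (L2_norm (\<lambda>x. G1 x s - G2 x s - (G1 x t - G2 x t))) \<le>
            L2_norm (\<lambda>x. G1 x s - G1 x t) + L2_norm (\<lambda>x. G2 x s - G2 x t)"
        proof eventually_elim
          case (elim s)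
          then have s: "s > 0" by simp
          have "(\<lambda>x. G1 x s - G2 x s - (G1 x t - G2 x t)) = (\<lambda>x. (G1 x s - G1 x t) - (G2 x s - G2 x t))" by auto
          then show ?case
            using L2_norm_diff_le[OF L2_diff[OF L2_pathD[OF P(1) s] L2_pathD[OF P(1) t]]
                L2_diff[OF L2_pathD[OF P(2) s] L2_pathD[OF P(2) t]]] L2_norm_nonneg by simp
        qed
      qed
    qed
    show "AE t in lborel. t > 0 \<longrightarrow> has_traces (\<lambda>x. G1 x t - G2 x t) 0 0"
    proof -
      have "AE t in lborel. t > 0 \<longrightarrow> has_traces (\<lambda>x. G1 x t) 1 p" "AE t in lborel. t > 0 \<longrightarrow> has_traces (\<lambda>x. G2 x t) 1 p"
        using G1 G2 by (auto simp: is_weak_solution_def)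
      then show ?thesis
      proof eventually_elim
        case (elim t)
        then show ?case using has_traces_diff[of "\<lambda>x. G1 x t" 1 p "\<lambda>x. G2 x t" 1 p] by simp
      qed
    qed
    show "AE t in lborel. t > 0 \<longrightarrow> (\<exists>D. energy_density (\<lambda>x. G1 x t - G2 x t) D \<and> (\<integral>x. D x \<partial>lebesgue_on I) \<le> N t)"
      using D1(1) D2(1)
    proof eventually_elim
      case (elim t)
      show ?case
      proof
        assume t: "t > 0"
        have e: "energy_density (\<lambda>x. G1 x t) (\<lambda>x. (1 - x^2) * (D1 x t)^2)" "energy_density (\<lambda>x. G2 x t) (\<lambda>x. (1 - x^2) * (D2 x t)^2)"
          using elim t H1rho_energy_density by blast+
        have i: "integrable (lebesgue_on I) (\<lambda>x. (1 - x^2) * (D1 x t)^2)" "integrable (lebesgue_on I) (\<lambda>x. (1 - x^2) * (D2 x t)^2)"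
          using e by (auto simp: energy_density_def)
        have "(\<integral>x. 2 * ((1 - x^2) * (D1 x t)^2 + (1 - x^2) * (D2 x t)^2) \<partial>lebesgue_on I) = N t"
          using i by (simp add: N_def)
        then show "\<exists>D. energy_density (\<lambda>x. G1 x t - G2 x t) D \<and> (\<integral>x. D x \<partial>lebesgue_on I) \<le> N t"
          using energy_density_diff[OF L2_pathD[OF P(1) t] L2_pathD[OF P(2) t] e]
          by (intro exI[of _ "\<lambda>x. 2 * ((1 - x^2) * (D1 x t)^2 + (1 - x^2) * (D2 x t)^2)"]) auto
      qed
    qed
    show "set_integrable lborel {a..b} N" if "0 < a" for a b
      unfolding N_def by (intro set_integrable_mult_right set_integral_add D1(2) D2(2) that)
    fix f t assume f: "test1 f" and t: "t > (0::real)"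
    define h where "h = deriv (deriv (\<lambda>y. (1 - y^2) * f y))"
    have Lf: "L2 f" and Lh: "L2 h"
      unfolding h_def using test1_smooth[OF f]
      by (auto intro!: L2_smooth1 smooth1_deriv smooth1_mult smooth1_diff smooth1_power)
    have w: "weak_eq lam G1" "weak_eq lam G2" using G1 G2 by (auto simp: is_weak_solution_def)
    have "((\<lambda>s. ip (\<lambda>x. G1 x s) f - ip (\<lambda>x. G2 x s) f) has_real_derivative
        lam / 2 * ip (\<lambda>x. G1 x t) h - lam / 2 * ip (\<lambda>x. G2 x t) h) (at t)"
      unfolding h_def by (intro DERIV_diff weak_eq_DERIV w P f t)
    also have "lam / 2 * ip (\<lambda>x. G1 x t) h - lam / 2 * ip (\<lambda>x. G2 x t) h = lam / 2 * ip (\<lambda>x. G1 x t - G2 x t) h"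
      using ip_diff_left[OF L2_pathD[OF P(1) t] L2_pathD[OF P(2) t] Lh] by (simp add: right_diff_distrib)
    finally show "((\<lambda>s. ip (\<lambda>x. G1 x s - G2 x s) f) has_real_derivative
       lam / 2 * ip (\<lambda>x. G1 x t - G2 x t) (deriv (deriv (\<lambda>y. (1 - y^2) * f y)))) (at t)"
      unfolding h_def[symmetric]
    proof (rule has_field_derivative_transform_within_open[where S = "{0<..}"])
      fix s :: real assume "s \<in> {0<..}"
      then have s: "s > 0" by simp
      show "ip (\<lambda>x. G1 x s) f - ip (\<lambda>x. G2 x s) f = ip (\<lambda>x. G1 x s - G2 x s) f"
        by (rule ip_diff_left[OF L2_pathD[OF P(1) s] L2_pathD[OF P(2) s] Lf, symmetric])
    qed (use t in auto)
  qed
  then show ?thesis by (rule that)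
qed

theorem theorem3p3:
  fixes lam p :: real and G0 :: "real \<Rightarrow> real" and G1 G2 :: "real \<Rightarrow> real \<Rightarrow> real"
  assumes "lam > 0"
    and "L2 G0"
    and "is_weak_solution lam G0 p G1"
    and "is_weak_solution lam G0 p G2"
  shows "\<forall>t>0. AE x in lebesgue_on I. G1 x t = G2 x t"
proof (intro allI impI)
  fix t :: real assume t: "t > 0"
  obtain N where N: "null_solution lam (\<lambda>x t. G1 x t - G2 x t) N"
    using weak_solution_difference[OF assms(1,3,4)] by blast
  interpret null_solution lam "\<lambda>x t. G1 x t - G2 x t" N by (rule N)
  have P: "L2_path G1" "L2_path G2" using assms by (auto simp: is_weak_solution_def L2_path_def)
  have "((\<lambda>s. L2_norm (\<lambda>x. G1 x s - G2 x s)) \<longlongrightarrow> 0) (at_right 0)"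
  proof (rule Lim_null_comparison)
    have "((\<lambda>s. L2_norm (\<lambda>x. G1 x s - G0 x) + L2_norm (\<lambda>x. G2 x s - G0 x)) \<longlongrightarrow> 0 + 0) (at_right 0)"
      using assms(3,4) unfolding is_weak_solution_def by (intro tendsto_add) auto
    then show "((\<lambda>s. L2_norm (\<lambda>x. G1 x s - G0 x) + L2_norm (\<lambda>x. G2 x s - G0 x)) \<longlongrightarrow> 0) (at_right 0)" by simp
    show "\<forall>\<^sub>F s in at_right 0. norm (L2_norm (\<lambda>x. G1 x s - G2 x s)) \<le> L2_norm (\<lambda>x. G1 x s - G0 x) + L2_norm (\<lambda>x. G2 x s - G0 x)"
      unfolding eventually_at_right_field
    proof (intro exI[of _ 1] conjI allI impI)
      fix s :: real assume s: "s > 0"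
      have "(\<lambda>x. G1 x s - G2 x s) = (\<lambda>x. (G1 x s - G0 x) - (G2 x s - G0 x))" by auto
      then show "norm (L2_norm (\<lambda>x. G1 x s - G2 x s)) \<le> L2_norm (\<lambda>x. G1 x s - G0 x) + L2_norm (\<lambda>x. G2 x s - G0 x)"
        using L2_norm_diff_le[OF L2_diff[OF L2_pathD[OF P(1) s] assms(2)] L2_diff[OF L2_pathD[OF P(2) s] assms(2)]] L2_norm_nonneg
        by simp
    qed simp
  qed
  then have "AE x in lebesgue_on I. G1 x t - G2 x t = 0"
    by (intro moments_determine L2_W[OF t] moments_zero t)
  then show "AE x in lebesgue_on I. G1 x t = G2 x t" by simp
qed

end
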